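(* Let $Y=\{Y(t),t\geqslant 0\}$ be a spectrally negative Lévy process, i.e., a real-valued Lévy process without upward jumps, whose paths are not almost surely non-increasing. Let $\Phi(\alpha)=\log\mathbb{E}\,e^{\alpha Y(1)}$, $\alpha\geqslant 0$, and let $\Psi(q)=\sup\{\alpha\geqslant 0:\Phi(\alpha)=q\}$, $q\geqslant 0$, be its right-inverse. Let $\omega>0$ and $\beta\geqslant 0$; if $\beta=0$, assume in addition that $\mathbb{E}\,Y(1)<0$. Let $Y_{\beta,\omega}$ be the running maximum of $Y$ at Poisson($\omega$) inspection epochs until the exponential($\beta$) killing time (as defined in the context). Then, for $\alpha\geqslant 0$, $$\mathbb{E}\,e^{-\alpha Y_{\beta,\omega}}=\frac{\Psi(\beta)}{\Psi(\beta)+\alpha}\,\frac{\Psi(\beta+\omega)+\alpha}{\Psi(\beta+\omega)}.$$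
   Context: $Y(0)=0$. The process $Y$ is inspected at the epochs $0=I_0<I_1<I_2<\dots$ of a Poisson process of intensity $\omega$, independent of $Y$, until an independent exponentially distributed killing time $T_\beta$ with parameter $\beta$. Let $N_{\beta,\omega}$ be the number of inspections before killing, so $\mathbb{P}(N_{\beta,\omega}=n)=\left(\frac{\omega}{\beta+\omega}\right)^n\frac{\beta}{\beta+\omega}$, $n=0,1,\dots$. Let $Z_1,Z_2,\dots$ be the increments of $Y$ between consecutive inspection epochs, conditioned on the process not having been killed; they are i.i.d., distributed as $Y(T_{\beta+\omega})$ with $T_{\beta+\omega}$ exponential with parameter $\beta+\omega$ and independent of $Y$, and they are independent of $N_{\beta,\omega}$. With $S_0=0$ and $S_n=\sum_{m=1}^n Z_m$, define $Y_{\beta,\omega}:=\max_{0\leqslant n\leqslant N_{\beta,\omega}}S_n$. (Equivalently, in law, $Y_{\beta,\omega}$ is the maximum of $Y(I_n)$ over all $n\geqslant 0$ with $I_n\leqslant T_\beta$.) For $\beta=0$ we use the convention $T_0=\infty$, $N_{0,\omega}=\infty$, so that $Y_{0,\omega}=\sup_{n\geqslant 0}S_n$. *)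

theory Defs
  imports "HOL-Probability.Probability"
begin

text \<open>Only the times \<open>t \<ge> 0\<close> of a process \<open>Y :: real \<Rightarrow> 'a \<Rightarrow> real\<close> are meaningful. All paths are
  required to be right-continuous with left limits (not merely almost all of them), so that
  \<open>Y\<close> evaluated at a random time is a random variable even when \<open>M\<close> is not complete.\<close>

definition cadlag :: "(real \<Rightarrow> real) \<Rightarrow> bool" where
  "cadlag f \<longleftrightarrow>
     (\<forall>t\<ge>0. (f \<longlongrightarrow> f t) (at_right t)) \<and> (\<forall>t>0. \<exists>l. (f \<longlongrightarrow> l) (at_left t))"

definition levy_process :: "'a measure \<Rightarrow> (real \<Rightarrow> 'a \<Rightarrow> real) \<Rightarrow> bool" where
  "levy_process M Y \<longleftrightarrow>
     prob_space M \<and>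
     (\<forall>t\<ge>0. Y t \<in> borel_measurable M) \<and>
     (\<forall>x\<in>space M. Y 0 x = 0) \<and>
     (\<forall>x\<in>space M. cadlag (\<lambda>t. Y t x)) \<and>
     (\<forall>t :: nat \<Rightarrow> real. 0 \<le> t 0 \<and> incseq t \<longrightarrow>
        prob_space.indep_vars M (\<lambda>_. borel) (\<lambda>i x. Y (t (Suc i)) x - Y (t i) x) UNIV) \<and>
     (\<forall>s\<ge>0. \<forall>t\<ge>0. distr M borel (\<lambda>x. Y (s + t) x - Y s x) = distr M borel (Y t))"

definition no_upward_jumps :: "'a measure \<Rightarrow> (real \<Rightarrow> 'a \<Rightarrow> real) \<Rightarrow> bool" where
  "no_upward_jumps M Y \<longleftrightarrow>
     (\<forall>x\<in>space M. \<forall>t>0. Y t x \<le> Lim (at_left t) (\<lambda>s. Y s x))"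

definition spectrally_negative_levy :: "'a measure \<Rightarrow> (real \<Rightarrow> 'a \<Rightarrow> real) \<Rightarrow> bool" where
  "spectrally_negative_levy M Y \<longleftrightarrow>
     levy_process M Y \<and> no_upward_jumps M Y \<and>
     \<not> (AE x in M. \<forall>s t. 0 \<le> s \<and> s \<le> t \<longrightarrow> Y t x \<le> Y s x)"

text \<open>The exponential moments of a spectrally negative Levy process are finite, so the Bochner
  integral below is the true expectation for every \<open>\<alpha> \<ge> 0\<close>.\<close>

definition laplace_exponent :: "'a measure \<Rightarrow> (real \<Rightarrow> 'a \<Rightarrow> real) \<Rightarrow> real \<Rightarrow> real" where
  "laplace_exponent M Y \<alpha> = ln (\<integral>x. exp (\<alpha> * Y 1 x) \<partial>M)"

definition right_inverse_exponent :: "'a measure \<Rightarrow> (real \<Rightarrow> 'a \<Rightarrow> real) \<Rightarrow> real \<Rightarrow> real" where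
  "right_inverse_exponent M Y q = Sup {\<alpha>. 0 \<le> \<alpha> \<and> laplace_exponent M Y \<alpha> = q}"

text \<open>The mean of a spectrally negative Levy process may be \<open>-\<infinity>\<close>, where the Bochner
  integral would be \<open>0\<close>; hence the extended-real expectation.\<close>

definition ext_expectation :: "'a measure \<Rightarrow> ('a \<Rightarrow> real) \<Rightarrow> ereal" where
  "ext_expectation M X =
     enn2ereal (\<integral>\<^sup>+x. ennreal (X x) \<partial>M) - enn2ereal (\<integral>\<^sup>+x. ennreal (- X x) \<partial>M)"

definition exponential_law :: "real \<Rightarrow> real measure" where
  "exponential_law q = density lborel (\<lambda>t. ennreal (exponential_density q t))"

text \<open>The law of \<open>Y\<close> at an independent exponential time with parameter \<open>q\<close>. The truncation only
  affects the null set of negative times, at which \<open>Y\<close> is unconstrained.\<close>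

definition law_at_exponential_time ::
    "'a measure \<Rightarrow> (real \<Rightarrow> 'a \<Rightarrow> real) \<Rightarrow> real \<Rightarrow> real measure" where
  "law_at_exponential_time M Y q =
     distr (M \<Otimes>\<^sub>M exponential_law q) borel (\<lambda>(x, t). Y (max 0 t) x)"

text \<open>As the library's \<open>indep_var\<close>, but for random elements of two different types.\<close>

definition indep_elements ::
    "'a measure \<Rightarrow> 'b measure \<Rightarrow> ('a \<Rightarrow> 'b) \<Rightarrow> 'c measure \<Rightarrow> ('a \<Rightarrow> 'c) \<Rightarrow> bool" where
  "indep_elements M A X B U \<longleftrightarrow>
     X \<in> measurable M A \<and> U \<in> measurable M B \<and>
     prob_space.indep_set M {X -` S \<inter> space M | S. S \<in> sets A} {U -` S \<inter> space M | S. S \<in> sets B}"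

text \<open>The embedded random walk: increments \<open>Z 0, Z 1, \<dots>\<close> and number \<open>N\<close> of inspections, living
  on a probability space \<open>K\<close> of their own. For \<open>\<beta> = 0\<close> every finite value of \<open>N\<close> has
  probability zero, that is, \<open>N = \<infinity>\<close> almost surely.\<close>

definition killed_skeleton ::
    "'a measure \<Rightarrow> (real \<Rightarrow> 'a \<Rightarrow> real) \<Rightarrow> real \<Rightarrow> real \<Rightarrow>
     'b measure \<Rightarrow> (nat \<Rightarrow> 'b \<Rightarrow> real) \<Rightarrow> ('b \<Rightarrow> enat) \<Rightarrow> bool" where
  "killed_skeleton M Y \<beta> \<omega> K Z N \<longleftrightarrow>
     prob_space K \<and>
     prob_space.indep_vars K (\<lambda>_. borel) Z UNIV \<and>
     (\<forall>m. distr K borel (Z m) = law_at_exponential_time M Y (\<beta> + \<omega>)) \<and>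
     (\<forall>n. measure K {x \<in> space K. N x = enat n} = (\<omega> / (\<beta> + \<omega>)) ^ n * (\<beta> / (\<beta> + \<omega>))) \<and>
     indep_elements K (PiM UNIV (\<lambda>_. borel)) (\<lambda>x m. Z m x) (count_space UNIV) N"

text \<open>The suprema below are over finite sets if \<open>\<beta> > 0\<close>, and over sets bounded above if \<open>\<beta> = 0\<close>
  and the mean is negative, in both cases almost surely.\<close>

definition skeleton_max :: "(nat \<Rightarrow> 'b \<Rightarrow> real) \<Rightarrow> ('b \<Rightarrow> enat) \<Rightarrow> 'b \<Rightarrow> real" where
  "skeleton_max Z N x = (SUP n\<in>{n. enat n \<le> N x}. \<Sum>m<n. Z m x)"

definition killing_law :: "real \<Rightarrow> ereal measure" where
  "killing_law \<beta> = (if \<beta> = 0 then return borel \<infinity> else distr (exponential_law \<beta>) borel ereal)"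

text \<open>Inspection epochs and killing time on the space of \<open>Y\<close> itself. The two final conditions
  amount to the mutual independence of the process, the epochs and the killing time.\<close>

definition poisson_inspection ::
    "'a measure \<Rightarrow> (real \<Rightarrow> 'a \<Rightarrow> real) \<Rightarrow> real \<Rightarrow> real \<Rightarrow>
     (nat \<Rightarrow> 'a \<Rightarrow> real) \<Rightarrow> ('a \<Rightarrow> ereal) \<Rightarrow> bool" where
  "poisson_inspection M Y \<beta> \<omega> I T \<longleftrightarrow>
     (\<forall>x\<in>space M. I 0 x = 0 \<and> strict_mono (\<lambda>n. I n x)) \<and>
     prob_space.indep_vars M (\<lambda>_. borel) (\<lambda>n x. I (Suc n) x - I n x) UNIV \<and>
     (\<forall>n. distr M borel (\<lambda>x. I (Suc n) x - I n x) = exponential_law \<omega>) \<and>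
     distr M borel T = killing_law \<beta> \<and>
     indep_elements M
       (PiM {0..} (\<lambda>_. borel)) (\<lambda>x. \<lambda>t\<in>{0..}. Y t x)
       (PiM UNIV (\<lambda>_. borel)) (\<lambda>x n. I n x) \<and>
     indep_elements M
       (PiM {0..} (\<lambda>_. borel) \<Otimes>\<^sub>M PiM UNIV (\<lambda>_. borel))
       (\<lambda>x. (\<lambda>t\<in>{0..}. Y t x, \<lambda>n. I n x))
       borel T"

definition inspected_max ::
    "(real \<Rightarrow> 'a \<Rightarrow> real) \<Rightarrow> (nat \<Rightarrow> 'a \<Rightarrow> real) \<Rightarrow> ('a \<Rightarrow> ereal) \<Rightarrow> 'a \<Rightarrow> real" where
  "inspected_max Y I T x = (SUP n\<in>{n. ereal (I n x) \<le> T x}. Y (I n x) x)"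

end

(* Sampling at an independent exponential time with parameter q, the law of Y has an exponential
   upper tail with rate kappa: since Y cannot jump upwards it passes a level b > 0 continuously, and
   the strong Markov property at that passage time tau_b, obtained as a limit of first passages on
   dyadic grids, gives P(Z >= b + t) = E exp(-q tau_b) P(Z >= t). Hence b |-> E exp(-q tau_b)
   is multiplicative, so it is exp(-kappa b). This yields all exponential moments, and comparing the
   two expressions for E exp(alpha Z) identifies kappa with the right inverse at q = beta + omega.

   The maximum of the killed walk is then found without fluctuation theory. Let H x be 1 for x < 0 and
   (1 - Psi beta / Psi q) exp(-Psi beta x) for x >= 0. The exponential tail makes H harmonic:
   (omega / q) E H (x - Z) = H x for x >= 0. Unfolding this equation n times expresses H x
   as the probability that the killed walk exceeds x within n steps, plus a remainder that is
   geometrically small by an exponential moment with a smaller exponent, where the Laplace exponent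
   is below beta. *)
theory Submission
  imports Defs
begin

text \<open>The form of \<open>H\<close> is read off the answer: the claimed transform belongs to
  the mixture of an atom at 0 of mass \<Psi>(\<beta>) / \<Psi>(q) and an exponential law of rate
  \<Psi>(\<beta>), and \<open>H\<close> is the tail of this mixture. Harmonicity is not yet enough,
  since the remainder has to vanish. At the exponent \<Psi>(\<beta>) the discounted exponential of
  the walk is a martingale and does not decay, so an exponent with \<Phi> strictly below \<beta> is
  required; its existence is where \<beta> > 0, or the negative mean for \<beta> = 0, enters.
  Finiteness of exponential moments is not presupposed. It comes from the tail: the rate kappa grows
  beyond any bound with q. The random walk with its own geometric clock and the epochs living on the
  space of \<open>Y\<close> share one argument. All it needs is that survival of k steps together
  with events for these steps has probability p^k times a product of step laws, p = \<omega> / q.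
  For the epochs this holds because damping the exponential(\<omega>) density by the survival factor
  exp(-\<beta> t) gives p times the exponential(q) density.\<close>

section \<open>Multiplicative and convex functions\<close>

text \<open>Additivity and nonnegativity make \<open>f\<close> monotone. Squeezing its value at a
  large multiple of \<open>x\<close> between those at the neighbouring integers bounds that multiple
  of the defect by \<open>f 1\<close>, so the defect is 0.\<close>

lemma mono_additive_on_pos_linear:
  fixes f :: "real \<Rightarrow> real"
  assumes add: "\<And>x y. 0 < x \<Longrightarrow> 0 < y \<Longrightarrow> f (x + y) = f x + f y"
    and nonneg: "\<And>x. 0 < x \<Longrightarrow> 0 \<le> f x" and x: "0 < x"
  shows "f x = x * f 1"
proof -
  have mult: "f (real (Suc n) * y) = real (Suc n) * f y" if "0 < y" for n y
  proof (induction n)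
    case (Suc n)
    have "f (real (Suc (Suc n)) * y) = f (real (Suc n) * y + y)"
      by (simp add: algebra_simps)
    also have "\<dots> = f (real (Suc n) * y) + f y"
      using that by (intro add) auto
    finally show ?case using Suc by (simp add: algebra_simps)
  qed simp
  have mono: "f y \<le> f z" if "0 < y" "y \<le> z" for y z
  proof (cases "y = z")
    case False
    then have "f z = f y + f (z - y)" using add[of y "z - y"] that by simp
    then show ?thesis using nonneg[of "z - y"] that False by simp
  qed simp
  \<comment> \<open>For a multiple of \<open>x\<close> below 1 the floor would be 0, outside the
    domain of additivity.\<close>
  have "real (Suc n) * \<bar>f x - x * f 1\<bar> \<le> f 1" if n: "real (Suc n) * x \<ge> 1" for n
  proof -
    define k where "k = nat \<lfloor>real (Suc n) * x\<rfloor>"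
    have k: "real k \<le> real (Suc n) * x" "real (Suc n) * x \<le> real (Suc k)" "k \<ge> 1"
      using n x by (auto simp: k_def le_nat_iff le_floor_iff) linarith+
    then obtain j where j: "k = Suc j" by (cases k) auto
    have "real k * f 1 \<le> real (Suc n) * f x"
      using mono[of "real k * 1" "real (Suc n) * x"] k mult[of 1 j] mult[of x n] x by (simp add: j)
    moreover have "real (Suc n) * f x \<le> real (Suc k) * f 1"
      using mono[of "real (Suc n) * x" "real (Suc k) * 1"] k mult[of 1 k] mult[of x n] x by simp
    moreover have "real k * f 1 \<le> (real (Suc n) * x) * f 1" "(real (Suc n) * x) * f 1 \<le> real (Suc k) * f 1"
      using k nonneg[of 1] by (intro mult_right_mono; simp)+
    ultimately have "\<bar>real (Suc n) * f x - (real (Suc n) * x) * f 1\<bar> \<le> f 1"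
      by (simp add: algebra_simps abs_le_iff)
    then show ?thesis
      by (simp only: mult.assoc right_diff_distrib[symmetric] abs_mult abs_of_nat)
  qed
  then have bound: "\<bar>f x - x * f 1\<bar> * real (Suc n) \<le> f 1" if "n \<ge> nat \<lceil>1 / x\<rceil>" for n
  proof -
    have "real (Suc n) * x \<ge> 1"
      using that x by (simp add: field_simps nat_le_iff ceiling_le_iff)
    then show ?thesis
      using \<open>\<And>n. 1 \<le> real (Suc n) * x \<Longrightarrow> _\<close>[of n] by (simp add: mult.commute)
  qed
  show ?thesis
  proof (rule ccontr)
    assume "f x \<noteq> x * f 1"
    then have pos: "\<bar>f x - x * f 1\<bar> > 0" by simp
    obtain n where "f 1 / \<bar>f x - x * f 1\<bar> < real n" using reals_Archimedean2 by blast
    then have n: "f 1 < \<bar>f x - x * f 1\<bar> * real n" using pos by (simp add: field_simps)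
    define N where "N = n + nat \<lceil>1 / x\<rceil>"
    have "\<bar>f x - x * f 1\<bar> * real n \<le> \<bar>f x - x * f 1\<bar> * real (Suc N)"
      by (intro mult_left_mono) (auto simp: N_def)
    then show False using bound[of N] n by (simp add: N_def)
  qed
qed

text \<open>The bound by 1 takes the place of continuity: it makes \<open>- ln \<phi>\<close>
  nonnegative, hence linear. One positive value suffices for the logarithm to make sense, because a
  zero would propagate to all larger arguments and multiples of \<open>x0\<close> are arbitrarily
  large.\<close>

lemma multiplicative_on_pos_exp:
  fixes \<phi> :: "real \<Rightarrow> real"
  assumes mult: "\<And>x y. 0 < x \<Longrightarrow> 0 < y \<Longrightarrow> \<phi> (x + y) = \<phi> x * \<phi> y"
    and bounds: "\<And>x. 0 < x \<Longrightarrow> 0 \<le> \<phi> x \<and> \<phi> x \<le> 1" and pos: "0 < x0" "0 < \<phi> x0"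
  obtains \<kappa> where "0 \<le> \<kappa>" "\<And>x. 0 < x \<Longrightarrow> \<phi> x = exp (- \<kappa> * x)"
proof -
  have less: "0 < \<phi> y" if "0 < y" "y < z" "0 < \<phi> z" for y z
    using mult[of y "z - y"] that bounds[of y]
    by (metis add_diff_cancel_left' diff_gt_0_iff_gt le_less mult_zero_left add.commute diff_add_cancel)
  have pow: "0 < \<phi> (real (Suc n) * x0)" for n
  proof (induction n)
    case (Suc n)
    have "\<phi> (real (Suc (Suc n)) * x0) = \<phi> (real (Suc n) * x0 + x0)"
      by (simp add: algebra_simps)
    also have "\<dots> = \<phi> (real (Suc n) * x0) * \<phi> x0"
      using pos by (intro mult) auto
    finally show ?case using Suc pos by simp
  qed (use pos in simp)
  have gt0: "0 < \<phi> x" if "0 < x" for x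
  proof -
    obtain n where "x / x0 < real n" using reals_Archimedean2 by blast
    then have "x < real (Suc n) * x0" using pos by (simp add: field_simps)
    then show ?thesis using less that pow by blast
  qed
  have "- ln (\<phi> x) = x * (- ln (\<phi> 1))" if "0 < x" for x
  proof (rule mono_additive_on_pos_linear[where f = "\<lambda>x. - ln (\<phi> x)"])
    show "- ln (\<phi> (x + y)) = - ln (\<phi> x) + - ln (\<phi> y)" if "0 < x" "0 < y" for x y
      using that gt0[of x] gt0[of y] by (simp add: mult ln_mult)
  qed (use gt0 bounds that in \<open>auto simp: ln_le_zero_iff\<close>)
  then have "\<phi> x = exp (- (- ln (\<phi> 1)) * x)" if "0 < x" for x
    using gt0[OF that] that by (metis exp_ln minus_equation_iff mult.commute mult_minus_left)
  moreover have "0 \<le> - ln (\<phi> 1)" using gt0[of 1] bounds[of 1] by simp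
  ultimately show ?thesis by (rule that[rotated])
qed

text \<open>The level \<open>q\<close> may also be attained left of \<open>t\<close>, as the Laplace
  exponent does at 0 for \<open>q = 0\<close>. Starting from a point strictly below the level
  isolates the last crossing, which is the supremum.\<close>

lemma convex_right_inverse:
  fixes \<Phi> :: "real \<Rightarrow> real"
  assumes convex: "convex_on {0..} \<Phi>" and t: "0 < t" "\<Phi> t < q" and b: "t < b" "q \<le> \<Phi> b"
  defines "P \<equiv> Sup {\<alpha>. 0 \<le> \<alpha> \<and> \<Phi> \<alpha> = q}"
  shows "t < P" "\<Phi> P = q" "\<And>\<alpha>. P < \<alpha> \<Longrightarrow> q < \<Phi> \<alpha>"
    "\<And>\<alpha>. \<lbrakk>t \<le> \<alpha>; \<alpha> < P\<rbrakk> \<Longrightarrow> \<Phi> \<alpha> < q"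
proof -
  have comb: "\<Phi> y \<le> (z - y) / (z - x) * \<Phi> x + (y - x) / (z - x) * \<Phi> z"
    if "0 \<le> x" "x < y" "y < z" for x y z
  proof -
    have "(z - y) * x + (y - x) * z = y * (z - x)"
      by (simp add: algebra_simps)
    then have "(z - y) / (z - x) * x + (y - x) / (z - x) * z = y"
      using that by (simp add: add_divide_distrib[symmetric] nonzero_divide_eq_eq)
    moreover have "(z - y) / (z - x) + (y - x) / (z - x) = 1"
      using that by (simp add: add_divide_distrib[symmetric])
    ultimately show ?thesis
      using convex[unfolded convex_on_def, THEN conjunct2, rule_format,
          of x z "(z - y) / (z - x)" "(y - x) / (z - x)"] that by simp
  qed
  \<comment> \<open>A convex function may jump at the endpoint 0; the interval used below starts at
    \<open>t > 0\<close>.\<close>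
  have cont: "continuous_on {0<..} \<Phi>"
    by (rule convex_on_continuous) (use convex in \<open>auto intro: convex_on_subset\<close>)
  \<comment> \<open>If the level were not exceeded at \<open>z\<close>, convexity between
    \<open>t\<close> and \<open>z\<close> would put the value at \<open>y\<close> strictly below
    \<open>q\<close>, as the value at \<open>t\<close> is.\<close>
  have above: "q < \<Phi> z" if "t < y" "q \<le> \<Phi> y" "y < z" for y z
  proof (rule ccontr)
    assume "\<not> q < \<Phi> z"
    have "q \<le> (z - y) / (z - t) * \<Phi> t + (y - t) / (z - t) * \<Phi> z"
      using comb[of t y z] that t by simp
    also have "\<dots> < (z - y) / (z - t) * q + (y - t) / (z - t) * q"
      using that t \<open>\<not> q < \<Phi> z\<close> by (intro add_less_le_mono mult_strict_left_mono mult_left_mono) auto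
    also have "\<dots> = q"
      using that by (simp add: divide_simps) (simp add: algebra_simps)
    finally show False by simp
  qed
  have "continuous_on {t..b} \<Phi>"
    by (rule continuous_on_subset[OF cont]) (use t in auto)
  then obtain a where a: "t \<le> a" "a \<le> b" "\<Phi> a = q"
    using IVT'[of \<Phi> t q b] t b by auto
  then have "t < a" using t by (cases "t = a") auto
  have "z \<le> a" if "\<Phi> z = q" for z
    using above[of a z] \<open>t < a\<close> a that by (cases "z \<le> a") auto
  then have P: "P = a"
    unfolding P_def using a t by (intro cSup_eq_maximum) auto
  show "t < P" "\<Phi> P = q" using P a \<open>t < a\<close> by auto
  show "q < \<Phi> \<alpha>" if "P < \<alpha>" for \<alpha>
    using above[of a \<alpha>] that \<open>t < a\<close> a P by simp
  show "\<Phi> \<alpha> < q" if "t \<le> \<alpha>" "\<alpha> < P" for \<alpha>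
    using above[of \<alpha> a] that t a P by (cases "t = \<alpha>") force+
qed

section \<open>Exponential laws\<close>

lemma prob_space_exponential_law: "0 < q \<Longrightarrow> prob_space (exponential_law q)"
  unfolding exponential_law_def by (rule prob_space_exponential_density)

lemma sets_exponential_law [simp, measurable_cong]: "sets (exponential_law q) = sets borel"
  by (simp add: exponential_law_def)

lemma space_exponential_law [simp]: "space (exponential_law q) = UNIV"
  by (simp add: exponential_law_def)

lemma nn_integral_exponential_law:
  assumes [measurable]: "f \<in> borel_measurable borel"
  shows "(\<integral>\<^sup>+t. f t \<partial>exponential_law q) =
    (\<integral>\<^sup>+t. ennreal (exponential_density q t) * f t \<partial>lborel)"
  unfolding exponential_law_def by (subst nn_integral_density) auto

lemma AE_exponential_law_nonneg: "AE t in exponential_law q. 0 \<le> t"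
  unfolding exponential_law_def
  by (subst AE_density) (auto simp: exponential_density_def intro!: AE_I2)

lemma emeasure_exponential_law_greaterThan:
  assumes "0 < q"
  shows "emeasure (exponential_law q) {x<..} = ennreal (exp (- q * max 0 x))"
proof -
  interpret prob_space "exponential_law q" using assms by (rule prob_space_exponential_law)
  have D: "distributed (exponential_law q) lborel (\<lambda>x. x) (exponential_density q)"
    unfolding distributed_def using assms
    by (auto simp: exponential_law_def exponential_density_nonneg distr_id2)
  show ?thesis
  proof (cases "0 \<le> x")
    case True
    then have "prob {x<..} = exp (- x * q)"
      using exponential_distributedD_gt[OF D True assms] by (simp add: greaterThan_def)
    with True show ?thesis by (simp add: emeasure_eq_measure max_def mult.commute)
  next
    case False
    have "AE t in exponential_law q. t \<in> {x<..}"
      using AE_exponential_law_nonneg[of q] by (rule eventually_mono) (use False in auto)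
    then have "prob {x<..} = 1" by (simp add: prob_eq_1)
    with False show ?thesis by (simp add: emeasure_eq_measure max_def)
  qed
qed

text \<open>Exponential tilting with \<open>a\<close> of either sign: positive for moments of an
  overshoot, negative for Laplace transforms and for the survival of an interval under
  killing.\<close>

lemma nn_integral_exp_exponential_law:
  assumes q: "0 < q" "a < q" and [measurable]: "f \<in> borel_measurable borel"
  shows "(\<integral>\<^sup>+t. ennreal (exp (a * t)) * f t \<partial>exponential_law q) =
    ennreal (q / (q - a)) * (\<integral>\<^sup>+t. f t \<partial>exponential_law (q - a))"
proof -
  have "ennreal (exponential_density q t) * (ennreal (exp (a * t)) * f t) =
      ennreal (q / (q - a)) * (ennreal (exponential_density (q - a) t) * f t)" for t
  proof (cases "t < 0")
    case False
    have "exp (- t * q) * exp (a * t) = exp (- t * (q - a))"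
      by (simp add: exp_add[symmetric] algebra_simps)
    then have "q * exp (- t * q) * exp (a * t) = q / (q - a) * ((q - a) * exp (- t * (q - a)))"
      using q by simp
    with False q show ?thesis
      by (simp add: exponential_density_def mult.assoc[symmetric] ennreal_mult[symmetric] del: times_divide_eq_left times_divide_eq_right nonzero_mult_div_cancel_left)
  qed (simp add: exponential_density_def)
  then show ?thesis
    by (simp add: nn_integral_exponential_law nn_integral_cmult)
qed

lemma nn_integral_exp_exponential_law_finite:
  assumes q: "0 < q" "a < q"
  shows "(\<integral>\<^sup>+t. ennreal (exp (a * t)) \<partial>exponential_law q) = ennreal (q / (q - a))"
proof -
  interpret prob_space "exponential_law (q - a)" using q by (intro prob_space_exponential_law) simp
  show ?thesis
    using nn_integral_exp_exponential_law[OF q, of "\<lambda>_. 1"] emeasure_space_1 by simp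
qed

text \<open>The boundary case \<open>a = q\<close> already diverges: density times exponential is at
  least the constant \<open>q\<close> on the half-line.\<close>

lemma nn_integral_exp_exponential_law_infinite:
  assumes q: "0 < q" "q \<le> a"
  shows "(\<integral>\<^sup>+t. ennreal (exp (a * t)) \<partial>exponential_law q) = \<infinity>"
proof -
  have "(\<integral>\<^sup>+(t::real). ennreal q * indicator {0..} t \<partial>lborel) \<le>
      (\<integral>\<^sup>+t. ennreal (exponential_density q t) * ennreal (exp (a * t)) \<partial>lborel)"
    using q by (intro nn_integral_mono) (auto simp: exponential_density_def indicator_def
        ennreal_mult[symmetric] exp_add[symmetric] mult.assoc algebra_simps intro!: ennreal_leI mult_left_mono)
  moreover have "(\<integral>\<^sup>+(t::real). ennreal q * indicator {0..} t \<partial>lborel) = \<infinity>"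
  proof -
    have "of_nat n \<le> emeasure lborel {0::real..}" for n
      using emeasure_mono[of "{0..real n}" "{0..}" lborel] by (simp add: ennreal_of_nat_eq_real_of_nat)
    then have "emeasure lborel {0::real..} = \<infinity>"
      by (metis ennreal_Ex_less_of_nat infinity_ennreal_def not_less top.not_eq_extremum)
    then show ?thesis using q by (simp add: nn_integral_cmult_indicator ennreal_mult_top)
  qed
  ultimately show ?thesis
    by (subst nn_integral_exponential_law) (auto simp: top_unique)
qed

text \<open>Rays determine a measure on the line, so the tails identify the part of \<mu> on the
  positive axis, whatever \<mu> does elsewhere.\<close>

lemma nn_integral_exponential_tail:
  assumes "prob_space \<mu>" and sets_mu [measurable_cong, simp]: "sets \<mu> = sets borel" and "0 < \<kappa>" "0 \<le> c"
    and tail: "\<And>x. 0 \<le> x \<Longrightarrow> measure \<mu> {x<..} = c * exp (- \<kappa> * x)"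
    and [measurable]: "f \<in> borel_measurable borel"
  shows "(\<integral>\<^sup>+z. f z * indicator {0<..} z \<partial>\<mu>) = ennreal c * (\<integral>\<^sup>+t. f t \<partial>exponential_law \<kappa>)"
proof -
  interpret prob_space \<mu> by fact
  have space: "space \<mu> = UNIV" using sets_eq_imp_space_eq[OF sets_mu] by simp
  have "density \<mu> (indicator {0<..}) = density (exponential_law \<kappa>) (\<lambda>_. ennreal c)"
  proof (rule measure_eqI_lessThan)
    fix x :: real
    have "emeasure (density \<mu> (indicator {0<..})) {x<..} = emeasure \<mu> ({0<..} \<inter> {x<..})"
      by (subst emeasure_density) (auto simp: indicator_inter_arith[symmetric] intro!: nn_integral_indicator)
    also have "{0<..} \<inter> {x<..} = {max 0 x<..}" by auto
    finally have *: "emeasure (density \<mu> (indicator {0<..})) {x<..} = ennreal (c * exp (- \<kappa> * max 0 x))"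
      by (simp add: emeasure_eq_measure tail)
    then show "emeasure (density \<mu> (indicator {0<..})) {x<..} < \<infinity>" by simp
    have "emeasure (density (exponential_law \<kappa>) (\<lambda>_. ennreal c)) {x<..} =
        ennreal c * emeasure (exponential_law \<kappa>) {x<..}"
      by (subst emeasure_density) (auto simp: nn_integral_cmult_indicator)
    with * show "emeasure (density \<mu> (indicator {0<..})) {x<..} =
        emeasure (density (exponential_law \<kappa>) (\<lambda>_. ennreal c)) {x<..}"
      using assms by (simp add: emeasure_exponential_law_greaterThan ennreal_mult)
  qed auto
  then have "(\<integral>\<^sup>+z. f z \<partial>density \<mu> (indicator {0<..})) =
      (\<integral>\<^sup>+z. f z \<partial>density (exponential_law \<kappa>) (\<lambda>_. ennreal c))" by simp
  then show ?thesis
    by (subst (asm) (1 2) nn_integral_density) (auto simp: nn_integral_cmult mult.commute)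
qed

section \<open>Walks with an exponential upper tail\<close>

text \<open>Phrased by increments, and only by those below \<open>k\<close>, so that one event
  serves both the random walk and the Levy process on a grid, each described on a finite
  product.\<close>

definition first_cross :: "nat \<Rightarrow> real \<Rightarrow> (nat \<Rightarrow> real) \<Rightarrow> bool" where
  "first_cross k x z \<longleftrightarrow> (\<forall>i<k. (\<Sum>l<i. z l) \<le> x) \<and> x < (\<Sum>l<k. z l)"

lemma partial_sum_measurable:
  fixes i k :: nat
  shows "i \<le> k \<Longrightarrow> (\<lambda>z. \<Sum>l<i. z l) \<in> borel_measurable (PiM {..<k} (\<lambda>_. borel :: real measure))"
  by (intro borel_measurable_sum measurable_component_singleton) (auto intro: less_le_trans)

lemma indicator_first_cross_measurable [measurable]:
  "(indicator {z. first_cross k x z} :: _ \<Rightarrow> ennreal) \<in> borel_measurable (PiM {..<k} (\<lambda>_. borel))"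
proof -
  note partial_sum_measurable[measurable]
  have "Measurable.pred (PiM {..<k} (\<lambda>_. borel)) (first_cross k x)"
    unfolding first_cross_def Ball_def[symmetric] lessThan_iff[symmetric]
    by (intro pred_intros_logic pred_intros_finite) auto
  then show ?thesis by simp
qed

text \<open>To be used with \<open>lam\<close> = \<Psi>(\<beta> + \<omega>), \<theta> =
  \<Psi>(\<beta>) and \<open>p\<close> the survival probability of one step. By \<open>mgf\<close>,
  p^n exp(\<theta> S_n) is a martingale.\<close>

locale exp_tail_walk =
  fixes \<mu> :: "real measure" and c lam \<theta> p :: real
  assumes prob_mu: "prob_space \<mu>" and sets_mu [measurable_cong, simp]: "sets \<mu> = sets borel"
    and tail: "\<And>x. 0 \<le> x \<Longrightarrow> measure \<mu> {x<..} = c * exp (- lam * x)"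
    and \<theta>: "0 < \<theta>" "\<theta> < lam" and p: "0 < p"
    and mgf: "(\<integral>\<^sup>+z. ennreal (exp (\<theta> * z)) \<partial>\<mu>) = ennreal (1 / p)"
begin

sublocale mu: prob_space \<mu> by (rule prob_mu)

lemma space_mu [simp]: "space \<mu> = UNIV"
  using sets_eq_imp_space_eq[OF sets_mu] by simp

lemma c_nonneg: "0 \<le> c"
  using tail[of 0] by (metis exp_zero measure_nonneg mult.right_neutral mult_zero_right order_refl)

text \<open>The value forced by harmonicity: 1 / r is the exponential moment of order \<theta> of an
  exponential overshoot with rate \<open>lam\<close>.\<close>

definition r :: real where "r = 1 - \<theta> / lam"

definition H :: "real \<Rightarrow> ennreal" where
  "H x = (if x < 0 then 1 else ennreal (r * exp (- \<theta> * x)))"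

lemma H_measurable [measurable]: "H \<in> borel_measurable borel"
  unfolding H_def[abs_def] by measurable

lemma r_bounds: "0 < r" "r < 1"
  using \<theta> by (auto simp: r_def)

text \<open>For steps up to \<open>x\<close> only the exponential branch occurs, which
  \<open>mgf\<close> makes harmonic. For larger steps the exponential is replaced by 1 without
  changing the integral: the overshoot over \<open>x\<close> is exponential with rate
  \<open>lam\<close>, and \<open>r\<close> is the reciprocal of its moment of order
  \<theta>.\<close>

lemma H_harmonic:
  assumes x: "0 \<le> x"
  shows "ennreal p * (\<integral>\<^sup>+z. H (x - z) \<partial>\<mu>) = H x"
proof -
  let ?g = "\<lambda>z. ennreal (r * exp (- \<theta> * x)) * (ennreal (exp (\<theta> * z)) * indicator {x<..} z)"
  have "indicator {x<..} z = (indicator {x<..} z * indicator {0<..} z :: ennreal)" for z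
    using x by (auto simp: indicator_def)
  then have "(\<integral>\<^sup>+z. ennreal (exp (\<theta> * z)) * indicator {x<..} z \<partial>\<mu>) =
      (\<integral>\<^sup>+z. (ennreal (exp (\<theta> * z)) * indicator {x<..} z) * indicator {0<..} z \<partial>\<mu>)"
    by (simp add: mult.assoc)
  also have "\<dots> = ennreal c * (\<integral>\<^sup>+z. (ennreal (exp (\<theta> * z)) * indicator {x<..} z) \<partial>exponential_law lam)"
    using \<theta> by (intro nn_integral_exponential_tail) (simp_all add: prob_mu tail[simplified] c_nonneg)
  also have "\<dots> = ennreal c * (ennreal (lam / (lam - \<theta>)) * ennreal (exp (- (lam - \<theta>) * x)))"
    using \<theta> x by (subst nn_integral_exp_exponential_law) (auto simp: emeasure_exponential_law_greaterThan)
  finally have "(\<integral>\<^sup>+z. ?g z \<partial>\<mu>) = ennreal (r * exp (- \<theta> * x)) *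
      (ennreal c * (ennreal (lam / (lam - \<theta>)) * ennreal (exp (- (lam - \<theta>) * x))))"
    by (simp add: nn_integral_cmult)
  also have "\<dots> = ennreal (c * exp (- lam * x))"
    using \<theta> c_nonneg r_bounds
  proof -
    have "r * exp (- \<theta> * x) * (c * (lam / (lam - \<theta>) * exp (- (lam - \<theta>) * x))) =
        c * (r * (lam / (lam - \<theta>))) * (exp (- \<theta> * x) * exp (- (lam - \<theta>) * x))"
      by (simp only: ac_simps)
    also have "r * (lam / (lam - \<theta>)) = 1"
      using \<theta> by (simp add: r_def field_simps)
    also have "exp (- \<theta> * x) * exp (- (lam - \<theta>) * x) = exp (- lam * x)"
      by (simp add: exp_add[symmetric] algebra_simps)
    finally show ?thesis
      using \<theta> c_nonneg r_bounds by (simp add: ennreal_mult[symmetric])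
  qed
  finally have g: "(\<integral>\<^sup>+z. ?g z \<partial>\<mu>) = ennreal (c * exp (- lam * x))" .
  \<comment> \<open>The surplus \<open>?g\<close> is added on both sides rather than subtracted in
    \<open>ennreal\<close>; its integral is finite by \<open>g\<close>, so it cancels.\<close>
  have "H (x - z) + ?g z = ennreal (r * exp (- \<theta> * x)) * ennreal (exp (\<theta> * z)) + indicator {x<..} z" for z
  proof (cases "x < z")
    case True
    then show ?thesis by (simp add: H_def add.commute)
  next
    case False
    have "exp (- \<theta> * (x - z)) = exp (- \<theta> * x) * exp (\<theta> * z)"
      by (simp add: exp_add[symmetric] algebra_simps)
    with False show ?thesis
      using r_bounds by (simp add: H_def ennreal_mult[symmetric] mult.assoc)
  qed
  then have "(\<integral>\<^sup>+z. H (x - z) \<partial>\<mu>) + (\<integral>\<^sup>+z. ?g z \<partial>\<mu>) =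
      (\<integral>\<^sup>+z. ennreal (r * exp (- \<theta> * x)) * ennreal (exp (\<theta> * z)) + indicator {x<..} z \<partial>\<mu>)"
    by (subst nn_integral_add[symmetric]) auto
  also have "\<dots> = ennreal (r * exp (- \<theta> * x)) * ennreal (1 / p) + (\<integral>\<^sup>+z. ?g z \<partial>\<mu>)"
    by (subst nn_integral_add; (subst g)?; simp add: nn_integral_cmult mgf mu.emeasure_eq_measure tail[OF x, simplified])
  finally have "(\<integral>\<^sup>+z. H (x - z) \<partial>\<mu>) = ennreal (r * exp (- \<theta> * x)) * ennreal (1 / p)"
    unfolding g by (subst (asm) (1 2) add.commute) (simp add: ennreal_add_left_cancel)
  then show ?thesis
    using x p r_bounds by (simp add: H_def ennreal_mult[symmetric] divide_simps)
qed

sublocale W: product_sigma_finite "\<lambda>_. \<mu>" ..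

section \<open>Expansion over first crossings\<close>

definition uncrossed :: "nat \<Rightarrow> real \<Rightarrow> (nat \<Rightarrow> real) \<Rightarrow> bool" where
  "uncrossed k x z \<longleftrightarrow> (\<forall>i\<le>k. (\<Sum>l<i. z l) \<le> x)"

abbreviation W :: "nat \<Rightarrow> (nat \<Rightarrow> real) measure" where
  "W k \<equiv> PiM {..<k} (\<lambda>_. \<mu>)"

definition cross_prob :: "nat \<Rightarrow> real \<Rightarrow> ennreal" where
  "cross_prob k x = (\<integral>\<^sup>+z. indicator {z. first_cross k x z} z \<partial>W k)"

definition remainder :: "nat \<Rightarrow> real \<Rightarrow> ennreal" where
  "remainder k x = (\<integral>\<^sup>+z. indicator {z. uncrossed k x z} z * H (x - (\<Sum>l<k. z l)) \<partial>W k)"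

lemma indicator_uncrossed_measurable [measurable]:
  "k \<le> m \<Longrightarrow> (indicator {z. uncrossed k x z} :: _ \<Rightarrow> ennreal) \<in> borel_measurable (PiM {..<m} (\<lambda>_. borel))"
proof -
  assume "k \<le> m"
  note partial_sum_measurable[measurable]
  have "Measurable.pred (PiM {..<m} (\<lambda>_. borel)) (uncrossed k x)"
    unfolding uncrossed_def Ball_def[symmetric] atMost_iff[symmetric]
    using \<open>k \<le> m\<close> by (intro pred_intros_logic pred_intros_finite) auto
  then show ?thesis by simp
qed

lemma measurable_W: "borel_measurable (W k) = borel_measurable (PiM {..<k} (\<lambda>_. borel))"
  by (intro measurable_cong_sets sets_PiM_cong) auto

text \<open>A path uncrossed at time \<open>k\<close> either crosses in the next step, where
  \<open>H\<close> equals 1 and counts it, or stays uncrossed. Both cases together are one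
  application of harmonicity in the last coordinate.\<close>

lemma cross_remainder_step: "ennreal p * (cross_prob (Suc k) x + remainder (Suc k) x) = remainder k x"
proof -
  note partial_sum_measurable[measurable] measurable_W[simp]
  have split: "indicator {z. first_cross (Suc k) x z} z +
      indicator {z. uncrossed (Suc k) x z} z * H (x - (\<Sum>l<Suc k. z l)) =
      indicator {z. uncrossed k x z} z * H (x - (\<Sum>l<Suc k. z l))" for z
    by (auto simp: indicator_def first_cross_def uncrossed_def H_def le_Suc_eq less_Suc_eq_le not_less
        simp del: sum.lessThan_Suc)
  have upd: "(\<Sum>l<i. if l = k then y else z l) = (\<Sum>l<i. z l)" if "i \<le> k" for i y and z :: "nat \<Rightarrow> real"
    using that by (intro sum.cong) auto
  have "cross_prob (Suc k) x + remainder (Suc k) x =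
      (\<integral>\<^sup>+z. indicator {z. uncrossed k x z} z * H (x - (\<Sum>l<Suc k. z l)) \<partial>W (Suc k))"
    unfolding cross_prob_def remainder_def split[symmetric]
    by (subst nn_integral_add) auto
  also have "\<dots> = (\<integral>\<^sup>+z. (\<integral>\<^sup>+y. indicator {z. uncrossed k x z} z * H (x - (\<Sum>l<k. z l) - y) \<partial>\<mu>) \<partial>W k)"
    unfolding lessThan_Suc[of k]
    by (subst W.product_nn_integral_insert)
       (auto simp: indicator_def uncrossed_def upd diff_diff_eq lessThan_Suc[symmetric] simp del: sum.insert
          intro!: nn_integral_cong)
  also have "\<dots> = (\<integral>\<^sup>+z. indicator {z. uncrossed k x z} z * (\<integral>\<^sup>+y. H (x - (\<Sum>l<k. z l) - y) \<partial>\<mu>) \<partial>W k)"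
    by (intro nn_integral_cong nn_integral_cmult) auto
  finally have "ennreal p * (cross_prob (Suc k) x + remainder (Suc k) x) =
      (\<integral>\<^sup>+z. ennreal p * (indicator {z. uncrossed k x z} z * (\<integral>\<^sup>+y. H (x - (\<Sum>l<k. z l) - y) \<partial>\<mu>)) \<partial>W k)"
    by (subst nn_integral_cmult) auto
  also have "\<dots> = remainder k x"
    unfolding remainder_def
    by (intro nn_integral_cong) (auto simp: indicator_def uncrossed_def H_harmonic)
  finally show ?thesis .
qed

lemma cross_prob_sum:
  assumes "0 \<le> x"
  shows "(\<Sum>j\<le>n. ennreal p ^ j * cross_prob j x) + ennreal p ^ n * remainder n x = H x"
proof (induction n)
  case 0
  show ?case
    using assms by (simp add: cross_prob_def remainder_def PiM_empty nn_integral_count_space_finite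
        first_cross_def uncrossed_def)
next
  case (Suc n)
  have "(\<Sum>j\<le>Suc n. ennreal p ^ j * cross_prob j x) + ennreal p ^ Suc n * remainder (Suc n) x =
      (\<Sum>j\<le>n. ennreal p ^ j * cross_prob j x) +
      ennreal p ^ n * (ennreal p * (cross_prob (Suc n) x + remainder (Suc n) x))"
    by (simp add: algebra_simps)
  then show ?case using Suc cross_remainder_step by simp
qed

text \<open>On uncrossed paths the distance to the level is nonnegative, so lowering the exponent
  only increases the exponential. Dropping the constraint then leaves a product of independent
  factors.\<close>

lemma remainder_le:
  assumes "\<theta>' \<le> \<theta>"
  shows "remainder n x \<le> ennreal (r * exp (- \<theta>' * x)) * (\<integral>\<^sup>+z. ennreal (exp (\<theta>' * z)) \<partial>\<mu>) ^ n"
proof -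
  note partial_sum_measurable[measurable] measurable_W[simp]
  have "remainder n x \<le> (\<integral>\<^sup>+z. ennreal (r * exp (- \<theta>' * x)) * (\<Prod>l<n. ennreal (exp (\<theta>' * z l))) \<partial>W n)"
    unfolding remainder_def
  proof (intro nn_integral_mono)
    fix z :: "nat \<Rightarrow> real"
    let ?s = "\<Sum>l<n. z l"
    have "H (x - ?s) \<le> ennreal (r * exp (- \<theta>' * x)) * ennreal (exp (\<theta>' * ?s))" if "?s \<le> x"
    proof -
      have "exp (- \<theta> * (x - ?s)) \<le> exp (- \<theta>' * (x - ?s))"
        using mult_right_mono[OF assms, of "x - ?s"] that by simp
      also have "\<dots> = exp (- \<theta>' * x) * exp (\<theta>' * ?s)"
        by (simp add: exp_add[symmetric] algebra_simps)
      finally show ?thesis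
        using that r_bounds by (simp add: H_def ennreal_mult[symmetric] mult.assoc)
    qed
    moreover have "(\<Prod>l<n. ennreal (exp (\<theta>' * z l))) = ennreal (exp (\<theta>' * ?s))"
      by (simp add: prod_ennreal exp_sum sum_distrib_left)
    ultimately show "indicator {z. uncrossed n x z} z * H (x - ?s) \<le>
        ennreal (r * exp (- \<theta>' * x)) * (\<Prod>l<n. ennreal (exp (\<theta>' * z l)))"
      by (auto simp: indicator_def uncrossed_def)
  qed
  also have "\<dots> = ennreal (r * exp (- \<theta>' * x)) * (\<integral>\<^sup>+z. ennreal (exp (\<theta>' * z)) \<partial>\<mu>) ^ n"
    using W.product_nn_integral_prod[of "{..<n}" "\<lambda>_ z. ennreal (exp (\<theta>' * z))"]
    by (subst nn_integral_cmult) (auto intro!: borel_measurable_prod_ennreal)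
  finally show ?thesis .
qed

text \<open>At \<theta> itself the bound of \<open>remainder_le\<close> is geometric with ratio 1
  and does not decay, hence a second exponent with ratio below 1.\<close>

lemma cross_prob_sums:
  assumes x: "0 \<le> x" and t: "\<theta>' \<le> \<theta>" "ennreal p * (\<integral>\<^sup>+z. ennreal (exp (\<theta>' * z)) \<partial>\<mu>) < 1"
  shows "(\<Sum>j. ennreal p ^ j * cross_prob j x) = H x"
proof -
  let ?m = "ennreal p * (\<integral>\<^sup>+z. ennreal (exp (\<theta>' * z)) \<partial>\<mu>)"
  let ?s = "\<lambda>n. \<Sum>j\<le>n. ennreal p ^ j * cross_prob j x"
  have "?s \<longlonglongrightarrow> (\<Sum>j. ennreal p ^ j * cross_prob j x)"
    by (rule summable_LIMSEQ') simp
  moreover have "(\<lambda>n. ennreal p ^ n * remainder n x) \<longlonglongrightarrow> 0"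
  proof (rule tendsto_sandwich[OF _ _ tendsto_const])
    show "\<forall>\<^sub>F n in sequentially. ennreal p ^ n * remainder n x \<le> ennreal (r * exp (- \<theta>' * x)) * ?m ^ n"
    proof (intro always_eventually allI)
      fix n
      show "ennreal p ^ n * remainder n x \<le> ennreal (r * exp (- \<theta>' * x)) * ?m ^ n"
        using mult_left_mono[OF remainder_le[OF t(1), of n x], of "ennreal p ^ n"]
        by (simp add: power_mult_distrib mult_ac)
    qed
    obtain m where m: "?m = ennreal m" "0 \<le> m" using t(2) by (cases ?m) auto
    then have "m < 1" using t(2) by simp
    then have "(\<lambda>n. ennreal (r * exp (- \<theta>' * x) * m ^ n)) \<longlonglongrightarrow> ennreal (r * exp (- \<theta>' * x) * 0)"
      using m by (intro tendsto_ennrealI tendsto_intros LIMSEQ_realpow_zero) auto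
    then show "(\<lambda>n. ennreal (r * exp (- \<theta>' * x)) * ?m ^ n) \<longlonglongrightarrow> 0"
      unfolding m(1) using m r_bounds by (simp add: ennreal_mult ennreal_power)
  qed simp
  ultimately have "(\<lambda>n. ?s n + ennreal p ^ n * remainder n x) \<longlonglongrightarrow>
      (\<Sum>j. ennreal p ^ j * cross_prob j x) + 0"
    by (rule tendsto_add)
  then have "(\<lambda>n::nat. H x) \<longlonglongrightarrow> (\<Sum>j. ennreal p ^ j * cross_prob j x)"
    unfolding cross_prob_sum[OF x] by simp
  then show ?thesis by (simp add: LIMSEQ_const_iff)
qed

end

text \<open>The supremum of a set without upper bound is a junk value, but always the same one.\<close>

lemma Sup_unbounded: "\<not> bdd_above (X :: real set) \<Longrightarrow> Sup X = Sup UNIV"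
  unfolding Sup_real_def by (rule arg_cong[where f = Least]) (auto simp: bdd_above_def fun_eq_iff
      intro: exI[of _ "_ + 1 :: real"] dest: spec[of _ "_ + 1 :: real"])

text \<open>On \<open>E k\<close> the walk has made at least \<open>k\<close> steps before being killed. Independence of killing
  and steps is not required separately: \<open>law\<close> also fits inspection times, where the length of an
  inspection interval influences both the increment over it and the survival of it.\<close>

locale stopped_walk = exp_tail_walk + prob_space Q
  for Q :: "'a measure" +
  fixes E :: "nat \<Rightarrow> 'a set" and Z :: "nat \<Rightarrow> 'a \<Rightarrow> real" and \<theta>' :: real
  assumes E_sets [measurable]: "\<And>k. E k \<in> sets Q" and E_0: "E 0 = space Q" and E_decseq: "decseq E"
    and Z_measurable [measurable]: "\<And>l. Z l \<in> borel_measurable Q"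
    and law: "\<And>k A. (\<And>l. l < k \<Longrightarrow> A l \<in> sets borel) \<Longrightarrow>
        emeasure Q {x \<in> E k. \<forall>l<k. Z l x \<in> A l} = ennreal p ^ k * (\<Prod>l<k. emeasure \<mu> (A l))"
    and \<theta>': "\<theta>' \<le> \<theta>" "ennreal p * (\<integral>\<^sup>+z. ennreal (exp (\<theta>' * z)) \<partial>\<mu>) < 1"
begin

text \<open>The rectangles in \<open>law\<close> generate the product \<sigma>-algebra, and both
  sides are finite measures, so the joint law of the first \<open>k\<close> steps on
  \<open>E k\<close> is determined.\<close>

lemma law_integral:
  assumes [measurable]: "F \<in> borel_measurable (PiM {..<k} (\<lambda>_. borel))"
  shows "(\<integral>\<^sup>+x. indicator (E k) x * F (\<lambda>l\<in>{..<k}. Z l x) \<partial>Q) = ennreal p ^ k * (\<integral>\<^sup>+z. F z \<partial>W k)"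
proof -
  note measurable_W[simp]
  let ?Z = "\<lambda>x. \<lambda>l\<in>{..<k}. Z l x"
  have [measurable]: "?Z \<in> measurable Q (PiM {..<k} (\<lambda>_. borel))" by measurable
  let ?P = "distr (density Q (indicator (E k))) (PiM {..<k} (\<lambda>_. borel)) ?Z"
  have P: "emeasure ?P (Pi\<^sub>E {..<k} A) = ennreal p ^ k * (\<Prod>l<k. emeasure \<mu> (A l))"
    if A: "\<And>i. i \<in> {..<k} \<Longrightarrow> A i \<in> sets borel" for A
  proof -
    have "Pi\<^sub>E {..<k} A \<in> sets (PiM {..<k} (\<lambda>_. borel))"
      using A by (intro sets_PiM_I_finite) auto
    then have "emeasure ?P (Pi\<^sub>E {..<k} A) = emeasure Q (E k \<inter> (?Z -` Pi\<^sub>E {..<k} A \<inter> space Q))"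
      by (subst emeasure_distr) (auto simp: emeasure_density indicator_inter_arith[symmetric]
          intro!: nn_integral_indicator)
    also have "E k \<inter> (?Z -` Pi\<^sub>E {..<k} A \<inter> space Q) = {x \<in> E k. \<forall>l<k. Z l x \<in> A l}"
      using sets.sets_into_space[OF E_sets[of k]] by (auto simp: PiE_iff)
    also have "emeasure Q {x \<in> E k. \<forall>l<k. Z l x \<in> A l} = ennreal p ^ k * (\<Prod>l<k. emeasure \<mu> (A l))"
      using A by (intro law) auto
    finally show ?thesis .
  qed
  have "?P = density (W k) (\<lambda>_. ennreal p ^ k)"
  proof (rule measure_eqI_PiM_finite)
    show "sets (density (W k) (\<lambda>_. ennreal p ^ k)) = sets (PiM {..<k} (\<lambda>_. borel))"
      by (simp cong: sets_PiM_cong)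
    fix A :: "nat \<Rightarrow> real set" assume A: "\<And>i. i \<in> {..<k} \<Longrightarrow> A i \<in> sets borel"
    then have "emeasure (W k) (Pi\<^sub>E {..<k} A) = (\<Prod>l<k. emeasure \<mu> (A l))"
      by (subst W.emeasure_PiM) auto
    with A show "emeasure ?P (Pi\<^sub>E {..<k} A) = emeasure (density (W k) (\<lambda>_. ennreal p ^ k)) (Pi\<^sub>E {..<k} A)"
      by (subst P) (auto simp: emeasure_density_const sets_PiM_I_finite)
  next
    show "range (\<lambda>_::nat. Pi\<^sub>E {..<k} (\<lambda>_. UNIV :: real set)) \<subseteq> prod_algebra {..<k} (\<lambda>_. borel)"
      by (auto intro!: prod_algebraI_finite)
    show "(\<Union>i::nat. Pi\<^sub>E {..<k} (\<lambda>_. UNIV :: real set)) = space (PiM {..<k} (\<lambda>_. borel))"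
      by (simp add: space_PiM)
    show "emeasure ?P (Pi\<^sub>E {..<k} (\<lambda>_. UNIV)) \<noteq> \<infinity>" for i :: nat
      by (subst P) (auto simp: ennreal_mult_eq_top_iff power_eq_top_ennreal mu.emeasure_space_1[simplified])
  qed auto
  then have "(\<integral>\<^sup>+z. F z \<partial>?P) = (\<integral>\<^sup>+z. F z \<partial>density (W k) (\<lambda>_. ennreal p ^ k))" by simp
  then show ?thesis
    by (simp add: nn_integral_distr nn_integral_density nn_integral_cmult)
qed

abbreviation S :: "nat \<Rightarrow> 'a \<Rightarrow> real" where
  "S n x \<equiv> \<Sum>m<n. Z m x"

text \<open>Decomposition by the first crossing. As \<open>E\<close> decreases, a walk alive at its
  crossing was alive before, and a first crossing at step \<open>k\<close> concerns only
  \<open>E k\<close> and the first \<open>k\<close> steps.\<close>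

lemma crossing_prob:
  assumes x: "0 \<le> x"
  shows "emeasure Q {w \<in> space Q. \<exists>n. w \<in> E n \<and> x < S n w} = H x"
proof -
  let ?C = "\<lambda>k. {w \<in> E k. first_cross k x (\<lambda>l. Z l w)}"
  have E_mono: "w \<in> E n" if "w \<in> E k" "n \<le> k" for w n k
    using E_decseq that by (auto simp: decseq_def)
  have sub: "w \<in> space Q" if "w \<in> E k" for w k
    using sets.sets_into_space[OF E_sets] that by blast
  have C[measurable]: "?C k \<in> sets Q" for k
    unfolding first_cross_def by measurable
  have "{w \<in> space Q. \<exists>n. w \<in> E n \<and> x < S n w} = (\<Union>k. ?C k)" (is "?L = ?R")
  proof
    show "?L \<subseteq> ?R"
    proof
      fix w assume "w \<in> ?L"
      then have ex: "\<exists>n. w \<in> E n \<and> x < S n w" by auto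
      define k where "k = (LEAST n. w \<in> E n \<and> x < S n w)"
      have k: "w \<in> E k \<and> x < S k w" unfolding k_def by (rule LeastI_ex[OF ex])
      moreover have "S i w \<le> x" if "i < k" for i
        using not_less_Least[of i "\<lambda>n. w \<in> E n \<and> x < S n w"] that E_mono[of w k i] k
        unfolding k_def[symmetric] by force
      ultimately show "w \<in> ?R" by (auto simp: first_cross_def)
    qed
  qed (auto simp: first_cross_def dest: sub)
  moreover have "disjoint_family ?C"
  proof -
    have "?C i \<inter> ?C j = {}" if "i < j" for i j
      using that by (force simp: first_cross_def)
    note * = this
    show ?thesis
      unfolding disjoint_family_on_def
    proof (intro ballI impI)
      fix i j :: nat assume "i \<noteq> j"
      then show "?C i \<inter> ?C j = {}"
        using *[of i j] *[of j i] by (cases i j rule: linorder_cases) (simp_all only: Int_commute)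
    qed
  qed
  ultimately have "emeasure Q {w \<in> space Q. \<exists>n. w \<in> E n \<and> x < S n w} = (\<Sum>k. emeasure Q (?C k))"
    using C by (subst suminf_emeasure) auto
  also have "\<dots> = (\<Sum>k. ennreal p ^ k * cross_prob k x)"
  proof (intro suminf_cong)
    fix k
    have "emeasure Q (?C k) = (\<integral>\<^sup>+w. indicator (?C k) w \<partial>Q)" by simp
    also have "\<dots> = (\<integral>\<^sup>+w. indicator (E k) w * indicator {z. first_cross k x z} (\<lambda>l\<in>{..<k}. Z l w) \<partial>Q)"
      by (intro nn_integral_cong) (auto simp: indicator_def first_cross_def)
    also have "\<dots> = ennreal p ^ k * cross_prob k x"
      unfolding cross_prob_def by (rule law_integral) measurable
    finally show "emeasure Q (?C k) = ennreal p ^ k * cross_prob k x" .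
  qed
  also have "(\<Sum>k. ennreal p ^ k * cross_prob k x) = H x"
    by (rule cross_prob_sums[OF x \<theta>'])
  finally show ?thesis .
qed

definition R :: "'a \<Rightarrow> real" where
  "R w = (SUP n\<in>{n. w \<in> E n}. S n w)"

abbreviation "bounded_path w \<equiv> bdd_above ((\<lambda>n. S n w) ` {n. w \<in> E n})"

lemma less_R_iff: "w \<in> space Q \<Longrightarrow> bounded_path w \<Longrightarrow> a < R w \<longleftrightarrow> (\<exists>n. w \<in> E n \<and> a < S n w)"
  unfolding R_def using E_0 by (subst less_cSUP_iff) auto

lemma bounded_path_iff: "bounded_path w \<longleftrightarrow> (\<exists>N::nat. \<forall>n. w \<in> E n \<longrightarrow> S n w \<le> real N)"
proof
  assume "bounded_path w"
  then obtain b where "\<forall>n. w \<in> E n \<longrightarrow> S n w \<le> b" by (auto simp: bdd_above_def)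
  moreover obtain N where "b \<le> real N" using real_arch_simple by blast
  ultimately show "\<exists>N::nat. \<forall>n. w \<in> E n \<longrightarrow> S n w \<le> real N" by (meson order_trans)
qed (auto simp: bdd_above_def)

text \<open>On paths without an upper bound \<open>R\<close> is the fixed value
  \<open>Sup UNIV\<close>, so measurability holds without completeness of \<open>Q\<close>.\<close>

lemma R_measurable [measurable]: "R \<in> borel_measurable Q"
proof (subst borel_measurable_iff_greater, intro allI)
  fix a :: real
  have [measurable]: "Measurable.pred Q bounded_path"
    unfolding bounded_path_iff by measurable
  have "{w \<in> space Q. a < R w} = {w \<in> space Q. (bounded_path w \<and> (\<exists>n. w \<in> E n \<and> a < S n w)) \<or>
      (\<not> bounded_path w \<and> a < Sup UNIV)}"
  proof (intro Collect_cong conj_cong refl)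
    fix w assume "w \<in> space Q"
    then show "a < R w \<longleftrightarrow> (bounded_path w \<and> (\<exists>n. w \<in> E n \<and> a < S n w)) \<or>
        (\<not> bounded_path w \<and> a < Sup UNIV)"
      by (cases "bounded_path w") (simp_all add: less_R_iff, simp add: R_def Sup_unbounded)
  qed
  also have "\<dots> \<in> sets Q" by measurable
  finally show "{w \<in> space Q. a < R w} \<in> sets Q" .
qed

text \<open>An unbounded path crosses every level, and the crossing probabilities tend to 0. This
  matters for \<open>p = 1\<close>, where the walk is almost surely never killed.\<close>

lemma AE_bounded_path: "AE w in Q. bounded_path w"
proof -
  let ?U = "{w \<in> space Q. \<not> bounded_path w}"
  have U: "?U \<in> sets Q" unfolding bounded_path_iff by measurable
  have "emeasure Q ?U \<le> ennreal (r * exp (- \<theta> * real n))" for n :: nat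
  proof -
    have "emeasure Q ?U \<le> emeasure Q {w \<in> space Q. \<exists>k. w \<in> E k \<and> real n < S k w}"
      unfolding bounded_path_iff by (intro emeasure_mono) (auto simp: not_le)
    also have "\<dots> = ennreal (r * exp (- \<theta> * real n))"
      by (subst crossing_prob) (auto simp: H_def)
    finally show ?thesis .
  qed
  moreover have "(\<lambda>n. ennreal (r * exp (- \<theta> * real n))) \<longlonglongrightarrow> ennreal (r * 0)"
    using \<theta> by (intro tendsto_ennrealI tendsto_mult tendsto_const) real_asymp
  ultimately have "emeasure Q ?U \<le> ennreal (r * 0)"
    by (intro LIMSEQ_le_const) auto
  then show ?thesis
    using U by (intro AE_I[of _ _ ?U]) auto
qed

lemma laplace_R:
  assumes \<alpha>: "0 \<le> \<alpha>"
  shows "(\<integral>w. exp (- \<alpha> * R w) \<partial>Q) = \<theta> / (\<theta> + \<alpha>) * ((lam + \<alpha>) / lam)"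
proof -
  define \<nu> where "\<nu> = distr Q borel R"
  interpret nu: prob_space \<nu> unfolding \<nu>_def by (rule prob_space_distr) simp
  have [measurable_cong, simp]: "sets \<nu> = sets borel" and [simp]: "space \<nu> = UNIV" by (auto simp: \<nu>_def)
  have tail: "emeasure \<nu> {x<..} = ennreal (r * exp (- \<theta> * x))" if "0 \<le> x" for x
  proof -
    have "emeasure \<nu> {x<..} = emeasure Q {w \<in> space Q. x < R w}"
      unfolding \<nu>_def by (subst emeasure_distr) (auto intro!: arg_cong[where f = "emeasure Q"])
    also have "\<dots> = emeasure Q {w \<in> space Q. \<exists>n. w \<in> E n \<and> x < S n w}"
    proof (rule emeasure_eq_AE)
      show "AE w in Q. w \<in> {w \<in> space Q. x < R w} \<longleftrightarrow> w \<in> {w \<in> space Q. \<exists>n. w \<in> E n \<and> x < S n w}"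
        using AE_bounded_path AE_space by eventually_elim (simp add: less_R_iff)
    qed measurable
    finally show ?thesis using crossing_prob[OF that] that by (simp add: H_def)
  qed
  then have tail': "nu.prob {x<..} = r * exp (- \<theta> * x)" if "0 \<le> x" for x
    using that r_bounds by (simp add: measure_def)
  have "AE w in Q. 0 \<le> R w"
    using AE_bounded_path AE_space
    by eventually_elim (use E_0 in \<open>auto simp: R_def intro!: cSUP_upper2[where x = 0]\<close>)
  then have nonneg: "AE z in \<nu>. 0 \<le> z"
    unfolding \<nu>_def by (subst AE_distr_iff) auto
  \<comment> \<open>Up to a null set the nonpositive part is the single point 0, where the integrand
    is 1.\<close>
  then have "(\<integral>\<^sup>+z. ennreal (exp (- \<alpha> * z)) \<partial>\<nu>) =
      (\<integral>\<^sup>+z. ennreal (exp (- \<alpha> * z)) * indicator {0<..} z + indicator {..0} z \<partial>\<nu>)"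
    by (intro nn_integral_cong_AE) (auto elim!: eventually_mono simp: indicator_def)
  also have "\<dots> = ennreal r * ennreal (\<theta> / (\<theta> + \<alpha>)) + emeasure \<nu> {..0}"
    using nn_integral_exponential_tail[of \<nu> \<theta> r "\<lambda>z. ennreal (exp (- \<alpha> * z))"]
      nn_integral_exp_exponential_law_finite[of \<theta> "- \<alpha>"] \<theta> \<alpha> r_bounds tail' nu.prob_space_axioms
    by (subst nn_integral_add) auto
  also have "emeasure \<nu> {..0} = ennreal (1 - r)"
  proof -
    have "{..0::real} = space \<nu> - {0<..}" by auto
    then have "nu.prob {..0} = 1 - r"
      using tail'[of 0] by (simp add: nu.prob_compl[of "{0<..}", simplified])
    then show ?thesis by (simp add: nu.emeasure_eq_measure)
  qed
  also have "ennreal r * ennreal (\<theta> / (\<theta> + \<alpha>)) + ennreal (1 - r) = ennreal (\<theta> / (\<theta> + \<alpha>) * ((lam + \<alpha>) / lam))"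
  proof -
    have "r * (\<theta> / (\<theta> + \<alpha>)) + (1 - r) = \<theta> / (\<theta> + \<alpha>) * ((lam + \<alpha>) / lam)"
      using \<theta> \<alpha> by (simp add: r_def divide_simps add_eq_0_iff) (simp add: algebra_simps)
    then show ?thesis
      using r_bounds \<theta> \<alpha> by (simp add: ennreal_mult[symmetric] ennreal_plus[symmetric] del: ennreal_plus)
  qed
  finally have "(\<integral>\<^sup>+w. ennreal (exp (- \<alpha> * R w)) \<partial>Q) = ennreal (\<theta> / (\<theta> + \<alpha>) * ((lam + \<alpha>) / lam))"
    by (simp add: \<nu>_def nn_integral_distr)
  then show ?thesis
    using \<theta> \<alpha> by (subst integral_eq_nn_integral) auto
qed

end

section \<open>Spectrally negative Levy processes\<close>

text \<open>Evaluation is approximated along dyadic times to the right, with countably many pieces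
  at each stage. The \<sigma>-algebra is left general because it will also be the one generated by
  the path itself.\<close>

lemma right_continuous_joint_measurable:
  fixes Y :: "real \<Rightarrow> 'a \<Rightarrow> real"
  assumes Y: "\<And>t. 0 \<le> t \<Longrightarrow> Y t \<in> borel_measurable N"
    and right: "\<And>x t. x \<in> space N \<Longrightarrow> 0 \<le> t \<Longrightarrow> ((\<lambda>s. Y s x) \<longlongrightarrow> Y t x) (at_right t)"
  shows "(\<lambda>(x, t). Y (max 0 t) x) \<in> borel_measurable (N \<Otimes>\<^sub>M borel)"
proof (rule borel_measurable_LIMSEQ_real)
  \<comment> \<open>The shift by 1 keeps the grid time strictly after \<open>t\<close>, as
    \<open>at_right\<close> demands.\<close>
  let ?k = "\<lambda>n t. nat \<lfloor>2 ^ n * max 0 (t :: real)\<rfloor>" and ?d = "\<lambda>n k :: nat. (real k + 1) / 2 ^ n"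
  fix n
  have [measurable]: "Y (?d n k) \<in> borel_measurable N" for k
    by (rule Y) simp
  show "(\<lambda>w. Y (?d n (?k n (snd w))) (fst w)) \<in> borel_measurable (N \<Otimes>\<^sub>M borel)"
    by (rule measurable_compose_countable[where f = "\<lambda>k w. Y (?d n k) (fst w)"]) measurable
next
  let ?k = "\<lambda>n t. nat \<lfloor>2 ^ n * max 0 (t :: real)\<rfloor>" and ?d = "\<lambda>n k :: nat. (real k + 1) / 2 ^ n"
  fix w assume "w \<in> space (N \<Otimes>\<^sub>M (borel :: real measure))"
  then obtain x t where w: "w = (x, t)" "x \<in> space N" by (auto simp: space_pair_measure)
  define u where "u = max 0 t"
  have floor: "real (nat \<lfloor>2 ^ n * u\<rfloor>) = of_int \<lfloor>2 ^ n * u\<rfloor>" for n :: nat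
    by (simp add: u_def)
  have gt: "u < ?d n (nat \<lfloor>2 ^ n * u\<rfloor>)" for n :: nat
    unfolding floor by (simp add: field_simps mult.commute) linarith
  have le: "?d n (nat \<lfloor>2 ^ n * u\<rfloor>) \<le> u + 1 / 2 ^ n" for n :: nat
    unfolding floor by (simp add: field_simps mult.commute)
  have "(\<lambda>n. ?d n (nat \<lfloor>2 ^ n * u\<rfloor>)) \<longlonglongrightarrow> u"
  proof (rule tendsto_sandwich[OF _ _ tendsto_const])
    show "(\<lambda>n. u + 1 / 2 ^ n) \<longlonglongrightarrow> u" by real_asymp
  qed (use gt le in \<open>auto intro!: always_eventually less_imp_le\<close>)
  then have "filterlim (\<lambda>n. ?d n (nat \<lfloor>2 ^ n * u\<rfloor>)) (at_right u) sequentially"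
    unfolding filterlim_at using gt less_imp_neq[OF gt, symmetric] by (auto intro!: always_eventually)
  then have "(\<lambda>n. Y (?d n (nat \<lfloor>2 ^ n * u\<rfloor>)) x) \<longlonglongrightarrow> Y u x"
    by (rule filterlim_compose[OF right[OF w(2)], rotated]) (simp add: u_def)
  then show "(\<lambda>n. Y (?d n (?k n (snd w))) (fst w)) \<longlonglongrightarrow> (case w of (x, t) \<Rightarrow> Y (max 0 t) x)"
    by (simp only: w snd_conv fst_conv u_def prod.case)
qed

text \<open>Memorylessness in integrated form: beyond \<open>u\<close> the clock restarts, at the
  price of the survival factor.\<close>

lemma nn_integral_exponential_law_shift:
  assumes "0 < q" "0 \<le> u" and [measurable]: "f \<in> borel_measurable borel"
  shows "(\<integral>\<^sup>+t. indicator {u..} t * f t \<partial>exponential_law q) =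
    ennreal (exp (- q * u)) * (\<integral>\<^sup>+t. f (u + t) \<partial>exponential_law q)"
proof -
  have "(\<integral>\<^sup>+t. indicator {u..} t * f t \<partial>exponential_law q) =
      (\<integral>\<^sup>+t. ennreal (exponential_density q (u + t)) * (indicator {u..} (u + t) * f (u + t)) \<partial>lborel)"
    by (subst nn_integral_exponential_law, simp)
      (subst nn_integral_real_affine[where c = 1 and t = u], auto)
  also have "\<dots> = (\<integral>\<^sup>+t. ennreal (exp (- q * u)) * (ennreal (exponential_density q t) * f (u + t)) \<partial>lborel)"
  proof (intro nn_integral_cong)
    fix t
    have "q * exp (- (u + t) * q) = exp (- q * u) * (q * exp (- t * q))"
      by (simp add: exp_add[symmetric] algebra_simps)
    then have "exponential_density q (u + t) * indicator {u..} (u + t) = exp (- q * u) * exponential_density q t"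
      using assms by (auto simp: exponential_density_def indicator_def)
    then have "ennreal (exponential_density q (u + t)) * indicator {u..} (u + t) = ennreal (exp (- q * u)) * ennreal (exponential_density q t)"
      using assms by (simp add: ennreal_mult'[symmetric] ennreal_indicator[symmetric] ennreal_mult''[symmetric] exponential_density_nonneg)
    then show "ennreal (exponential_density q (u + t)) * (indicator {u..} (u + t) * f (u + t)) =
        ennreal (exp (- q * u)) * (ennreal (exponential_density q t) * f (u + t))"
      by (simp add: mult.assoc[symmetric])
  qed
  finally show ?thesis
    by (simp add: nn_integral_cmult nn_integral_exponential_law)
qed

locale sn_levy = prob_space M for M :: "'a measure" +
  fixes Y :: "real \<Rightarrow> 'a \<Rightarrow> real"
  assumes sn_levy: "spectrally_negative_levy M Y"
begin

lemma Y_measurable [measurable]: "0 \<le> t \<Longrightarrow> Y t \<in> borel_measurable M"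
  and Y_0: "x \<in> space M \<Longrightarrow> Y 0 x = 0"
  and Y_right: "x \<in> space M \<Longrightarrow> 0 \<le> t \<Longrightarrow> ((\<lambda>s. Y s x) \<longlongrightarrow> Y t x) (at_right t)"
  and Y_left: "x \<in> space M \<Longrightarrow> 0 < t \<Longrightarrow> \<exists>l. ((\<lambda>s. Y s x) \<longlongrightarrow> l) (at_left t)"
  and Y_no_jump: "x \<in> space M \<Longrightarrow> 0 < t \<Longrightarrow> Y t x \<le> Lim (at_left t) (\<lambda>s. Y s x)"
  and Y_indep: "0 \<le> \<tau> 0 \<Longrightarrow> incseq \<tau> \<Longrightarrow> indep_vars (\<lambda>_. borel) (\<lambda>i x. Y (\<tau> (Suc i)) x - Y (\<tau> i) x) UNIV"
  and Y_stationary: "0 \<le> s \<Longrightarrow> 0 \<le> t \<Longrightarrow> distr M borel (\<lambda>x. Y (s + t) x - Y s x) = distr M borel (Y t)"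
  and Y_not_decreasing: "\<not> (AE x in M. \<forall>s t. 0 \<le> s \<and> s \<le> t \<longrightarrow> Y t x \<le> Y s x)"
  using sn_levy
  by (auto simp: spectrally_negative_levy_def levy_process_def cadlag_def no_upward_jumps_def)

lemma Y_joint_measurable [measurable]: "(\<lambda>(x, t). Y (max 0 t) x) \<in> borel_measurable (M \<Otimes>\<^sub>M borel)"
  by (rule right_continuous_joint_measurable) (auto intro: Y_right)

lemma Y_joint_measurable' [measurable (raw)]:
  assumes [measurable]: "f \<in> measurable N M" "g \<in> borel_measurable N"
  shows "(\<lambda>w. Y (max 0 (g w)) (f w)) \<in> borel_measurable N"
  using measurable_compose[OF _ Y_joint_measurable, of "\<lambda>w. (f w, g w)" N] by simp

text \<open>The place where the absence of upward jumps enters. Left limits exist, so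
  \<open>Lim\<close> denotes a genuine limit.\<close>

lemma Y_le_of_before:
  assumes x: "x \<in> space M" and t: "0 < t" and le: "\<And>s. 0 \<le> s \<Longrightarrow> s < t \<Longrightarrow> Y s x \<le> b"
  shows "Y t x \<le> b"
proof -
  obtain l where l: "((\<lambda>s. Y s x) \<longlongrightarrow> l) (at_left t)" using Y_left[OF x t] by blast
  have "l \<le> b"
  proof (rule tendsto_upperbound[OF l])
    show "\<forall>\<^sub>F s in at_left t. Y s x \<le> b"
      using eventually_at_left_real[OF t] by eventually_elim (auto intro: le)
  qed simp
  moreover have "Lim (at_left t) (\<lambda>s. Y s x) = l"
    by (rule tendsto_Lim[OF _ l]) simp
  ultimately show ?thesis using Y_no_jump[OF x t] by simp
qed

text \<open>Independence is given for increments along sequences of times, so the past is recorded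
  by the increments on a grid, from which the positions on the grid can be recovered.\<close>

lemma markov:
  assumes h: "0 \<le> h" and s: "0 \<le> s"
    and [measurable]: "G \<in> borel_measurable (PiM {..<k} (\<lambda>_. borel) \<Otimes>\<^sub>M borel)"
  defines "D \<equiv> \<lambda>x. \<lambda>i\<in>{..<k}. Y (real (Suc i) * h) x - Y (real i * h) x"
  shows "(\<integral>\<^sup>+x. G (D x, Y (real k * h + s) x - Y (real k * h) x) \<partial>M) =
    (\<integral>\<^sup>+x. \<integral>\<^sup>+y. G (D x, Y s y) \<partial>M \<partial>M)"
proof -
  \<comment> \<open>One infinite sequence carries everything: grid steps up to index
    \<open>k\<close>, one step of length \<open>s\<close>, then no motion.\<close>
  define \<tau> where "\<tau> i = (if i \<le> k then real i * h else real k * h + s)" for i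
  have [measurable]: "Y (real i * h) \<in> borel_measurable M" "Y (real i * h + s) \<in> borel_measurable M" for i
    using h s by (auto intro!: Y_measurable)
  have "incseq \<tau>"
    using h s by (intro incseq_SucI) (auto simp: \<tau>_def mult_right_mono le_Suc_eq not_le less_Suc_eq_le)
  let ?I = "\<lambda>i x. Y (\<tau> (Suc i)) x - Y (\<tau> i) x"
  have "indep_vars (\<lambda>_. borel) ?I UNIV"
    by (intro Y_indep \<open>incseq \<tau>\<close>) (simp add: \<tau>_def)
  then have ind: "indep_var (PiM {..<k} (\<lambda>_. borel)) (\<lambda>x. restrict (\<lambda>i. ?I i x) {..<k})
      (PiM {k} (\<lambda>_. borel)) (\<lambda>x. restrict (\<lambda>i. ?I i x) {k})"
    by (rule indep_var_restrict) auto
  have D: "restrict (\<lambda>i. ?I i x) {..<k} = D x" for x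
    by (auto simp: D_def \<tau>_def fun_eq_iff)
  let ?K = "\<lambda>x. \<lambda>i\<in>{k}. ?I i x"
  have [measurable]: "D \<in> measurable M (PiM {..<k} (\<lambda>_. borel))"
    unfolding D_def using h by measurable
  have [measurable]: "?K \<in> measurable M (PiM {k} (\<lambda>_. borel))"
    using h s by (intro measurable_restrict) (auto simp: \<tau>_def)
  have joint: "distr M (PiM {..<k} (\<lambda>_. borel)) D \<Otimes>\<^sub>M distr M (PiM {k} (\<lambda>_. borel)) ?K =
      distr M (PiM {..<k} (\<lambda>_. borel) \<Otimes>\<^sub>M PiM {k} (\<lambda>_. borel)) (\<lambda>x. (D x, ?K x))"
    using ind unfolding indep_var_distribution_eq D by simp
  have Dx: "D x \<in> space (PiM {..<k} (\<lambda>_. borel))" for x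
    by (auto simp: D_def space_PiM)
  have [measurable]: "(\<lambda>z. G (D x, z)) \<in> borel_measurable borel" for x
    using Dx[of x] by measurable
  have K: "?I k x = Y (real k * h + s) x - Y (real k * h) x" for x
    by (simp add: \<tau>_def)
  interpret K: prob_space "distr M (PiM {k} (\<lambda>_. borel)) ?K" by (rule prob_space_distr) simp
  have "(\<integral>\<^sup>+x. G (D x, Y (real k * h + s) x - Y (real k * h) x) \<partial>M) =
      (\<integral>\<^sup>+w. G (fst w, snd w k) \<partial>distr M (PiM {..<k} (\<lambda>_. borel) \<Otimes>\<^sub>M PiM {k} (\<lambda>_. borel)) (\<lambda>x. (D x, ?K x)))"
    by (subst nn_integral_distr) (auto simp: K)
  also have "\<dots> = (\<integral>\<^sup>+z. \<integral>\<^sup>+w. G (z, w k) \<partial>distr M (PiM {k} (\<lambda>_. borel)) ?K \<partial>distr M (PiM {..<k} (\<lambda>_. borel)) D)"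
    unfolding joint[symmetric] by (subst K.nn_integral_fst[symmetric]) auto
  also have "\<dots> = (\<integral>\<^sup>+x. \<integral>\<^sup>+y. G (D x, Y (real k * h + s) y - Y (real k * h) y) \<partial>M \<partial>M)"
    by (subst nn_integral_distr, measurable) (rule nn_integral_cong, subst nn_integral_distr, auto simp: K)
  also have "\<dots> = (\<integral>\<^sup>+x. \<integral>\<^sup>+y. G (D x, Y s y) \<partial>M \<partial>M)"
  proof (rule nn_integral_cong)
    fix x assume x: "x \<in> space M"
    have "(\<integral>\<^sup>+y. G (D x, Y (real k * h + s) y - Y (real k * h) y) \<partial>M) =
        (\<integral>\<^sup>+z. G (D x, z) \<partial>distr M borel (\<lambda>y. Y (real k * h + s) y - Y (real k * h) y))"
      using h s by (subst nn_integral_distr) auto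
    also have "\<dots> = (\<integral>\<^sup>+y. G (D x, Y s y) \<partial>M)"
      using h s by (subst Y_stationary) (auto simp: nn_integral_distr)
    finally show "(\<integral>\<^sup>+y. G (D x, Y (real k * h + s) y - Y (real k * h) y) \<partial>M) = \<dots>" .
  qed
  finally show ?thesis .
qed

lemma sum_increments:
  "x \<in> space M \<Longrightarrow> j \<le> k \<Longrightarrow>
    (\<Sum>l<j. (\<lambda>i\<in>{..<k}. Y (real (Suc i) * h) x - Y (real i * h) x) l) = Y (real j * h) x"
proof -
  assume "x \<in> space M" "j \<le> k"
  then have "(\<Sum>l<j. (\<lambda>i\<in>{..<k}. Y (real (Suc i) * h) x - Y (real i * h) x) l) =
      (\<Sum>l<j. Y (real (Suc l) * h) x - Y (real l * h) x)"
    by (intro sum.cong) auto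
  also have "\<dots> = Y (real j * h) x"
    using \<open>x \<in> space M\<close> by (subst sum_lessThan_telescope[where f = "\<lambda>l. Y (real l * h) x"]) (simp add: Y_0)
  finally show ?thesis .
qed

definition zlaw :: "real \<Rightarrow> real measure" where "zlaw q = law_at_exponential_time M Y q"

lemma sets_zlaw [simp, measurable_cong]: "sets (zlaw q) = sets borel"
  by (simp add: zlaw_def law_at_exponential_time_def)

lemma space_zlaw [simp]: "space (zlaw q) = UNIV"
  by (simp add: zlaw_def law_at_exponential_time_def)

lemma prob_space_zlaw: "0 < q \<Longrightarrow> prob_space (zlaw q)"
proof -
  assume "0 < q"
  then interpret T: prob_space "exponential_law q" by (rule prob_space_exponential_law)
  interpret pair_prob_space M "exponential_law q" ..
  show ?thesis unfolding zlaw_def law_at_exponential_time_def by (rule prob_space_distr) measurable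
qed

lemma nn_integral_zlaw:
  assumes q: "0 < q" and [measurable]: "f \<in> borel_measurable borel"
  shows "(\<integral>\<^sup>+z. f z \<partial>zlaw q) = (\<integral>\<^sup>+t. \<integral>\<^sup>+x. f (Y (max 0 t) x) \<partial>M \<partial>exponential_law q)"
proof -
  interpret T: prob_space "exponential_law q" using q by (rule prob_space_exponential_law)
  interpret pair_sigma_finite M "exponential_law q" ..
  have "(\<integral>\<^sup>+z. f z \<partial>zlaw q) = (\<integral>\<^sup>+w. f (Y (max 0 (snd w)) (fst w)) \<partial>(M \<Otimes>\<^sub>M exponential_law q))"
    unfolding zlaw_def law_at_exponential_time_def by (subst nn_integral_distr) (auto simp: split_beta)
  also have "\<dots> = (\<integral>\<^sup>+t. \<integral>\<^sup>+x. f (Y (max 0 t) x) \<partial>M \<partial>exponential_law q)"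
    by (subst nn_integral_snd[symmetric]) auto
  finally show ?thesis .
qed

lemma nn_integral_zlaw':
  assumes q: "0 < q" and [measurable]: "f \<in> borel_measurable borel"
  shows "(\<integral>\<^sup>+z. f z \<partial>zlaw q) = (\<integral>\<^sup>+x. \<integral>\<^sup>+t. f (Y (max 0 t) x) \<partial>exponential_law q \<partial>M)"
proof -
  interpret T: prob_space "exponential_law q" using q by (rule prob_space_exponential_law)
  interpret pair_sigma_finite M "exponential_law q" ..
  show ?thesis unfolding nn_integral_zlaw[OF assms]
    by (subst Fubini') auto
qed

end

section \<open>The strong Markov property at first passage\<close>

lemma (in prob_space) nn_integral_bounded_convergence:
  fixes u :: "nat \<Rightarrow> 'a \<Rightarrow> ennreal"
  assumes [measurable]: "\<And>n. u n \<in> borel_measurable M"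
    and "\<And>n x. x \<in> space M \<Longrightarrow> u n x \<le> 1" and lim: "\<And>x. x \<in> space M \<Longrightarrow> (\<lambda>n. u n x) \<longlonglongrightarrow> v x"
  shows "(\<lambda>n. \<integral>\<^sup>+x. u n x \<partial>M) \<longlonglongrightarrow> (\<integral>\<^sup>+x. v x \<partial>M)"
proof -
  have [measurable]: "v \<in> borel_measurable M"
    by (rule borel_measurable_LIMSEQ_order[OF lim]) auto
  show ?thesis
    by (rule nn_integral_dominated_convergence[where w = "\<lambda>_. 1"]) (use assms in \<open>auto simp: emeasure_space_1\<close>)
qed

context sn_levy
begin

definition hit :: "real \<Rightarrow> real \<Rightarrow> nat \<Rightarrow> 'a \<Rightarrow> bool" where
  "hit h b k x \<longleftrightarrow> (\<forall>j<k. Y (real j * h) x \<le> b) \<and> b < Y (real k * h) x"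

lemma Y_grid_measurable [measurable]: "0 \<le> h \<Longrightarrow> Y (real k * h) \<in> borel_measurable M"
  by (rule Y_measurable) simp

lemma pred_hit [measurable]: "0 \<le> h \<Longrightarrow> Measurable.pred M (hit h b k)"
  unfolding hit_def[abs_def] by measurable

lemma hit_unique: "hit h b k x \<Longrightarrow> hit h b l x \<Longrightarrow> k = l"
  unfolding hit_def by (metis linorder_cases not_le)

lemma zlaw_tail_measurable:
  assumes "0 < q"
  shows "(\<lambda>y. emeasure (zlaw q) {a - y..}) \<in> borel_measurable borel"
proof -
  interpret zlaw: prob_space "zlaw q" using assms by (rule prob_space_zlaw)
  have "emeasure (zlaw q) {a - y..} = (\<integral>\<^sup>+z. indicator {a..} (y + z) \<partial>zlaw q)" for y
  proof -
    have "emeasure (zlaw q) {a - y..} = (\<integral>\<^sup>+z. indicator {a - y..} z \<partial>zlaw q)" by simp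
    also have "\<dots> = (\<integral>\<^sup>+z. indicator {a..} (y + z) \<partial>zlaw q)"
      by (intro nn_integral_cong) (auto simp: indicator_def)
    finally show ?thesis .
  qed
  then show ?thesis by simp
qed

text \<open>The event \<open>hit\<close> is decided by the first \<open>k\<close> increments, so the
  path restarts at time \<open>k h\<close>. Memorylessness restarts the exponential clock at the
  same time and yields the discount factor.\<close>

lemma grid_strong_markov_step:
  assumes q: "0 < q" and h: "0 \<le> h"
  shows "(\<integral>\<^sup>+s. \<integral>\<^sup>+x. indicator {x. hit h b k x} x * indicator {real k * h..} s * indicator {a..} (Y (max 0 s) x) \<partial>M \<partial>exponential_law q) =
    (\<integral>\<^sup>+x. indicator {x. hit h b k x} x * (ennreal (exp (- q * (real k * h))) * emeasure (zlaw q) {a - Y (real k * h) x..}) \<partial>M)"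
    (is "?L = ?R")
proof -
  interpret T: prob_space "exponential_law q" using q by (rule prob_space_exponential_law)
  interpret T: pair_sigma_finite "exponential_law q" M ..
  note h[measurable (raw)]
  let ?u = "real k * h"
  define \<phi> where "\<phi> s = (\<integral>\<^sup>+x. indicator {x. hit h b k x} x * indicator {a..} (Y (max 0 s) x) \<partial>M)" for s
  have [measurable]: "\<phi> \<in> borel_measurable borel"
    unfolding \<phi>_def by measurable
  have G: "emeasure (zlaw q) {a - y..} = (\<integral>\<^sup>+s. \<integral>\<^sup>+w. indicator {a..} (y + Y (max 0 s) w) \<partial>M \<partial>exponential_law q)" for y
  proof -
    have "emeasure (zlaw q) {a - y..} = (\<integral>\<^sup>+z. indicator {a - y..} z \<partial>zlaw q)" by simp
    also have "\<dots> = (\<integral>\<^sup>+s. \<integral>\<^sup>+w. indicator {a - y..} (Y (max 0 s) w) \<partial>M \<partial>exponential_law q)"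
      by (rule nn_integral_zlaw[OF q]) simp
    also have "\<dots> = (\<integral>\<^sup>+s. \<integral>\<^sup>+w. indicator {a..} (y + Y (max 0 s) w) \<partial>M \<partial>exponential_law q)"
      by (intro nn_integral_cong) (auto simp: indicator_def)
    finally show ?thesis .
  qed
  have shift: "\<phi> (?u + s) = (\<integral>\<^sup>+x. \<integral>\<^sup>+w. indicator {x. hit h b k x} x * indicator {a..} (Y ?u x + Y (max 0 s) w) \<partial>M \<partial>M)"
    if s: "0 \<le> s" for s
  proof -
    define D where "D x = (\<lambda>i\<in>{..<k}. Y (real (Suc i) * h) x - Y (real i * h) x)" for x
    have sums: "(\<Sum>l<j. D x l) = Y (real j * h) x" if "x \<in> space M" "j \<le> k" for j x
      unfolding D_def by (rule sum_increments[OF that])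
    have cross: "first_cross k b (D x) \<longleftrightarrow> hit h b k x" if "x \<in> space M" for x
      unfolding first_cross_def hit_def using sums[OF that] by simp
    \<comment> \<open>Both the event and the position at time \<open>k h\<close> are functions of
      the past increments, the form that \<open>markov\<close> asks for.\<close>
    let ?G = "\<lambda>(z, y). indicator {z. first_cross k b z} z * indicator {a..} ((\<Sum>l<k. z l) + y) :: ennreal"
    have [measurable]: "?G \<in> borel_measurable (PiM {..<k} (\<lambda>_. borel) \<Otimes>\<^sub>M borel)"
      using partial_sum_measurable[of k k] by measurable
    have "\<phi> (?u + s) = (\<integral>\<^sup>+x. ?G (D x, Y (?u + s) x - Y ?u x) \<partial>M)"
      unfolding \<phi>_def using s h by (intro nn_integral_cong) (simp add: sums cross indicator_def)
    also have "\<dots> = (\<integral>\<^sup>+x. \<integral>\<^sup>+w. ?G (D x, Y s w) \<partial>M \<partial>M)"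
      unfolding D_def by (rule markov[OF h s]) simp
    also have "\<dots> = (\<integral>\<^sup>+x. \<integral>\<^sup>+w. indicator {x. hit h b k x} x * indicator {a..} (Y ?u x + Y (max 0 s) w) \<partial>M \<partial>M)"
      using s by (intro nn_integral_cong) (simp add: sums cross indicator_def)
    finally show ?thesis .
  qed
  have "?L = (\<integral>\<^sup>+s. indicator {?u..} s * \<phi> s \<partial>exponential_law q)"
    unfolding \<phi>_def by (intro nn_integral_cong) (simp add: nn_integral_cmult[symmetric] mult_ac)
  also have "\<dots> = ennreal (exp (- q * ?u)) * (\<integral>\<^sup>+s. \<phi> (?u + s) \<partial>exponential_law q)"
    using q h by (intro nn_integral_exponential_law_shift) auto
  also have "(\<integral>\<^sup>+s. \<phi> (?u + s) \<partial>exponential_law q) =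
      (\<integral>\<^sup>+s. \<integral>\<^sup>+x. \<integral>\<^sup>+w. indicator {x. hit h b k x} x * indicator {a..} (Y ?u x + Y (max 0 s) w) \<partial>M \<partial>M \<partial>exponential_law q)"
    using AE_exponential_law_nonneg[of q] by (intro nn_integral_cong_AE) (auto elim!: eventually_mono simp: shift)
  also have "\<dots> = (\<integral>\<^sup>+x. \<integral>\<^sup>+s. \<integral>\<^sup>+w. indicator {x. hit h b k x} x * indicator {a..} (Y ?u x + Y (max 0 s) w) \<partial>M \<partial>exponential_law q \<partial>M)"
    by (rule T.Fubini'[symmetric]) measurable
  also have "\<dots> = (\<integral>\<^sup>+x. indicator {x. hit h b k x} x * emeasure (zlaw q) {a - Y ?u x..} \<partial>M)"
    unfolding G by (intro nn_integral_cong) (simp add: nn_integral_cmult)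
  also have "ennreal (exp (- q * ?u)) * \<dots> = ?R"
    using zlaw_tail_measurable[OF q, measurable]
    by (subst nn_integral_cmult[symmetric], measurable) (rule nn_integral_cong, simp add: mult.left_commute)
  finally show ?thesis .
qed

lemma grid_strong_markov:
  assumes q: "0 < q" and h: "0 \<le> h"
  shows "(\<integral>\<^sup>+s. \<integral>\<^sup>+x. indicator {x. \<exists>k. hit h b k x \<and> real k * h \<le> s} x * indicator {a..} (Y (max 0 s) x) \<partial>M \<partial>exponential_law q) =
    (\<integral>\<^sup>+x. (\<Sum>k. indicator {x. hit h b k x} x * (ennreal (exp (- q * (real k * h))) * emeasure (zlaw q) {a - Y (real k * h) x..})) \<partial>M)"
proof -
  note zlaw_tail_measurable[OF q, measurable] h[measurable (raw)]
  \<comment> \<open>At most one index is the first one above the level, so the existential becomes a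
    sum that can be integrated termwise.\<close>
  have sum: "indicator {x. \<exists>k. hit h b k x \<and> real k * h \<le> s} x = (\<Sum>k. indicator {x. hit h b k x} x * indicator {real k * h..} s :: ennreal)" for s x
  proof (cases "\<exists>k. hit h b k x")
    case True
    then obtain k where k: "hit h b k x" by blast
    have "(\<Sum>k. indicator {x. hit h b k x} x * indicator {real k * h..} s :: ennreal) =
        (\<Sum>l\<in>{k}. indicator {x. hit h b l x} x * indicator {real l * h..} s)"
      by (rule suminf_finite) (auto simp: indicator_def dest: hit_unique[OF k])
    then show ?thesis using k by (auto simp: indicator_def dest: hit_unique)
  qed (auto simp: indicator_def)
  have "(\<integral>\<^sup>+s. \<integral>\<^sup>+x. indicator {x. \<exists>k. hit h b k x \<and> real k * h \<le> s} x * indicator {a..} (Y (max 0 s) x) \<partial>M \<partial>exponential_law q) =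
      (\<integral>\<^sup>+s. \<integral>\<^sup>+x. (\<Sum>k. indicator {x. hit h b k x} x * indicator {real k * h..} s * indicator {a..} (Y (max 0 s) x)) \<partial>M \<partial>exponential_law q)"
    unfolding sum by (intro nn_integral_cong) (rule ennreal_suminf_multc[symmetric])
  also have "\<dots> = (\<Sum>k. \<integral>\<^sup>+s. \<integral>\<^sup>+x. indicator {x. hit h b k x} x * indicator {real k * h..} s * indicator {a..} (Y (max 0 s) x) \<partial>M \<partial>exponential_law q)"
    by (subst nn_integral_suminf[symmetric], measurable) (rule nn_integral_cong, rule nn_integral_suminf, measurable)
  also have "\<dots> = (\<Sum>k. \<integral>\<^sup>+x. indicator {x. hit h b k x} x * (ennreal (exp (- q * (real k * h))) * emeasure (zlaw q) {a - Y (real k * h) x..}) \<partial>M)"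
    unfolding grid_strong_markov_step[OF assms] ..
  also have "\<dots> = (\<integral>\<^sup>+x. (\<Sum>k. indicator {x. hit h b k x} x * (ennreal (exp (- q * (real k * h))) * emeasure (zlaw q) {a - Y (real k * h) x..})) \<partial>M)"
    by (rule nn_integral_suminf[symmetric]) measurable
  finally show ?thesis .
qed

lemma hit_exists:
  assumes "b < Y (real j * h) x"
  shows "\<exists>k\<le>j. hit h b k x"
proof -
  define k where "k = (LEAST k. b < Y (real k * h) x)"
  have "b < Y (real k * h) x" unfolding k_def using assms by (rule LeastI)
  moreover have "Y (real i * h) x \<le> b" if "i < k" for i
    using not_less_Least[of i "\<lambda>k. b < Y (real k * h) x"] that by (auto simp: k_def not_less)
  moreover have "k \<le> j" unfolding k_def using assms by (rule Least_le)
  ultimately show ?thesis by (auto simp: hit_def)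
qed

text \<open>By right-continuity the path stays above \<open>b\<close> for a while after
  \<open>s\<close>, and a fine grid has a point there, at most \<delta> late.\<close>

lemma eventually_hit:
  assumes x: "x \<in> space M" and s: "0 \<le> s" "b < Y s x" and \<delta>: "0 < \<delta>"
  shows "\<forall>\<^sub>F m in sequentially. \<exists>k. hit (1 / 2 ^ m) b k x \<and> real k * (1 / 2 ^ m) \<le> s + \<delta>"
proof -
  have "\<forall>\<^sub>F u in at_right s. b < Y u x"
    using order_tendstoD(1)[OF Y_right[OF x s(1)] s(2)] .
  then obtain d where d: "s < d" "\<And>u. s < u \<Longrightarrow> u < d \<Longrightarrow> b < Y u x"
    by (auto simp: eventually_at_right_field)
  have "(\<lambda>m. 1 / 2 ^ m :: real) \<longlonglongrightarrow> 0" by real_asymp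
  then have "\<forall>\<^sub>F m in sequentially. 1 / 2 ^ m < min (d - s) \<delta>"
    using d(1) \<delta> by (intro order_tendstoD(2)) auto
  then show ?thesis
  proof eventually_elim
    case (elim m)
    define j where "j = nat \<lfloor>s * 2 ^ m\<rfloor> + 1"
    have j: "real j = of_int \<lfloor>s * 2 ^ m\<rfloor> + 1" using s(1) by (simp add: j_def)
    have "s * 2 ^ m < real j" "real j \<le> s * 2 ^ m + 1"
      unfolding j by linarith+
    then have "s < real j * (1 / 2 ^ m)" "real j * (1 / 2 ^ m) \<le> s + 1 / 2 ^ m"
      by (simp_all add: field_simps)
    moreover from this have "b < Y (real j * (1 / 2 ^ m)) x"
      using elim by (intro d(2)) auto
    ultimately show ?case
      using hit_exists[of b j "1 / 2 ^ m" x] elim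
      by (meson divide_right_mono mult_right_mono of_nat_le_iff order_trans zero_le_divide_1_iff zero_le_numeral zero_le_power less_imp_le add_left_mono min_less_iff_conj)
  qed
qed

section \<open>First passage in continuous time\<close>

text \<open>The infimum is junk if the level is never exceeded; \<open>discount\<close> is then set to \<open>0\<close>.\<close>

definition passage :: "real \<Rightarrow> 'a \<Rightarrow> real" where
  "passage b x = Inf {s. 0 \<le> s \<and> b < Y s x}"

definition discount :: "real \<Rightarrow> real \<Rightarrow> 'a \<Rightarrow> ennreal" where
  "discount q b x = (if \<exists>s\<ge>0. b < Y s x then ennreal (exp (- q * passage b x)) else 0)"

lemma passage_le: "0 \<le> s \<Longrightarrow> b < Y s x \<Longrightarrow> passage b x \<le> s"
  unfolding passage_def by (rule cInf_lower) (auto intro: bdd_belowI)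

lemma passage_nonneg: "\<exists>s\<ge>0. b < Y s x \<Longrightarrow> 0 \<le> passage b x"
  unfolding passage_def by (rule cInf_greatest) auto

text \<open>The start at 0 and right-continuity keep the path below \<open>b\<close> for a while.
  Positivity gives the passage time a left neighbourhood, and later makes its Laplace transform
  vanish for large \<open>q\<close>.\<close>

lemma passage_pos:
  assumes x: "x \<in> space M" and b: "0 < b" and ex: "\<exists>s\<ge>0. b < Y s x"
  shows "0 < passage b x"
proof -
  have "\<forall>\<^sub>F u in at_right 0. Y u x < b"
    using order_tendstoD(2)[OF Y_right[OF x order_refl]] b x by (simp add: Y_0)
  then obtain d where d: "0 < d" "\<And>u. 0 < u \<Longrightarrow> u < d \<Longrightarrow> Y u x < b"
    by (auto simp: eventually_at_right_field)
  have "d \<le> passage b x"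
    unfolding passage_def
  proof (rule cInf_greatest)
    fix s assume s: "s \<in> {s. 0 \<le> s \<and> b < Y s x}"
    then have "s \<noteq> 0" using b x by (auto simp: Y_0)
    with s d(2)[of s] show "d \<le> s" by force
  qed (use ex in auto)
  with d(1) show ?thesis by simp
qed

lemma Y_passage_le:
  assumes x: "x \<in> space M" and b: "0 < b" and ex: "\<exists>s\<ge>0. b < Y s x"
  shows "Y (passage b x) x \<le> b"
proof (rule Y_le_of_before[OF x passage_pos[OF assms]])
  fix s assume "0 \<le> s" "s < passage b x"
  then show "Y s x \<le> b" using passage_le[of s b x] by force
qed

text \<open>The first grid times above \<open>b\<close> approach the passage time from the right,
  where the path equals \<open>b\<close>, so the overshoots vanish in the limit. They are
  nonnegative, hence one-sided continuity of \<open>g\<close> at 0 is enough.\<close>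

lemma grid_discount_limit:
  fixes g :: "real \<Rightarrow> ennreal"
  assumes x: "x \<in> space M" and b: "0 < b"
    and g: "\<And>y. y \<longlonglongrightarrow> 0 \<Longrightarrow> (\<And>m. 0 \<le> y m) \<Longrightarrow> (\<lambda>m. g (y m)) \<longlonglongrightarrow> L" and L: "L < \<top>"
  shows "(\<lambda>m. \<Sum>k. indicator {x. hit (1 / 2 ^ m) b k x} x *
      (ennreal (exp (- q * (real k * (1 / 2 ^ m)))) * g (Y (real k * (1 / 2 ^ m)) x - b))) \<longlonglongrightarrow> discount q b x * L"
    (is "?s \<longlonglongrightarrow> _")
proof (cases "\<exists>s\<ge>0. b < Y s x")
  case False
  then have "\<not> hit (1 / 2 ^ m) b k x" for m k
    by (auto simp: hit_def)
  then have "?s = (\<lambda>_. 0)" by simp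
  moreover have "discount q b x = 0" using False by (simp add: discount_def)
  ultimately show ?thesis by (simp only: mult_zero_left tendsto_const)
next
  case True
  let ?h = "\<lambda>m. 1 / 2 ^ m :: real" and ?\<tau> = "passage b x"
  define H where "H m = (\<exists>k. hit (?h m) b k x)" for m
  \<comment> \<open>On the finitely many grids that miss the level, the default values keep
    \<open>T\<close> right of the passage time and \<open>y\<close> nonnegative.\<close>
  define T where "T m = (if H m then real (SOME k. hit (?h m) b k x) * ?h m else ?\<tau>)" for m
  define y where "y m = (if H m then Y (T m) x - b else 0)" for m
  have hit_T: "hit (?h m) b k x \<Longrightarrow> H m \<and> T m = real k * ?h m" for m k
    using someI[of "\<lambda>k. hit (?h m) b k x" k] hit_unique by (auto simp: H_def T_def)
  have T_ge: "?\<tau> \<le> T m" for m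
  proof (cases "H m")
    case True
    then obtain k where k: "hit (?h m) b k x" by (auto simp: H_def)
    then show ?thesis using hit_T[OF k] by (auto simp: hit_def intro!: passage_le)
  qed (simp add: T_def)
  have y_nonneg: "0 \<le> y m" for m
    using hit_T by (auto simp: y_def H_def hit_def less_imp_le)
  have ev: "\<forall>\<^sub>F m in sequentially. H m \<and> T m < u" if u: "?\<tau> < u" for u
  proof -
    obtain s where s: "0 \<le> s" "b < Y s x" "s < u"
      using u True cInf_lessD[of "{s. 0 \<le> s \<and> b < Y s x}" u] by (auto simp: passage_def)
    have "\<forall>\<^sub>F m in sequentially. \<exists>k. hit (?h m) b k x \<and> real k * ?h m \<le> s + (u - s) / 2"
      using s by (intro eventually_hit x) auto
    then show ?thesis
    proof eventually_elim
      case (elim m)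
      then obtain k where k: "hit (?h m) b k x" "real k * ?h m \<le> s + (u - s) / 2" by blast
      moreover have "s + (u - s) / 2 < u" using s by (simp add: field_simps)
      ultimately show ?case using hit_T[OF k(1)] by linarith
    qed
  qed
  have T_lim: "T \<longlonglongrightarrow> ?\<tau>"
  proof (rule order_tendstoI)
    fix u assume "u < ?\<tau>"
    then show "\<forall>\<^sub>F m in sequentially. u < T m" using T_ge by (intro always_eventually) (auto intro: less_le_trans)
  next
    fix u assume "?\<tau> < u"
    from ev[OF this] show "\<forall>\<^sub>F m in sequentially. T m < u" by eventually_elim simp
  qed
  have H_ev: "\<forall>\<^sub>F m in sequentially. H m"
    using ev[of "?\<tau> + 1"] by (auto elim: eventually_mono)
  \<comment> \<open>Continuity is taken within the closed half-line, since \<open>T m\<close> may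
    equal the passage time.\<close>
  have "continuous (at ?\<tau> within {?\<tau>..}) (\<lambda>s. Y s x)"
    using Y_right[OF x passage_nonneg[OF True]] by (simp add: continuous_within at_within_Ici_at_right)
  then have Y_lim: "(\<lambda>m. Y (T m) x) \<longlonglongrightarrow> Y ?\<tau> x"
    by (rule continuous_within_tendsto_compose) (use T_ge T_lim in auto)
  have "Y ?\<tau> x = b"
  proof (rule antisym[OF Y_passage_le[OF x b True]])
    show "b \<le> Y ?\<tau> x"
    proof (rule tendsto_lowerbound[OF Y_lim])
      show "\<forall>\<^sub>F m in sequentially. b \<le> Y (T m) x"
        using H_ev
      proof eventually_elim
        case (elim m)
        then show ?case using y_nonneg[of m] by (simp add: y_def)
      qed
    qed simp
  qed
  then have "(\<lambda>m. Y (T m) x - b) \<longlonglongrightarrow> 0"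
    using tendsto_diff[OF Y_lim tendsto_const[of b]] by simp
  then have "y \<longlonglongrightarrow> 0"
    by (rule Lim_transform_eventually) (use H_ev in \<open>auto elim!: eventually_mono simp: y_def\<close>)
  then have "(\<lambda>m. g (y m)) \<longlonglongrightarrow> L"
    by (intro g y_nonneg)
  moreover have "(\<lambda>m. ennreal (exp (- q * T m))) \<longlonglongrightarrow> ennreal (exp (- q * ?\<tau>))"
    by (intro tendsto_ennrealI tendsto_intros T_lim)
  ultimately have "(\<lambda>m. ennreal (exp (- q * T m)) * g (y m)) \<longlonglongrightarrow> ennreal (exp (- q * ?\<tau>)) * L"
    using L by (intro tendsto_mult_ennreal) auto
  moreover have "discount q b x = ennreal (exp (- q * ?\<tau>))" using True by (simp add: discount_def)
  moreover have "\<forall>\<^sub>F m in sequentially. ennreal (exp (- q * T m)) * g (y m) = ?s m"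
    using H_ev
  proof eventually_elim
    case (elim m)
    then obtain k where k: "hit (?h m) b k x" by (auto simp: H_def)
    have "?s m = (\<Sum>l\<in>{k}. indicator {x. hit (?h m) b l x} x *
        (ennreal (exp (- q * (real l * ?h m))) * g (Y (real l * ?h m) x - b)))"
      by (rule suminf_finite) (auto simp: indicator_def dest: hit_unique[OF k])
    with k hit_T[OF k] show ?case by (simp add: y_def)
  qed
  ultimately show ?thesis
    using Lim_transform_eventually by simp
qed

lemma sum_hit_le_1:
  assumes "\<And>k. f k \<le> 1"
  shows "(\<Sum>k. indicator {x. hit h b k x} x * f k) \<le> (1 :: ennreal)"
proof (cases "\<exists>k. hit h b k x")
  case True
  then obtain k where k: "hit h b k x" by blast
  have "(\<Sum>l. indicator {x. hit h b l x} x * f l) = (\<Sum>l\<in>{k}. indicator {x. hit h b l x} x * f l)"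
    by (rule suminf_finite) (auto simp: indicator_def dest: hit_unique[OF k])
  with assms[of k] k show ?thesis by simp
qed simp

text \<open>An infimum over uncountably many times is not visibly measurable; a limit over grids,
  obtained with constant \<open>g\<close>, is.\<close>

lemma discount_measurable [measurable]:
  assumes "0 < b"
  shows "discount q b \<in> borel_measurable M"
proof (rule borel_measurable_LIMSEQ_order)
  fix x assume "x \<in> space M"
  from grid_discount_limit[OF this assms, of "\<lambda>_. 1" 1]
  show "(\<lambda>m. \<Sum>k. indicator {x. hit (1 / 2 ^ m) b k x} x * ennreal (exp (- q * (real k * (1 / 2 ^ m))))) \<longlonglongrightarrow> discount q b x"
    by simp
qed measurable

text \<open>The two sides are limits of the two sides of \<open>grid_strong_markov\<close> along
  dyadic grids. Closed rays are essential: enlarged by a vanishing overshoot they converge to the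
  closed ray again, whereas open rays would gain their end point.\<close>

lemma strong_markov:
  assumes q: "0 < q" and b: "0 < b" and t: "0 < t"
  shows "emeasure (zlaw q) {b + t..} = (\<integral>\<^sup>+x. discount q b x \<partial>M) * emeasure (zlaw q) {t..}"
proof -
  interpret zlaw: prob_space "zlaw q" using q by (rule prob_space_zlaw)
  interpret T: prob_space "exponential_law q" using q by (rule prob_space_exponential_law)
  note zlaw_tail_measurable[OF q, measurable]
  let ?h = "\<lambda>m. 1 / 2 ^ m :: real"
  let ?G = "\<lambda>y. emeasure (zlaw q) {t - y..}"
  have Y_m [measurable]: "Y (real k * ?h m) \<in> borel_measurable M" for k m by (rule Y_measurable) simp
  have hit_m [measurable]: "Measurable.pred M (hit (?h m) b k)" for k m by (rule pred_hit) simp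
  have G: "(\<lambda>m. ?G (y m)) \<longlonglongrightarrow> ?G 0" if y: "y \<longlonglongrightarrow> 0" "\<And>m. 0 \<le> y m" for y
  proof -
    have "(\<lambda>m. \<integral>\<^sup>+z. indicator {t - y m..} z \<partial>zlaw q) \<longlonglongrightarrow> (\<integral>\<^sup>+z. indicator {t..} z \<partial>zlaw q)"
    proof (rule zlaw.nn_integral_bounded_convergence)
      fix z
      show "(\<lambda>m. indicator {t - y m..} z :: ennreal) \<longlonglongrightarrow> indicator {t..} z"
      proof (cases "t \<le> z")
        case True
        then have "indicator {t - y m..} z = (1 :: ennreal)" for m using y(2)[of m] by (simp add: indicator_def)
        with True show ?thesis by simp
      next
        case False
        then have "\<forall>\<^sub>F m in sequentially. y m < t - z" using y(1) by (intro order_tendstoD(2)) auto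
        then have "\<forall>\<^sub>F m in sequentially. indicator {t - y m..} z = (0 :: ennreal)"
          by eventually_elim (simp add: indicator_def)
        with False show ?thesis by (simp add: tendsto_eventually)
      qed
    qed (auto simp: indicator_def)
    then show ?thesis by simp
  qed
  let ?R = "\<lambda>m. \<integral>\<^sup>+x. (\<Sum>k. indicator {x. hit (?h m) b k x} x * (ennreal (exp (- q * (real k * ?h m))) * ?G (Y (real k * ?h m) x - b))) \<partial>M"
  have G_le: "ennreal (exp (- q * (real k * ?h m))) * ?G z \<le> 1" for k m z
    using mult_mono[of "ennreal (exp (- q * (real k * ?h m)))" 1 "?G z" 1] q zlaw.emeasure_le_1 by simp
  have "?R \<longlonglongrightarrow> (\<integral>\<^sup>+x. discount q b x * ?G 0 \<partial>M)"
  proof (rule nn_integral_bounded_convergence)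
    fix x assume "x \<in> space M"
    show "(\<lambda>m. \<Sum>k. indicator {x. hit (?h m) b k x} x * (ennreal (exp (- q * (real k * ?h m))) * ?G (Y (real k * ?h m) x - b))) \<longlonglongrightarrow> discount q b x * ?G 0"
      by (rule grid_discount_limit[OF \<open>x \<in> space M\<close> b G]) (auto simp: zlaw.emeasure_eq_measure)
  next
    show "(\<Sum>k. indicator {x. hit (?h m) b k x} x * (ennreal (exp (- q * (real k * ?h m))) * ?G (Y (real k * ?h m) x - b))) \<le> 1" for m x
      by (intro sum_hit_le_1 G_le)
  qed measurable
  moreover have "?R m = (\<integral>\<^sup>+s. \<integral>\<^sup>+x. indicator {x. \<exists>k. hit (?h m) b k x \<and> real k * ?h m \<le> s} x * indicator {b + t..} (Y (max 0 s) x) \<partial>M \<partial>exponential_law q)" for m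
    by (subst grid_strong_markov[OF q]) (auto simp: algebra_simps)
  ultimately have "(\<lambda>m. \<integral>\<^sup>+s. \<integral>\<^sup>+x. indicator {x. \<exists>k. hit (?h m) b k x \<and> real k * ?h m \<le> s} x * indicator {b + t..} (Y (max 0 s) x) \<partial>M \<partial>exponential_law q)
      \<longlonglongrightarrow> (\<integral>\<^sup>+x. discount q b x * ?G 0 \<partial>M)" (is "?L \<longlonglongrightarrow> _")
    by simp
  moreover have "?L \<longlonglongrightarrow> (\<integral>\<^sup>+s. \<integral>\<^sup>+x. indicator {b + t..} (Y (max 0 s) x) \<partial>M \<partial>exponential_law q)"
  proof (rule T.nn_integral_bounded_convergence)
    fix m and s :: real
    have "(\<integral>\<^sup>+x. indicator {x. \<exists>k. hit (?h m) b k x \<and> real k * ?h m \<le> s} x * indicator {b + t..} (Y (max 0 s) x) \<partial>M) \<le> (\<integral>\<^sup>+x. 1 \<partial>M)"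
      by (intro nn_integral_mono) (auto simp: indicator_def)
    then show "(\<integral>\<^sup>+x. indicator {x. \<exists>k. hit (?h m) b k x \<and> real k * ?h m \<le> s} x * indicator {b + t..} (Y (max 0 s) x) \<partial>M) \<le> 1"
      by (simp add: emeasure_space_1)
  next
    fix s :: real
    show "(\<lambda>m. \<integral>\<^sup>+x. indicator {x. \<exists>k. hit (?h m) b k x \<and> real k * ?h m \<le> s} x * indicator {b + t..} (Y (max 0 s) x) \<partial>M)
        \<longlonglongrightarrow> (\<integral>\<^sup>+x. indicator {b + t..} (Y (max 0 s) x) \<partial>M)"
    proof (rule nn_integral_bounded_convergence)
      fix x assume x: "x \<in> space M"
      show "(\<lambda>m. indicator {x. \<exists>k. hit (?h m) b k x \<and> real k * ?h m \<le> s} x * indicator {b + t..} (Y (max 0 s) x) :: ennreal)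
        \<longlonglongrightarrow> indicator {b + t..} (Y (max 0 s) x)"
      proof (cases "b + t \<le> Y (max 0 s) x")
        case True
        then have "b < Y (max 0 s) x" using t by simp
        \<comment> \<open>Being above \<open>b\<close> at \<open>s\<close> does not suffice, as the
          next grid point may lie after \<open>s\<close>. Without upward jumps the level is already
          exceeded at some earlier \<open>u\<close>, which leaves room for a grid point.\<close>
        then have "0 < s" using x b Y_0 by (cases "0 < s") (auto simp: max_def split: if_splits)
        with \<open>b < Y (max 0 s) x\<close> obtain u where u: "0 \<le> u" "u < s" "b < Y u x"
          using Y_le_of_before[OF x \<open>0 < s\<close>, of b] by (auto simp: not_le[symmetric])
        have "\<forall>\<^sub>F m in sequentially. \<exists>k. hit (?h m) b k x \<and> real k * ?h m \<le> u + (s - u)"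
          using u by (intro eventually_hit x) auto
        then have "\<forall>\<^sub>F m in sequentially. indicator {x. \<exists>k. hit (?h m) b k x \<and> real k * ?h m \<le> s} x * indicator {b + t..} (Y (max 0 s) x) = (1 :: ennreal)"
          by eventually_elim (use True in simp)
        with True show ?thesis by (simp add: tendsto_eventually)
      qed simp
    qed (auto simp: indicator_def)
  qed measurable
  ultimately have "(\<integral>\<^sup>+s. \<integral>\<^sup>+x. indicator {b + t..} (Y (max 0 s) x) \<partial>M \<partial>exponential_law q) = (\<integral>\<^sup>+x. discount q b x * ?G 0 \<partial>M)"
    by (rule LIMSEQ_unique[rotated])
  moreover have "emeasure (zlaw q) {b + t..} = (\<integral>\<^sup>+s. \<integral>\<^sup>+x. indicator {b + t..} (Y (max 0 s) x) \<partial>M \<partial>exponential_law q)"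
    by (subst nn_integral_zlaw[OF q, symmetric]) auto
  ultimately show ?thesis
    using b q by (simp add: nn_integral_multc)
qed

section \<open>The exponential tail and the Laplace exponent\<close>

text \<open>Stationarity carries nonpositivity over to each single increment, the rational pairs of
  times share one null set, and right-continuity reaches all pairs.\<close>

lemma AE_nonpos_imp_decreasing:
  assumes "AE x in M. \<forall>t\<ge>0. Y t x \<le> 0"
  shows "AE x in M. \<forall>s t. 0 \<le> s \<and> s \<le> t \<longrightarrow> Y t x \<le> Y s x"
proof -
  have pair: "AE x in M. Y t x \<le> Y s x" if st: "0 \<le> s" "s \<le> t" for s t
  proof -
    have "AE x in M. Y (t - s) x \<le> 0" using assms by eventually_elim (use st in simp)
    then have "AE y in distr M borel (Y (t - s)). y \<le> 0"
      using st by (subst AE_distr_iff) auto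
    also have "distr M borel (Y (t - s)) = distr M borel (\<lambda>x. Y t x - Y s x)"
      using Y_stationary[of s "t - s"] st by simp
    finally have "AE x in M. Y t x - Y s x \<le> 0"
      using st by (subst (asm) AE_distr_iff) auto
    then show ?thesis by simp
  qed
  have "AE x in M. \<forall>p :: rat \<times> rat. 0 \<le> fst p \<and> fst p \<le> snd p \<longrightarrow> Y (of_rat (snd p)) x \<le> Y (of_rat (fst p)) x"
    unfolding AE_all_countable
  proof
    fix p :: "rat \<times> rat"
    show "AE x in M. 0 \<le> fst p \<and> fst p \<le> snd p \<longrightarrow> Y (of_rat (snd p)) x \<le> Y (of_rat (fst p)) x"
      using pair[of "of_rat (fst p)" "of_rat (snd p)"]
      by (cases "0 \<le> fst p \<and> fst p \<le> snd p") (auto simp: of_rat_less_eq)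
  qed
  then show ?thesis
    using AE_space
  proof eventually_elim
    case (elim x)
    show ?case
    proof (intro allI impI, rule ccontr)
      fix s t :: real assume st: "0 \<le> s \<and> s \<le> t" and "\<not> Y t x \<le> Y s x"
      then have less: "Y s x < Y t x" and "s < t" by (auto simp: le_less)
      then obtain c where c: "Y s x < c" "c < Y t x" using dense by blast
      obtain d where d: "s < d" "\<And>u. s < u \<Longrightarrow> u < d \<Longrightarrow> Y u x < c"
        using order_tendstoD(2)[OF Y_right[OF elim(2)] c(1)] st by (auto simp: eventually_at_right_field)
      obtain e where e: "t < e" "\<And>u. t < u \<Longrightarrow> u < e \<Longrightarrow> c < Y u x"
        using order_tendstoD(1)[OF Y_right[OF elim(2)] c(2)] st by (auto simp: eventually_at_right_field)
      obtain a where a: "s < of_rat a" "of_rat a < min d t"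
        using of_rat_dense[of s "min d t"] d(1) \<open>s < t\<close> by auto
      obtain b where b: "t < of_rat b" "of_rat b < e"
        using of_rat_dense[of t e] e(1) by auto
      have "(0::real) \<le> of_rat a" "(of_rat a :: real) \<le> of_rat b" using a b st by linarith+
      then have "0 \<le> fst (a, b)" "fst (a, b) \<le> snd (a, b)" by (simp_all add: of_rat_less_eq)
      then have "Y (of_rat b) x \<le> Y (of_rat a) x" using elim(1)[rule_format, of "(a, b)"] by simp
      moreover have "Y (of_rat a) x < c" "c < Y (of_rat b) x"
        using a b by (auto intro: d(2) e(2))
      ultimately show False by simp
    qed
  qed
qed

text \<open>Otherwise almost every path would be nonpositive at almost every time, by
  right-continuity at every time, and hence non-increasing. This is where such processes are
  excluded.\<close>

lemma zlaw_tail_pos: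
  assumes q: "0 < q"
  shows "\<exists>t>0. emeasure (zlaw q) {t..} \<noteq> 0"
proof (rule ccontr)
  assume "\<not> ?thesis"
  then have "{1 / real (Suc n)..} \<in> null_sets (zlaw q)" for n
    by (auto simp: null_sets_def)
  then have "(\<Union>n. {1 / real (Suc n)..}) \<in> null_sets (zlaw q)" by (rule null_sets_UN)
  also have "(\<Union>n. {1 / real (Suc n)..}) = {0<..}"
  proof (intro equalityI subsetI)
    fix y :: real assume "y \<in> {0<..}"
    then obtain n where "1 / real (Suc n) < y" using nat_approx_posE[of y] by auto
    then show "y \<in> (\<Union>n. {1 / real (Suc n)..})" by (intro UN_I[of n]) auto
  next
    fix y :: real assume "y \<in> (\<Union>n. {1 / real (Suc n)..})"
    then obtain n where "1 / real (Suc n) \<le> y" by auto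
    then have "0 < y" by (rule less_le_trans[rotated]) simp
    then show "y \<in> {0<..}" by simp
  qed
  finally have "(\<integral>\<^sup>+z. indicator {0<..} z \<partial>zlaw q) = 0" by auto
  interpret T: prob_space "exponential_law q" using q by (rule prob_space_exponential_law)
  from \<open>(\<integral>\<^sup>+z. indicator {0<..} z \<partial>zlaw q) = 0\<close>
  have "(\<integral>\<^sup>+x. \<integral>\<^sup>+s. indicator {0<..} (Y (max 0 s) x) \<partial>exponential_law q \<partial>M) = (0 :: ennreal)"
    by (subst (asm) nn_integral_zlaw'[OF q]) auto
  then have "AE x in M. (\<integral>\<^sup>+s. indicator {0<..} (Y (max 0 s) x) \<partial>exponential_law q) = (0 :: ennreal)"
    by (subst (asm) nn_integral_0_iff_AE) auto
  then have "AE x in M. \<forall>t\<ge>0. Y t x \<le> 0"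
    using AE_space
  proof eventually_elim
    case (elim x)
    note elim(2)[measurable (raw)]
    have [measurable]: "(\<lambda>s. Y (max 0 s) x) \<in> borel_measurable borel" by measurable
    have "AE s in exponential_law q. indicator {0<..} (Y (max 0 s) x) = (0 :: ennreal)"
      using elim(1) by (subst (asm) nn_integral_0_iff_AE) auto
    then have "AE s in lborel. 0 \<le> s \<longrightarrow> Y s x \<le> 0"
      unfolding exponential_law_def using q
      by (subst (asm) AE_density) (auto elim!: eventually_mono simp: exponential_density_def indicator_def split: if_splits)
    show ?case
    proof (intro allI impI, rule ccontr)
      fix t :: real assume t: "0 \<le> t" "\<not> Y t x \<le> 0"
      obtain d where d: "t < d" "\<And>u. t < u \<Longrightarrow> u < d \<Longrightarrow> 0 < Y u x"
        using order_tendstoD(1)[OF Y_right[OF elim(2) t(1)], of 0] t by (auto simp: eventually_at_right_field)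
      have "AE s in lborel. s \<notin> {t<..<d}"
        using \<open>AE s in lborel. 0 \<le> s \<longrightarrow> Y s x \<le> 0\<close>
      proof eventually_elim
        case (elim s)
        then show ?case using d(2)[of s] t by auto
      qed
      then have "emeasure lborel {t<..<d} = 0"
        by (subst (asm) AE_iff_null_sets[symmetric]) auto
      then show False using d(1) by simp
    qed
  qed
  from AE_nonpos_imp_decreasing[OF this] Y_not_decreasing show False by simp
qed

text \<open>The kappa of the overview, read off at level 1.\<close>

definition rate :: "real \<Rightarrow> real" where
  "rate q = - ln (enn2real (\<integral>\<^sup>+x. discount q 1 x \<partial>M))"

lemma discount_eq_0: "\<not> (\<exists>s\<ge>0. b < Y s x) \<Longrightarrow> discount q b x = 0"
  unfolding discount_def by (rule if_not_P)

lemma discount_le_1: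
  assumes "0 \<le> q"
  shows "discount q b x \<le> 1"
proof (cases "\<exists>s\<ge>0. b < Y s x")
  case True
  then have "0 \<le> q * passage b x" using passage_nonneg assms by simp
  then show ?thesis using True by (simp add: discount_def)
next
  case False
  then show ?thesis using discount_eq_0[OF False] by simp
qed

lemma nn_integral_discount_le_1:
  assumes "0 < q"
  shows "(\<integral>\<^sup>+x. discount q b x \<partial>M) \<le> 1"
proof -
  have "(\<integral>\<^sup>+x. discount q b x \<partial>M) \<le> (\<integral>\<^sup>+x. 1 \<partial>M)"
    using assms by (intro nn_integral_mono discount_le_1) simp
  then show ?thesis by (simp add: emeasure_space_1)
qed

text \<open>Passing a level in one stage or in two, and cancelling a positive tail value, gives
  multiplicativity. A zero rate would leave the tail unchanged under shifts, while it has to vanish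
  at infinity.\<close>

lemma nn_integral_discount:
  assumes q: "0 < q"
  shows "0 < rate q" "\<And>b. 0 < b \<Longrightarrow> (\<integral>\<^sup>+x. discount q b x \<partial>M) = ennreal (exp (- rate q * b))"
proof -
  interpret zlaw: prob_space "zlaw q" using q by (rule prob_space_zlaw)
  define \<phi> where "\<phi> b = enn2real (\<integral>\<^sup>+x. discount q b x \<partial>M)" for b
  define g where "g t = measure (zlaw q) {t..}" for t
  have \<phi>: "(\<integral>\<^sup>+x. discount q b x \<partial>M) = ennreal (\<phi> b)" for b
    unfolding \<phi>_def using nn_integral_discount_le_1[OF q, of b] by (simp add: order_le_less_trans ennreal_one_less_top)
  have \<phi>_le: "0 \<le> \<phi> b \<and> \<phi> b \<le> 1" for b
    using nn_integral_discount_le_1[OF q, of b] unfolding \<phi> by (simp add: \<phi>_def)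
  have g: "g (b + t) = \<phi> b * g t" if "0 < b" "0 < t" for b t
    using strong_markov[OF q that] \<phi>_le[of b] unfolding \<phi> g_def zlaw.emeasure_eq_measure
    by (simp add: ennreal_mult[symmetric])
  obtain t0 where t0: "0 < t0" "g t0 > 0"
    using zlaw_tail_pos[OF q] by (auto simp: g_def zlaw.emeasure_eq_measure less_le)
  have "\<phi> (x + y) * g t0 = \<phi> x * \<phi> y * g t0" if "0 < x" "0 < y" for x y
    using g[of "x + y" t0] g[of x "y + t0"] g[of y t0] that t0 by (simp add: add.assoc)
  then have mult: "\<phi> (x + y) = \<phi> x * \<phi> y" if "0 < x" "0 < y" for x y
    using that t0 by simp
  \<comment> \<open>The tail at \<open>t0\<close> factors through the level \<open>t0 / 2\<close>,
    so its positivity forces that of the transform.\<close>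
  have "0 < \<phi> (t0 / 2)"
    using g[of "t0 / 2" "t0 / 2"] t0 \<phi>_le[of "t0 / 2"] by (auto simp: less_le)
  then obtain \<kappa> where \<kappa>: "0 \<le> \<kappa>" "\<And>x. 0 < x \<Longrightarrow> \<phi> x = exp (- \<kappa> * x)"
    using multiplicative_on_pos_exp[of \<phi> "t0 / 2"] mult \<phi>_le t0 by auto
  have rate: "rate q = \<kappa>"
    unfolding rate_def \<phi>_def[symmetric] by (simp add: \<kappa>)
  show "(\<integral>\<^sup>+x. discount q b x \<partial>M) = ennreal (exp (- rate q * b))" if "0 < b" for b
    unfolding \<phi> rate using \<kappa> that by simp
  have "\<kappa> \<noteq> 0"
  proof
    assume "\<kappa> = 0"
    then have "g (real n + t0) = g t0" for n
      using g[of "real n" t0] t0 by (cases "n = 0") (auto simp: \<kappa>)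
    moreover have "(\<lambda>n. g (real n + t0)) \<longlonglongrightarrow> measure (zlaw q) (\<Inter>n. {real n + t0..})"
      unfolding g_def by (intro zlaw.finite_Lim_measure_decseq) (auto simp: decseq_def)
    moreover have "(\<Inter>n. {real n + t0..}) = {}"
    proof (intro equalityI subsetI)
      fix y assume y: "y \<in> (\<Inter>n. {real n + t0..})"
      obtain n where "y < real n" using reals_Archimedean2 by blast
      moreover have "real n + t0 \<le> y" using y by auto
      ultimately show "y \<in> {}" using t0 by simp
    qed simp
    ultimately have "(\<lambda>n::nat. g t0) \<longlonglongrightarrow> 0" by simp
    with t0 show False by (simp add: LIMSEQ_const_iff)
  qed
  with \<kappa>(1) rate show "0 < rate q" by simp
qed

text \<open>\<open>strong_markov\<close> concerns closed rays at positive \<open>t\<close>. Letting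
  \<open>t\<close> tend to 0 turns them into open rays starting at the level itself, with the mass
  of the positive axis as constant.\<close>

lemma zlaw_tail:
  assumes q: "0 < q"
  shows "\<exists>c>0. \<forall>x\<ge>0. measure (zlaw q) {x<..} = c * exp (- rate q * x)"
proof (intro exI conjI allI impI)
  interpret zlaw: prob_space "zlaw q" using q by (rule prob_space_zlaw)
  have lim: "(\<lambda>n. measure (zlaw q) {x + 1 / real (Suc n)..}) \<longlonglongrightarrow> measure (zlaw q) {x<..}" for x
  proof -
    have "(\<lambda>n. measure (zlaw q) {x + 1 / real (Suc n)..}) \<longlonglongrightarrow> measure (zlaw q) (\<Union>n. {x + 1 / real (Suc n)..})"
      by (intro zlaw.finite_Lim_measure_incseq) (auto simp: incseq_def frac_le intro: order_trans[rotated])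
    also have "(\<Union>n. {x + 1 / real (Suc n)..}) = {x<..}"
    proof (intro equalityI subsetI)
      fix y assume "y \<in> {x<..}"
      then obtain n where "1 / real (Suc n) < y - x" using nat_approx_posE[of "y - x"] by auto
      then show "y \<in> (\<Union>n. {x + 1 / real (Suc n)..})" by (intro UN_I[of n]) auto
    next
      fix y assume "y \<in> (\<Union>n. {x + 1 / real (Suc n)..})"
      then obtain n where "x + 1 / real (Suc n) \<le> y" by auto
      moreover have "0 < 1 / real (Suc n)" by simp
      ultimately have "x < y" by linarith
      then show "y \<in> {x<..}" by simp
    qed
    finally show ?thesis .
  qed
  obtain t0 where t0: "0 < t0" "0 < measure (zlaw q) {t0..}"
    using zlaw_tail_pos[OF q] by (auto simp: zlaw.emeasure_eq_measure less_le)
  show "0 < measure (zlaw q) {0<..}"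
    using t0 zlaw.finite_measure_mono[of "{t0..}" "{0<..}"] by (auto intro: less_le_trans)
  fix x :: real assume "0 \<le> x"
  show "measure (zlaw q) {x<..} = measure (zlaw q) {0<..} * exp (- rate q * x)"
  proof (cases "x = 0")
    case False
    with \<open>0 \<le> x\<close> have x: "0 < x" by simp
    have "measure (zlaw q) {x + t..} = exp (- rate q * x) * measure (zlaw q) {t..}" if "0 < t" for t
      using strong_markov[OF q x that] unfolding nn_integral_discount(2)[OF q x] zlaw.emeasure_eq_measure
      by (simp add: ennreal_mult[symmetric])
    then have "(\<lambda>n. exp (- rate q * x) * measure (zlaw q) {0 + 1 / real (Suc n)..}) \<longlonglongrightarrow> measure (zlaw q) {x<..}"
      using lim[of x] by simp
    from LIMSEQ_unique[OF this tendsto_mult[OF tendsto_const lim]] show ?thesis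
      by (simp only: mult.commute)
  qed simp
qed

text \<open>The passage time is positive, so its Laplace transform tends to 0 as the clock rate
  grows. Any given exponent therefore lies below some tail rate.\<close>

lemma rate_unbounded: "\<exists>q>0. K < rate q"
proof -
  have meas: "discount (real (Suc n)) 1 \<in> borel_measurable M" for n by (rule discount_measurable) auto
  have "(\<lambda>n. \<integral>\<^sup>+x. discount (real (Suc n)) 1 x \<partial>M) \<longlonglongrightarrow> (\<integral>\<^sup>+x. 0 \<partial>M)"
  proof (rule nn_integral_bounded_convergence[OF meas])
    fix n x
    show "discount (real (Suc n)) 1 x \<le> 1"
      by (rule discount_le_1) simp
  next
    fix x assume x: "x \<in> space M"
    show "(\<lambda>n. discount (real (Suc n)) 1 x) \<longlonglongrightarrow> 0"
    proof (cases "\<exists>s\<ge>0. 1 < Y s x")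
      case True
      from passage_pos[OF x _ True] have p: "0 < passage 1 x" by simp
      have "(\<lambda>n. exp (- real (Suc n) * c)) \<longlonglongrightarrow> 0" if "0 < c" for c using that by real_asymp
      from this[OF p]
      have "(\<lambda>n. ennreal (exp (- real (Suc n) * passage 1 x))) \<longlonglongrightarrow> ennreal 0" by (rule tendsto_ennrealI)
      with True show ?thesis by (simp add: discount_def)
    next
      case False
      then show ?thesis using discount_eq_0[OF False] by simp
    qed
  qed
  then have "(\<lambda>n. ennreal (exp (- rate (real (Suc n))))) \<longlonglongrightarrow> 0"
    using nn_integral_discount(2)[of _ 1] by simp
  then have "\<forall>\<^sub>F n in sequentially. ennreal (exp (- rate (real (Suc n)))) < ennreal (exp (- K))"
    by (rule order_tendstoD) simp
  then obtain n where "ennreal (exp (- rate (real (Suc n)))) < ennreal (exp (- K))"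
    by (auto dest: eventually_happens)
  then have "K < rate (real (Suc n))" by (simp add: ennreal_less_iff)
  then show ?thesis by (intro exI[of _ "real (Suc n)"]) simp
qed

section \<open>Exponential moments and the Laplace exponent\<close>

definition moment :: "real \<Rightarrow> real \<Rightarrow> ennreal" where
  "moment \<theta> t = (\<integral>\<^sup>+x. ennreal (exp (\<theta> * Y t x)) \<partial>M)"

lemma moment_neq_0: "0 \<le> t \<Longrightarrow> moment \<theta> t \<noteq> 0"
  unfolding moment_def
proof
  assume "0 \<le> t" "(\<integral>\<^sup>+x. ennreal (exp (\<theta> * Y t x)) \<partial>M) = 0"
  then have "AE x in M. ennreal (exp (\<theta> * Y t x)) = 0"
    by (subst (asm) nn_integral_0_iff_AE) auto
  then have "AE x in M. False" by eventually_elim simp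
  then show False by simp
qed

lemma moment_add:
  assumes s: "0 \<le> s" and t: "0 \<le> t"
  shows "moment \<theta> (s + t) = moment \<theta> s * moment \<theta> t"
proof -
  let ?G = "\<lambda>(z, y). ennreal (exp (\<theta> * (z 0 + y)))"
  let ?D = "\<lambda>x. \<lambda>i\<in>{..<1::nat}. Y (real (Suc i) * s) x - Y (real i * s) x"
  have "(\<integral>\<^sup>+x. ?G (?D x, Y (real 1 * s + t) x - Y (real 1 * s) x) \<partial>M) = (\<integral>\<^sup>+x. \<integral>\<^sup>+y. ?G (?D x, Y t y) \<partial>M \<partial>M)"
    by (rule markov[OF s t]) measurable
  moreover have "(\<integral>\<^sup>+x. ?G (?D x, Y (real 1 * s + t) x - Y (real 1 * s) x) \<partial>M) = moment \<theta> (s + t)"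
    unfolding moment_def by (intro nn_integral_cong) (simp add: Y_0)
  moreover have "(\<integral>\<^sup>+x. \<integral>\<^sup>+y. ?G (?D x, Y t y) \<partial>M \<partial>M) = (\<integral>\<^sup>+x. \<integral>\<^sup>+y. ennreal (exp (\<theta> * Y s x)) * ennreal (exp (\<theta> * Y t y)) \<partial>M \<partial>M)"
    by (intro nn_integral_cong) (simp add: Y_0 ennreal_mult[symmetric] exp_add[symmetric] algebra_simps)
  moreover have "\<dots> = moment \<theta> s * moment \<theta> t"
    unfolding moment_def using s t by (simp add: nn_integral_cmult nn_integral_multc)
  ultimately show ?thesis by simp
qed

lemma nn_integral_exp_zlaw:
  assumes q: "0 < q"
  shows "(\<integral>\<^sup>+z. ennreal (exp (\<theta> * z)) \<partial>zlaw q) = (\<integral>\<^sup>+t. moment \<theta> (max 0 t) \<partial>exponential_law q)"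
  unfolding moment_def by (rule nn_integral_zlaw[OF q]) simp

text \<open>The nonpositive axis contributes at most 1, so the exponential tail alone decides, and
  the critical exponent \<open>rate q\<close> itself diverges.\<close>

lemma nn_integral_exp_zlaw_finite_iff:
  assumes q: "0 < q" and \<theta>: "0 \<le> \<theta>"
  shows "(\<integral>\<^sup>+z. ennreal (exp (\<theta> * z)) \<partial>zlaw q) < \<infinity> \<longleftrightarrow> \<theta> < rate q"
proof -
  interpret zlaw: prob_space "zlaw q" using q by (rule prob_space_zlaw)
  obtain c where c: "0 < c" "\<And>x. 0 \<le> x \<Longrightarrow> measure (zlaw q) {x<..} = c * exp (- rate q * x)"
    using zlaw_tail[OF q] by blast
  have "ennreal (exp (\<theta> * z)) = ennreal (exp (\<theta> * z)) * indicator {0<..} z + ennreal (exp (\<theta> * z)) * indicator {..0} z" for z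
    by (simp add: indicator_def)
  then have split: "(\<integral>\<^sup>+z. ennreal (exp (\<theta> * z)) \<partial>zlaw q) =
      (\<integral>\<^sup>+z. ennreal (exp (\<theta> * z)) * indicator {0<..} z \<partial>zlaw q) + (\<integral>\<^sup>+z. ennreal (exp (\<theta> * z)) * indicator {..0} z \<partial>zlaw q)"
    by (subst nn_integral_add[symmetric]) auto
  have "(\<integral>\<^sup>+z. ennreal (exp (\<theta> * z)) * indicator {..0} z \<partial>zlaw q) \<le> (\<integral>\<^sup>+z. 1 \<partial>zlaw q)"
    using \<theta> by (intro nn_integral_mono) (auto simp: indicator_def mult_nonneg_nonpos)
  then have neg: "(\<integral>\<^sup>+z. ennreal (exp (\<theta> * z)) * indicator {..0} z \<partial>zlaw q) < \<infinity>"
    using zlaw.emeasure_space_1 by (auto intro: le_less_trans)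
  have pos: "(\<integral>\<^sup>+z. ennreal (exp (\<theta> * z)) * indicator {0<..} z \<partial>zlaw q) =
      ennreal c * (\<integral>\<^sup>+t. ennreal (exp (\<theta> * t)) \<partial>exponential_law (rate q))"
    using c nn_integral_discount(1)[OF q] q
    by (intro nn_integral_exponential_tail) (auto intro: prob_space_zlaw)
  show ?thesis
  proof (cases "\<theta> < rate q")
    case True
    then show ?thesis
      unfolding split pos using neg nn_integral_discount(1)[OF q]
      by (simp add: nn_integral_exp_exponential_law_finite ennreal_mult_less_top)
  next
    case False
    then show ?thesis
      unfolding split pos using c nn_integral_discount(1)[OF q]
      by (simp add: nn_integral_exp_exponential_law_infinite ennreal_mult_top)
  qed
qed

text \<open>An infinite moment at time 1 would persist at all later times, which the exponential
  clock reaches with positive probability. A clock with \<theta> < \<open>rate q\<close> contradicts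
  this.\<close>

lemma moment_finite:
  assumes \<theta>: "0 \<le> \<theta>"
  shows "moment \<theta> 1 < \<infinity>"
proof (rule ccontr)
  assume "\<not> moment \<theta> 1 < \<infinity>"
  then have top: "moment \<theta> 1 = \<top>" by (simp add: less_top[symmetric])
  obtain q where q: "0 < q" "\<theta> < rate q" using rate_unbounded by blast
  have inf: "moment \<theta> s = \<top>" if "1 \<le> s" for s
    using moment_add[of 1 "s - 1" \<theta>] moment_neq_0[of "s - 1" \<theta>] that by (simp add: top ennreal_top_mult)
  have "(\<integral>\<^sup>+t. \<top> * indicator {1<..} t \<partial>exponential_law q) \<le> (\<integral>\<^sup>+t. moment \<theta> (max 0 t) \<partial>exponential_law q)"
    by (intro nn_integral_mono) (auto simp: indicator_def inf)
  moreover have "(\<integral>\<^sup>+t. \<top> * indicator {1<..} t \<partial>exponential_law q) = \<top>"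
    using q by (subst nn_integral_cmult_indicator) (auto simp: emeasure_exponential_law_greaterThan ennreal_top_mult)
  ultimately show False
    using nn_integral_exp_zlaw_finite_iff[OF q(1) \<theta>] q(2) by (simp add: nn_integral_exp_zlaw[OF q(1)] top_unique)
qed

abbreviation "\<Phi> \<equiv> laplace_exponent M Y"

lemma moment_1:
  assumes "0 \<le> \<theta>"
  shows "moment \<theta> 1 = ennreal (exp (\<Phi> \<theta>))"
proof -
  have int: "integrable M (\<lambda>x. exp (\<theta> * Y 1 x))"
    using moment_finite[OF assms] by (intro integrableI_nonneg) (auto simp: moment_def)
  then have eq: "moment \<theta> 1 = ennreal (\<integral>x. exp (\<theta> * Y 1 x) \<partial>M)"
    unfolding moment_def by (intro nn_integral_eq_integral) auto
  moreover have "0 \<le> (\<integral>x. exp (\<theta> * Y 1 x) \<partial>M)" by simp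
  ultimately have "0 < (\<integral>x. exp (\<theta> * Y 1 x) \<partial>M)" using moment_neq_0[of 1 \<theta>] by (auto simp: less_le)
  then show ?thesis using eq by (simp add: laplace_exponent_def)
qed

lemma moment_grid:
  assumes "0 \<le> h"
  shows "moment \<theta> (real k * h) = moment \<theta> h ^ k"
proof (induction k)
  case 0
  show ?case
    using Y_0 emeasure_space_1 by (simp add: moment_def cong: nn_integral_cong_simp)
next
  case (Suc k)
  have "moment \<theta> (real (Suc k) * h) = moment \<theta> (h + real k * h)" by (simp add: algebra_simps)
  then show ?case using assms Suc by (simp add: moment_add)
qed

lemma moment_rational:
  assumes \<theta>: "0 \<le> \<theta>" and n: "0 < n"
  shows "moment \<theta> (real k * (1 / real n)) = ennreal (exp (real k * (1 / real n) * \<Phi> \<theta>))"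
proof -
  have "moment \<theta> (1 / real n) ^ n = ennreal (exp (\<Phi> \<theta>))"
    using moment_grid[of "1 / real n" \<theta> n] n moment_1[OF \<theta>] by simp
  moreover from this have "moment \<theta> (1 / real n) \<noteq> \<top>" using n by (auto simp: power_eq_top_ennreal)
  then obtain r where r: "moment \<theta> (1 / real n) = ennreal r" "0 \<le> r" by (cases "moment \<theta> (1 / real n)") auto
  ultimately have "r ^ n = exp (\<Phi> \<theta>)" by (simp add: ennreal_power)
  also have "\<dots> = exp (1 / real n * \<Phi> \<theta>) ^ n" using n by (simp add: exp_of_nat_mult[symmetric])
  finally have "r = exp (1 / real n * \<Phi> \<theta>)"
    using r n by (intro power_eq_imp_eq_base[of r n]) auto
  then show ?thesis
    using moment_grid[of "1 / real n" \<theta> k] r by (simp add: ennreal_power exp_of_nat_mult[symmetric])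
qed

text \<open>Multiplicativity settles rational times only; right-continuity and Fatou's lemma give
  one inequality at real times.\<close>

lemma moment_le:
  assumes \<theta>: "0 \<le> \<theta>" and t: "0 \<le> t"
  shows "moment \<theta> t \<le> ennreal (exp (t * \<Phi> \<theta>))"
proof -
  define k where "k n = nat \<lfloor>t * real (Suc n)\<rfloor> + 1" for n
  define r where "r n = real (k n) * (1 / real (Suc n))" for n
  have k: "t * real (Suc n) < real (k n)" "real (k n) \<le> t * real (Suc n) + 1" for n
    using t by (auto simp: k_def) linarith
  have r_gt: "t < r n" and r_le: "r n \<le> t + 1 / real (Suc n)" for n
    using k[of n] by (auto simp: r_def field_simps simp del: of_nat_Suc)
  have r_lim: "r \<longlonglongrightarrow> t"
  proof (rule tendsto_sandwich[OF _ _ tendsto_const])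
    show "(\<lambda>n. t + 1 / real (Suc n)) \<longlonglongrightarrow> t" by real_asymp
  qed (use r_gt r_le in \<open>auto intro!: always_eventually less_imp_le\<close>)
  then have r_right: "filterlim r (at_right t) sequentially"
    unfolding filterlim_at using r_gt less_imp_neq[OF r_gt, symmetric] by (auto intro!: always_eventually)
  have r_nonneg: "0 \<le> r n" for n using r_gt[of n] t by simp
  have "moment \<theta> t = (\<integral>\<^sup>+x. liminf (\<lambda>n. ennreal (exp (\<theta> * Y (r n) x))) \<partial>M)"
    unfolding moment_def
  proof (rule nn_integral_cong)
    fix x assume x: "x \<in> space M"
    have "(\<lambda>n. Y (r n) x) \<longlonglongrightarrow> Y t x"
      by (rule filterlim_compose[OF Y_right[OF x t] r_right])
    then have "(\<lambda>n. ennreal (exp (\<theta> * Y (r n) x))) \<longlonglongrightarrow> ennreal (exp (\<theta> * Y t x))"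
      by (intro tendsto_ennrealI tendsto_intros)
    then show "ennreal (exp (\<theta> * Y t x)) = liminf (\<lambda>n. ennreal (exp (\<theta> * Y (r n) x)))"
      by (intro lim_imp_Liminf[symmetric]) auto
  qed
  also have "\<dots> \<le> liminf (\<lambda>n. moment \<theta> (r n))"
    unfolding moment_def using r_nonneg by (intro nn_integral_liminf) auto
  also have "(\<lambda>n. moment \<theta> (r n)) = (\<lambda>n. ennreal (exp (r n * \<Phi> \<theta>)))"
    unfolding r_def by (intro ext moment_rational \<theta>) simp
  also have "liminf \<dots> = ennreal (exp (t * \<Phi> \<theta>))"
    by (intro lim_imp_Liminf tendsto_ennrealI tendsto_intros r_lim) auto
  finally show ?thesis .
qed

text \<open>Fatou's lemma only bounds the moment from above, but the bounds at \<open>t\<close> and \<open>N - t\<close> multiply to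
  the exact value at the integer \<open>N\<close>, so both are equalities.\<close>

lemma moment_eq:
  assumes \<theta>: "0 \<le> \<theta>" and t: "0 \<le> t"
  shows "moment \<theta> t = ennreal (exp (t * \<Phi> \<theta>))"
proof -
  obtain N where N: "t \<le> real N" using real_arch_simple by blast
  have "moment \<theta> t \<noteq> \<top>" "moment \<theta> (real N - t) \<noteq> \<top>"
    using moment_le[OF \<theta> t] moment_le[OF \<theta>, of "real N - t"] N by (auto simp: top_unique)
  then obtain a b where ab: "moment \<theta> t = ennreal a" "0 \<le> a" "moment \<theta> (real N - t) = ennreal b" "0 \<le> b"
    by (metis ennreal_cases)
  have le: "a \<le> exp (t * \<Phi> \<theta>)" "b \<le> exp ((real N - t) * \<Phi> \<theta>)"
    using moment_le[OF \<theta> t] moment_le[OF \<theta>, of "real N - t"] N ab by auto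
  have "moment \<theta> (real N) = ennreal (exp (real N * \<Phi> \<theta>))"
    using moment_rational[OF \<theta>, of 1 N] by simp
  then have "ennreal (exp (real N * \<Phi> \<theta>)) = ennreal (a * b)"
    using moment_add[OF t, of "real N - t" \<theta>] N ab by (simp add: ennreal_mult)
  then have "exp (real N * \<Phi> \<theta>) = a * b" using ab by simp
  also have "\<dots> \<le> a * exp ((real N - t) * \<Phi> \<theta>)" using le ab by (intro mult_left_mono) auto
  finally have "exp (t * \<Phi> \<theta>) * exp ((real N - t) * \<Phi> \<theta>) \<le> a * exp ((real N - t) * \<Phi> \<theta>)"
    by (simp add: exp_add[symmetric] algebra_simps)
  then have "exp (t * \<Phi> \<theta>) \<le> a" by simp
  with le ab show ?thesis by simp
qed

lemma mgf_zlaw: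
  assumes q: "0 < q" and \<theta>: "0 \<le> \<theta>"
  shows "(\<integral>\<^sup>+z. ennreal (exp (\<theta> * z)) \<partial>zlaw q) = (\<integral>\<^sup>+t. ennreal (exp (\<Phi> \<theta> * t)) \<partial>exponential_law q)"
proof -
  have "(\<integral>\<^sup>+t. moment \<theta> (max 0 t) \<partial>exponential_law q) = (\<integral>\<^sup>+t. ennreal (exp (\<Phi> \<theta> * t)) \<partial>exponential_law q)"
  proof (rule nn_integral_cong_AE)
    show "AE t in exponential_law q. moment \<theta> (max 0 t) = ennreal (exp (\<Phi> \<theta> * t))"
      using AE_exponential_law_nonneg[of q]
      by (rule eventually_mono) (simp add: moment_eq[OF \<theta>] mult.commute max_absorb2)
  qed
  then show ?thesis by (simp add: nn_integral_exp_zlaw[OF q])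
qed

lemma mgf_zlaw_finite:
  assumes "0 < q" "0 \<le> \<theta>" "\<Phi> \<theta> < q"
  shows "(\<integral>\<^sup>+z. ennreal (exp (\<theta> * z)) \<partial>zlaw q) = ennreal (q / (q - \<Phi> \<theta>))"
  using assms by (simp add: mgf_zlaw nn_integral_exp_exponential_law_finite)

text \<open>Two criteria for the same moment E exp(\<theta> Z) to be finite: averaging over the
  clock gives the left one, the exponential tail gives the right one.\<close>

lemma exponent_less_iff:
  assumes q: "0 < q" and \<theta>: "0 \<le> \<theta>"
  shows "\<Phi> \<theta> < q \<longleftrightarrow> \<theta> < rate q"
proof (cases "\<Phi> \<theta> < q")
  case True
  then show ?thesis
    using nn_integral_exp_zlaw_finite_iff[OF assms] mgf_zlaw_finite[OF assms True] by simp
next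
  case False
  then show ?thesis
    using nn_integral_exp_zlaw_finite_iff[OF assms] nn_integral_exp_exponential_law_infinite[of q "\<Phi> \<theta>"] q
    by (simp add: mgf_zlaw[OF assms])
qed

text \<open>Hoelder's inequality in disguise: with exponents centred by \<Phi> x and \<Phi> y both
  exponentials have mean 1, and convexity of \<open>exp\<close> is applied pointwise.\<close>

lemma exponent_convex: "convex_on {0..} \<Phi>"
proof (rule convex_onI)
  fix t x y :: real
  assume t: "0 < t" "t < 1" and "x \<in> {0..}" "y \<in> {0..}"
  then have xy: "0 \<le> x" "0 \<le> y" by auto
  let ?A = "\<Phi> x" and ?B = "\<Phi> y" and ?w = "(1 - t) * x + t * y"
  have w: "0 \<le> ?w" using t xy by simp
  have "ennreal (exp (- ((1 - t) * ?A + t * ?B))) * moment ?w 1 =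
      (\<integral>\<^sup>+\<omega>. ennreal (exp (- ((1 - t) * ?A + t * ?B))) * ennreal (exp (?w * Y 1 \<omega>)) \<partial>M)"
    unfolding moment_def by (simp add: nn_integral_cmult)
  also have "\<dots> \<le> (\<integral>\<^sup>+\<omega>. ennreal ((1 - t) * exp (- ?A)) * ennreal (exp (x * Y 1 \<omega>)) +
      ennreal (t * exp (- ?B)) * ennreal (exp (y * Y 1 \<omega>)) \<partial>M)"
  proof (rule nn_integral_mono)
    fix \<omega>
    let ?y = "Y 1 \<omega>"
    have "exp ((1 - t) *\<^sub>R (x * ?y - ?A) + t *\<^sub>R (y * ?y - ?B)) \<le> (1 - t) * exp (x * ?y - ?A) + t * exp (y * ?y - ?B)"
      using t by (intro convex_onD[OF exp_convex]) auto
    moreover have "(1 - t) *\<^sub>R (x * ?y - ?A) + t *\<^sub>R (y * ?y - ?B) = - ((1 - t) * ?A + t * ?B) + ?w * ?y"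
      by (simp add: algebra_simps)
    moreover have "exp (x * ?y - ?A) = exp (- ?A) * exp (x * ?y)" "exp (y * ?y - ?B) = exp (- ?B) * exp (y * ?y)"
      by (simp_all add: exp_add[symmetric])
    ultimately have "exp (- ((1 - t) * ?A + t * ?B)) * exp (?w * ?y) \<le>
        (1 - t) * exp (- ?A) * exp (x * ?y) + t * exp (- ?B) * exp (y * ?y)"
      by (simp only: exp_add[symmetric] mult.assoc)
    then show "ennreal (exp (- ((1 - t) * ?A + t * ?B))) * ennreal (exp (?w * ?y)) \<le>
        ennreal ((1 - t) * exp (- ?A)) * ennreal (exp (x * ?y)) + ennreal (t * exp (- ?B)) * ennreal (exp (y * ?y))"
      using t by (simp add: ennreal_mult[symmetric] ennreal_plus[symmetric] del: ennreal_plus)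
  qed
  also have "\<dots> = ennreal ((1 - t) * exp (- ?A)) * moment x 1 + ennreal (t * exp (- ?B)) * moment y 1"
    unfolding moment_def by (subst nn_integral_add) (auto simp: nn_integral_cmult)
  also have "\<dots> = ennreal 1"
    using t xy by (simp add: moment_1 ennreal_mult[symmetric] exp_add[symmetric] mult.assoc ennreal_plus[symmetric] del: ennreal_plus)
  finally have "exp (- ((1 - t) * ?A + t * ?B) + \<Phi> ?w) \<le> 1"
    using w by (simp add: moment_1 ennreal_mult[symmetric] exp_add)
  then show "\<Phi> ((1 - t) *\<^sub>R x + t *\<^sub>R y) \<le> (1 - t) * \<Phi> x + t * \<Phi> y" by simp
qed simp

section \<open>Inverting the Laplace exponent\<close>

abbreviation "\<Psi> \<equiv> right_inverse_exponent M Y"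

text \<open>The level 0 must be covered for \<beta> = 0, where no exponential clock of rate
  \<open>q\<close> exists. The tail rate of a faster clock \<open>p\<close> serves only to show that
  \<Phi> reaches the level.\<close>

lemma right_inverse:
  assumes t: "0 < t" "\<Phi> t < q"
  shows "t < \<Psi> q" "\<Phi> (\<Psi> q) = q"
proof -
  have "\<exists>b>t. q \<le> \<Phi> b"
  proof -
    obtain p where p: "0 < p" "p > q" "t < rate p"
    proof -
      define p where "p = max (max q 0 + 1) (\<Phi> t + 1)"
      have "0 < p" "q < p" "\<Phi> t < p" by (auto simp: p_def)
      then show ?thesis using that[of p] exponent_less_iff[of p t] t by simp
    qed
    then show ?thesis
      using exponent_less_iff[of p "rate p"] t by (intro exI[of _ "rate p"]) auto
  qed
  then obtain b where b: "t < b" "q \<le> \<Phi> b" by blast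
  show "t < \<Psi> q" "\<Phi> (\<Psi> q) = q"
    unfolding right_inverse_exponent_def
    using convex_right_inverse[OF exponent_convex t b] by auto
qed

lemma rate_eq_right_inverse:
  assumes q: "0 < q"
  shows "rate q = \<Psi> q"
proof -
  let ?t = "rate q / 2"
  have pos: "0 < rate q" using nn_integral_discount(1)[OF q] .
  have t: "0 < ?t" "\<Phi> ?t < q" using pos exponent_less_iff[OF q, of ?t] by auto
  have b: "?t < rate q" "q \<le> \<Phi> (rate q)" using pos exponent_less_iff[OF q, of "rate q"] by auto
  note R = convex_right_inverse[OF exponent_convex t b, folded right_inverse_exponent_def]
  show ?thesis
  proof (rule antisym)
    show "rate q \<le> \<Psi> q"
      using R(1,2) pos exponent_less_iff[OF q, of "\<Psi> q"] by (simp add: not_less[symmetric])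
    show "\<Psi> q \<le> rate q"
      using R(4)[of "rate q"] b exponent_less_iff[OF q, of "rate q"] pos by (auto simp: not_less[symmetric])
  qed
qed

text \<open>For \<beta> > 0 half the tail rate works. For \<beta> = 0 the mean may be minus
  infinity, so \<Phi> is not differentiated at 0. Instead, nonnegativity of \<Phi> on the positive
  axis would bound E(exp X - 1 - X) by Fatou's lemma, making X integrable with nonnegative
  mean.\<close>

lemma exists_exponent_less:
  assumes "0 \<le> \<beta>" "\<beta> = 0 \<Longrightarrow> ext_expectation M (Y 1) < 0"
  shows "\<exists>t>0. \<Phi> t < \<beta>"
proof (cases "\<beta> = 0")
  case False
  then show ?thesis
    using exponent_less_iff[of \<beta> "rate \<beta> / 2"] nn_integral_discount(1)[of \<beta>] assms
    by (intro exI[of _ "rate \<beta> / 2"]) auto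
next
  case True
  show ?thesis
  proof (rule ccontr)
    assume *: "\<not> ?thesis"
    let ?X = "Y 1"
    \<comment> \<open>X is replaced by difference quotients of the exponential. Adding
      \<open>exp X - 1\<close> makes everything nonnegative, so that Fatou's lemma applies although
      X may lack an integrable lower bound.\<close>
    define W where "W n x = exp (?X x) - 1 - real (Suc n) * (exp (?X x / real (Suc n)) - 1)" for n x
    have W_nonneg: "0 \<le> W n x" for n x
    proof -
      have "1 + real (Suc n) * (exp (?X x / real (Suc n)) - 1) \<le> (1 + (exp (?X x / real (Suc n)) - 1)) ^ Suc n"
        by (rule Bernoulli_inequality) simp
      also have "\<dots> = exp (?X x)" by (simp add: exp_of_nat_mult[symmetric] del: of_nat_Suc power_Suc)
      finally show ?thesis by (simp add: W_def)
    qed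
    have int: "integrable M (\<lambda>x. exp (t * ?X x))" "(\<integral>x. exp (t * ?X x) \<partial>M) = exp (\<Phi> t)" if "0 \<le> t" for t
    proof -
      show i: "integrable M (\<lambda>x. exp (t * ?X x))"
        using moment_finite[OF that] by (intro integrableI_nonneg) (auto simp: moment_def)
      have "ennreal (\<integral>x. exp (t * ?X x) \<partial>M) = ennreal (exp (\<Phi> t))"
        using moment_1[OF that] i unfolding moment_def by (subst (asm) nn_integral_eq_integral) auto
      then show "(\<integral>x. exp (t * ?X x) \<partial>M) = exp (\<Phi> t)" by (simp add: integral_nonneg_AE)
    qed
    have W_int: "(\<integral>\<^sup>+x. ennreal (W n x) \<partial>M) \<le> ennreal (exp (\<Phi> 1) - 1)" for n
    proof -
      let ?n = "real (Suc n)"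
      have i: "integrable M (\<lambda>x. exp (?X x))" "integrable M (\<lambda>x. exp (?X x / ?n))"
        using int(1)[of 1] int(1)[of "1 / ?n"] by (simp_all del: of_nat_Suc)
      have "integrable M (W n)"
        unfolding W_def[abs_def] using i by (intro Bochner_Integration.integrable_diff integrable_mult_right) auto
      then have "(\<integral>\<^sup>+x. ennreal (W n x) \<partial>M) = ennreal (\<integral>x. W n x \<partial>M)"
        using W_nonneg by (intro nn_integral_eq_integral) auto
      also have "(\<integral>x. W n x \<partial>M) = (\<integral>x. exp (?X x) \<partial>M) - 1 - ?n * ((\<integral>x. exp (?X x / ?n) \<partial>M) - 1)"
        unfolding W_def using i by (simp add: prob_space del: of_nat_Suc)
      also have "\<dots> = exp (\<Phi> 1) - 1 - ?n * (exp (\<Phi> (1 / ?n)) - 1)"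
        using int(2)[of 1] int(2)[of "1 / ?n"] by (simp del: of_nat_Suc)
      also have "\<dots> \<le> exp (\<Phi> 1) - 1"
      proof -
        have "\<not> (0 < 1 / ?n \<and> \<Phi> (1 / ?n) < \<beta>)" using * by blast
        then have "0 \<le> \<Phi> (1 / ?n)" using True by simp
        then have "0 \<le> ?n * (exp (\<Phi> (1 / ?n)) - 1)" by (intro mult_nonneg_nonneg) auto
        then show ?thesis by simp
      qed
      finally show ?thesis by (simp add: ennreal_leI)
    qed
    let ?V = "\<lambda>x. exp (?X x) - 1 - ?X x"
    have V_lim: "(\<lambda>n. ennreal (W n x)) \<longlonglongrightarrow> ennreal (?V x)" for x
    proof -
      have "(\<lambda>n. real (Suc n) * (exp (c / real (Suc n)) - 1)) \<longlonglongrightarrow> c" for c :: real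
        by real_asymp
      then show ?thesis
        unfolding W_def by (intro tendsto_ennrealI tendsto_diff tendsto_const)
    qed
    have "(\<integral>\<^sup>+x. ennreal (?V x) \<partial>M) = (\<integral>\<^sup>+x. liminf (\<lambda>n. ennreal (W n x)) \<partial>M)"
      using lim_imp_Liminf[OF _ V_lim] by simp
    also have "\<dots> \<le> liminf (\<lambda>n. \<integral>\<^sup>+x. ennreal (W n x) \<partial>M)"
      unfolding W_def[abs_def] by (intro nn_integral_liminf) auto
    also have "\<dots> \<le> liminf (\<lambda>n::nat. ennreal (exp (\<Phi> 1) - 1))"
      by (intro Liminf_mono always_eventually allI W_int)
    also have "\<dots> = ennreal (exp (\<Phi> 1) - 1)" by (simp add: Liminf_const)
    finally have V_int: "(\<integral>\<^sup>+x. ennreal (?V x) \<partial>M) \<le> ennreal (exp (\<Phi> 1) - 1)" .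
    have V_nonneg: "0 \<le> ?V x" for x using exp_ge_add_one_self[of "?X x"] by linarith
    have V: "integrable M ?V"
      using V_int V_nonneg by (intro integrableI_nonneg) (auto intro: le_less_trans)
    have e: "integrable M (\<lambda>x. exp (?X x))" using int(1)[of 1] by simp
    have X: "integrable M ?X"
    proof -
      have "integrable M (\<lambda>x. exp (?X x) - (1 + ?V x))"
        by (intro Bochner_Integration.integrable_diff Bochner_Integration.integrable_add V e) simp
      then show ?thesis by (simp add: algebra_simps)
    qed
    have "ennreal (\<integral>x. ?V x \<partial>M) \<le> ennreal (exp (\<Phi> 1) - 1)"
      using V_int V V_nonneg by (subst (asm) nn_integral_eq_integral) auto
    moreover have "(\<integral>x. ?V x \<partial>M) = exp (\<Phi> 1) - 1 - expectation ?X"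
      using e X int(2)[of 1] by (simp add: prob_space)
    moreover have "0 \<le> exp (\<Phi> 1) - 1" using * True by (force simp: not_less)
    ultimately have "0 \<le> expectation ?X" by (simp add: ennreal_le_iff)
    moreover have "ext_expectation M ?X = ereal (expectation ?X)"
    proof -
      have "(\<integral>\<^sup>+x. ennreal (?X x) \<partial>M) \<noteq> \<infinity>" "(\<integral>\<^sup>+x. ennreal (- ?X x) \<partial>M) \<noteq> \<infinity>"
        using X by (auto simp: real_integrable_def)
      then obtain a b where "0 \<le> a" "(\<integral>\<^sup>+x. ennreal (?X x) \<partial>M) = ennreal a"
        "0 \<le> b" "(\<integral>\<^sup>+x. ennreal (- ?X x) \<partial>M) = ennreal b"
        by (metis ennreal_cases infinity_ennreal_def)
      then show ?thesis
        unfolding ext_expectation_def real_lebesgue_integral_def[OF X] by simp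
    qed
    ultimately show False using assms(2)[OF True] by simp
  qed
qed

end

section \<open>Inspected processes\<close>

context prob_space
begin

text \<open>Pulling the first \<open>\<sigma>\<close>-algebra back to \<open>M\<close> keeps evaluation of right-continuous paths at random
  times measurable; on the product space of all paths it is not.\<close>

lemma indep_elements_nn_integral:
  assumes ind: "indep_elements M A X B U"
    and F [measurable]: "F \<in> borel_measurable (vimage_algebra (space M) X A \<Otimes>\<^sub>M B)"
  shows "(\<integral>\<^sup>+x. F (x, U x) \<partial>M) = (\<integral>\<^sup>+x. \<integral>\<^sup>+w. F (x, U w) \<partial>M \<partial>M)" (is ?fst)
    and "(\<integral>\<^sup>+x. F (x, U x) \<partial>M) = (\<integral>\<^sup>+w. \<integral>\<^sup>+x. F (x, U w) \<partial>M \<partial>M)" (is ?snd)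
proof -
  let ?V = "vimage_algebra (space M) X A"
  have X: "X \<in> measurable M A" and U [measurable]: "U \<in> measurable M B"
    and iset: "indep_set {X -` S \<inter> space M | S. S \<in> sets A} {U -` S \<inter> space M | S. S \<in> sets B}"
    using ind by (auto simp: indep_elements_def)
  have XA: "X \<in> space M \<rightarrow> space A" using X by (auto simp: measurable_def)
  have id [measurable]: "(\<lambda>x. x) \<in> measurable M ?V"
    by (rule measurable_vimage_algebra2) (use X in auto)
  let ?M1 = "distr M ?V (\<lambda>x. x)" and ?M2 = "distr M B U"
  interpret M1: prob_space ?M1 by (rule prob_space_distr) simp
  interpret M2: prob_space ?M2 by (rule prob_space_distr) simp
  interpret P: pair_sigma_finite ?M1 ?M2 ..
  have "?M1 \<Otimes>\<^sub>M ?M2 = distr M (?V \<Otimes>\<^sub>M B) (\<lambda>x. (x, U x))"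
  proof (rule pair_measure_eqI)
    fix S R assume "S \<in> sets ?M1" "R \<in> sets ?M2"
    then have S: "S \<in> sets ?V" and R [measurable]: "R \<in> sets B" by auto
    note S [measurable]
    obtain S' where S': "S = X -` S' \<inter> space M" "S' \<in> sets A"
      using S sets_vimage_algebra2[OF XA] by auto
    have "S \<in> events" using measurable_sets[OF X S'(2)] S' by simp
    have "emeasure (distr M (?V \<Otimes>\<^sub>M B) (\<lambda>x. (x, U x))) (S \<times> R) = emeasure M (S \<inter> (U -` R \<inter> space M))"
    proof (subst emeasure_distr)
      show "S \<times> R \<in> sets (?V \<Otimes>\<^sub>M B)" using S R by (rule pair_measureI)
      have "(\<lambda>x. (x, U x)) -` (S \<times> R) \<inter> space M = S \<inter> (U -` R \<inter> space M)"
        using S' by auto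
      then show "emeasure M ((\<lambda>x. (x, U x)) -` (S \<times> R) \<inter> space M) = emeasure M (S \<inter> (U -` R \<inter> space M))"
        by (rule arg_cong)
    qed measurable
    also have "\<dots> = emeasure M S * emeasure M (U -` R \<inter> space M)"
    proof -
      have "prob (S \<inter> (U -` R \<inter> space M)) = prob S * prob (U -` R \<inter> space M)"
        using S' R by (intro indep_setD[OF iset]) auto
      then show ?thesis by (simp only: emeasure_eq_measure ennreal_mult measure_nonneg)
    qed
    also have "emeasure M S = emeasure ?M1 S"
      using S sets.sets_into_space[OF S] by (subst emeasure_distr) (auto intro!: arg_cong[where f = "emeasure M"])
    also have "emeasure M (U -` R \<inter> space M) = emeasure ?M2 R"
      by (subst emeasure_distr) auto
    finally show "emeasure ?M1 S * emeasure ?M2 R = emeasure (distr M (?V \<Otimes>\<^sub>M B) (\<lambda>x. (x, U x))) (S \<times> R)" ..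
  qed (auto intro: M1.sigma_finite_measure_axioms M2.sigma_finite_measure_axioms cong: sets_pair_measure_cong)
  note eq = this
  have "(\<integral>\<^sup>+x. F (x, U x) \<partial>M) = (\<integral>\<^sup>+w. F w \<partial>(?M1 \<Otimes>\<^sub>M ?M2))"
    unfolding eq by (subst nn_integral_distr) auto
  moreover have "\<dots> = (\<integral>\<^sup>+x. \<integral>\<^sup>+w. F (x, U w) \<partial>M \<partial>M)"
  proof -
    have "(\<integral>\<^sup>+y. F (x, y) \<partial>?M2) = (\<integral>\<^sup>+w. F (x, U w) \<partial>M)" if "x \<in> space M" for x
      using measurable_compose[OF measurable_Pair1'[of x ?V B] F] that by (intro nn_integral_distr) auto
    then show ?thesis
      by (subst M2.nn_integral_fst[symmetric]) (auto simp: nn_integral_distr[OF id] intro!: nn_integral_cong)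
  qed
  moreover have "(\<integral>\<^sup>+w. F w \<partial>(?M1 \<Otimes>\<^sub>M ?M2)) = (\<integral>\<^sup>+w. \<integral>\<^sup>+x. F (x, U w) \<partial>M \<partial>M)"
  proof -
    have "(\<integral>\<^sup>+x. F (x, y) \<partial>?M1) = (\<integral>\<^sup>+x. F (x, y) \<partial>M)" if "y \<in> space B" for y
      using measurable_compose[OF measurable_Pair2'[of y B ?V] F] that by (intro nn_integral_distr[OF id]) auto
    moreover have "U w \<in> space B" if "w \<in> space M" for w using measurable_space[OF U that] .
    ultimately show ?thesis
      by (subst P.nn_integral_snd[symmetric]) (auto simp: nn_integral_distr[OF U] intro!: nn_integral_cong)
  qed
  ultimately show ?fst ?snd by simp_all
qed

lemma indep_elements_emeasure:
  assumes "indep_elements M A X B U" "S \<in> sets A" "R \<in> sets B"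
  shows "emeasure M {x \<in> space M. X x \<in> S \<and> U x \<in> R} =
    emeasure M {x \<in> space M. X x \<in> S} * emeasure M {x \<in> space M. U x \<in> R}"
proof -
  have "prob ((X -` S \<inter> space M) \<inter> (U -` R \<inter> space M)) = prob (X -` S \<inter> space M) * prob (U -` R \<inter> space M)"
    using assms by (intro indep_setD) (auto simp: indep_elements_def)
  moreover have "(X -` S \<inter> space M) \<inter> (U -` R \<inter> space M) = {x \<in> space M. X x \<in> S \<and> U x \<in> R}"
    "X -` S \<inter> space M = {x \<in> space M. X x \<in> S}" "U -` R \<inter> space M = {x \<in> space M. U x \<in> R}"
    by auto
  ultimately show ?thesis by (simp add: emeasure_eq_measure ennreal_mult)
qed

end

lemma emeasure_exponential_law_atLeast:
  assumes "0 < q" "0 \<le> s"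
  shows "emeasure (exponential_law q) {s..} = ennreal (exp (- q * s))"
proof -
  interpret prob_space "exponential_law q" using assms by (intro prob_space_exponential_law)
  show ?thesis
    using nn_integral_exponential_law_shift[of q s "\<lambda>_. 1"] assms emeasure_space_1 by simp
qed

lemma emeasure_killing_law:
  assumes "0 \<le> \<beta>" "0 \<le> s"
  shows "emeasure (killing_law \<beta>) {ereal s..} = ennreal (exp (- \<beta> * s))"
proof (cases "\<beta> = 0")
  case True
  then show ?thesis by (simp add: killing_law_def)
next
  case False
  have "ereal -` {ereal s..} = {s..}" by auto
  then show ?thesis
    using False assms by (simp add: killing_law_def emeasure_distr emeasure_exponential_law_atLeast)
qed

section \<open>The walk at the inspection epochs\<close>

locale killed_levy = sn_levy M Y for M :: "'a measure" and Y +
  fixes \<beta> \<omega> :: real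
  assumes \<omega>: "0 < \<omega>" and \<beta>: "0 \<le> \<beta>" and mean: "\<beta> = 0 \<Longrightarrow> ext_expectation M (Y 1) < 0"
begin

abbreviation "q \<equiv> \<beta> + \<omega>"
abbreviation "p \<equiv> \<omega> / q"

lemma q_pos: "0 < q" and p_bounds: "0 < p" "p \<le> 1"
  using \<omega> \<beta> by auto

text \<open>The second exponent \<theta>' of \<open>stopped_walk\<close>: since \<Phi> is below
  \<beta> there, the ratio \<omega> / (q - \<Phi> low) is below 1.\<close>

definition low where "low = (SOME t. 0 < t \<and> \<Phi> t < \<beta>)"

lemma low: "0 < low" "\<Phi> low < \<beta>"
  using someI_ex[OF exists_exponent_less[OF \<beta> mean]] by (auto simp: low_def)

definition c where "c = measure (zlaw q) {0<..}"

sublocale exp_tail_walk "zlaw q" c "\<Psi> q" "\<Psi> \<beta>" p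
proof (rule exp_tail_walk.intro)
  show "measure (zlaw q) {x<..} = c * exp (- \<Psi> q * x)" if "0 \<le> x" for x
  proof -
    obtain d where "\<forall>x\<ge>0. measure (zlaw q) {x<..} = d * exp (- rate q * x)"
      using zlaw_tail[OF q_pos] by blast
    from this[rule_format, OF that] this[rule_format, of 0] show ?thesis
      by (simp add: c_def rate_eq_right_inverse[OF q_pos])
  qed
  show "0 < \<Psi> \<beta>" using right_inverse[OF low] low by simp
  show "\<Psi> \<beta> < \<Psi> q"
    using exponent_less_iff[OF q_pos, of "\<Psi> \<beta>"] right_inverse[OF low] low \<omega>
    by (simp add: rate_eq_right_inverse[OF q_pos])
  \<comment> \<open>\<Phi> takes the value \<beta> at \<Psi> \<beta>, so the moment is q / (q -
    \<beta>) = q / \<omega>.\<close>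
  show "(\<integral>\<^sup>+z. ennreal (exp (\<Psi> \<beta> * z)) \<partial>zlaw q) = ennreal (1 / p)"
    using mgf_zlaw_finite[OF q_pos, of "\<Psi> \<beta>"] right_inverse[OF low] low \<omega> by simp
  show "prob_space (zlaw q)" by (rule prob_space_zlaw[OF q_pos])
qed (use p_bounds in simp_all)

lemma low_mgf: "low \<le> \<Psi> \<beta>" "ennreal p * (\<integral>\<^sup>+z. ennreal (exp (low * z)) \<partial>zlaw q) < 1"
proof -
  show "low \<le> \<Psi> \<beta>" using right_inverse[OF low] by simp
  have "p * (q / (q - \<Phi> low)) < 1"
    using low \<omega> \<beta> by (simp add: divide_simps)
  then show "ennreal p * (\<integral>\<^sup>+z. ennreal (exp (low * z)) \<partial>zlaw q) < 1"
    using low \<omega> \<beta> p_bounds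
    by (subst mgf_zlaw_finite[OF q_pos]) (auto simp: ennreal_mult[symmetric] simp del: times_divide_eq_left times_divide_eq_right)
qed

lemma skeleton_laplace:
  fixes K :: "'b measure"
  assumes sk: "killed_skeleton M Y \<beta> \<omega> K Z N" and \<alpha>: "0 \<le> \<alpha>"
  shows "(\<integral>x. exp (- \<alpha> * skeleton_max Z N x) \<partial>K) = \<Psi> \<beta> / (\<Psi> \<beta> + \<alpha>) * ((\<Psi> q + \<alpha>) / \<Psi> q)"
proof -
  interpret K: prob_space K using sk by (simp add: killed_skeleton_def)
  have ind: "K.indep_vars (\<lambda>_. borel) Z UNIV" and Z_law: "\<And>m. distr K borel (Z m) = zlaw q"
    and N_law: "\<And>n. K.prob {x \<in> space K. N x = enat n} = p ^ n * (\<beta> / q)"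
    and ZN: "indep_elements K (PiM UNIV (\<lambda>_. borel)) (\<lambda>x m. Z m x) (count_space UNIV) N"
    using sk by (auto simp: killed_skeleton_def zlaw_def)
  have Z [measurable]: "Z l \<in> borel_measurable K" for l
    using ind by (auto simp: K.indep_vars_def)
  have N [measurable]: "N \<in> measurable K (count_space UNIV)"
    using ZN by (simp add: indep_elements_def)
  define E where "E k = {x \<in> space K. enat k \<le> N x}" for k
  have E [measurable]: "E k \<in> sets K" for k unfolding E_def by measurable
  \<comment> \<open>Subtracting atoms from the total mass counts \<open>N = \<infinity>\<close> as
    survival, which covers \<beta> = 0 as well.\<close>
  have E_prob: "K.prob (E k) = p ^ k" for k
  proof (induction k)
    case 0
    show ?case by (simp add: E_def zero_enat_def[symmetric] K.prob_space)
  next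
    case (Suc k)
    have "E (Suc k) = E k - {x \<in> space K. N x = enat k}"
      by (auto simp: E_def Suc_ile_eq less_le)
    moreover have "K.prob (E k - {x \<in> space K. N x = enat k}) = K.prob (E k) - K.prob {x \<in> space K. N x = enat k}"
    proof (rule K.finite_measure_Diff)
      show "{x \<in> space K. N x = enat k} \<subseteq> E k" by (auto simp: E_def)
    qed measurable
    ultimately have "K.prob (E (Suc k)) = K.prob (E k) - K.prob {x \<in> space K. N x = enat k}"
      by (rule ssubst)
    also have "\<dots> = p ^ k * (1 - \<beta> / q)" by (simp add: Suc N_law algebra_simps)
    also have "1 - \<beta> / q = p" using q_pos by (simp add: field_simps)
    finally show ?case by simp
  qed
  interpret W: stopped_walk "zlaw q" c "\<Psi> q" "\<Psi> \<beta>" p K E Z low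
  proof
    show "E 0 = space K" by (auto simp: E_def zero_enat_def[symmetric])
    show "decseq E" by (auto simp: decseq_def E_def intro: order_trans[rotated])
    fix k and A :: "nat \<Rightarrow> real set" assume A: "\<And>l. l < k \<Longrightarrow> A l \<in> sets borel"
    let ?S = "{z. \<forall>l<k. z l \<in> A l}"
    have [measurable]: "Measurable.pred (PiM UNIV (\<lambda>_. borel)) (\<lambda>z. z l \<in> A l)" if "l < k" for l
      using A[OF that] by measurable
    have "Measurable.pred (PiM UNIV (\<lambda>_. borel)) (\<lambda>z. \<forall>l\<in>{..<k}. z l \<in> A l)"
      by (intro pred_intros_finite) auto
    then have S: "?S \<in> sets (PiM UNIV (\<lambda>_. borel :: real measure))"
      by (simp add: pred_def space_PiM Ball_def)
    have "{x \<in> E k. \<forall>l<k. Z l x \<in> A l} = {x \<in> space K. (\<lambda>m. Z m x) \<in> ?S \<and> N x \<in> {n. enat k \<le> n}}"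
      by (auto simp: E_def)
    also have "emeasure K \<dots> = emeasure K {x \<in> space K. (\<lambda>m. Z m x) \<in> ?S} * emeasure K {x \<in> space K. N x \<in> {n. enat k \<le> n}}"
      by (rule K.indep_elements_emeasure[OF ZN S]) simp
    also have "emeasure K {x \<in> space K. N x \<in> {n. enat k \<le> n}} = ennreal p ^ k"
      using E_prob[of k] p_bounds by (simp add: K.emeasure_eq_measure E_def ennreal_power)
    also have "emeasure K {x \<in> space K. (\<lambda>m. Z m x) \<in> ?S} = (\<Prod>l<k. emeasure (zlaw q) (A l))"
    proof (cases "k = 0")
      case True
      then show ?thesis by (simp add: K.emeasure_space_1)
    next
      case False
      have "{x \<in> space K. (\<lambda>m. Z m x) \<in> ?S} = (\<Inter>l\<in>{..<k}. Z l -` A l \<inter> space K)"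
        using False by auto
      moreover have "K.prob \<dots> = (\<Prod>l<k. K.prob (Z l -` A l \<inter> space K))"
        using A False by (intro K.indep_varsD[OF ind]) auto
      moreover have "emeasure (zlaw q) (A l) = ennreal (K.prob (Z l -` A l \<inter> space K))" if "l < k" for l
        using A[OF that] by (simp add: Z_law[of l, symmetric] emeasure_distr K.emeasure_eq_measure)
      ultimately show ?thesis by (simp add: K.emeasure_eq_measure prod_ennreal)
    qed
    finally show "emeasure K {x \<in> E k. \<forall>l<k. Z l x \<in> A l} = ennreal p ^ k * (\<Prod>l<k. emeasure (zlaw q) (A l))"
      by (simp add: mult.commute)
  qed (use low_mgf in auto)
  have "(\<integral>x. exp (- \<alpha> * skeleton_max Z N x) \<partial>K) = (\<integral>x. exp (- \<alpha> * W.R x) \<partial>K)"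
    by (intro Bochner_Integration.integral_cong) (auto simp: W.R_def skeleton_max_def E_def)
  then show ?thesis using W.laplace_R[OF \<alpha>] by simp
qed

text \<open>Survival of an inspection interval and the increment over it both depend on its length.
  Given the epochs, however, the survival probability exp(-\<beta> I_k) is a product over intervals
  and the increments are independent, so that integrating out the independent lengths factorises the
  joint law.\<close>

lemma inspection_laplace:
  assumes insp: "poisson_inspection M Y \<beta> \<omega> I T" and \<alpha>: "0 \<le> \<alpha>"
  shows "(\<integral>x. exp (- \<alpha> * inspected_max Y I T x) \<partial>M) = \<Psi> \<beta> / (\<Psi> \<beta> + \<alpha>) * ((\<Psi> q + \<alpha>) / \<Psi> q)"
proof -
  let ?path = "\<lambda>x. \<lambda>t\<in>{0..}. Y t x" and ?I = "\<lambda>x n. I n x"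
  let ?A1 = "PiM {0..} (\<lambda>_. borel) :: (real \<Rightarrow> real) measure" and ?A2 = "PiM UNIV (\<lambda>_. borel) :: (nat \<Rightarrow> real) measure"
  have I_0: "I 0 x = 0" and I_mono: "strict_mono (\<lambda>n. I n x)" if "x \<in> space M" for x
    using insp that by (auto simp: poisson_inspection_def)
  have I_indep: "indep_vars (\<lambda>_. borel) (\<lambda>n x. I (Suc n) x - I n x) UNIV"
    and I_law: "\<And>n. distr M borel (\<lambda>x. I (Suc n) x - I n x) = exponential_law \<omega>"
    and T_law: "distr M borel T = killing_law \<beta>"
    and ind1: "indep_elements M ?A1 ?path ?A2 ?I"
    and ind2: "indep_elements M (?A1 \<Otimes>\<^sub>M ?A2) (\<lambda>x. (?path x, ?I x)) borel T"
    using insp by (auto simp: poisson_inspection_def)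
  have T [measurable]: "T \<in> borel_measurable M" using ind2 by (simp add: indep_elements_def)
  have I_PiM: "?I \<in> measurable M ?A2" using ind1 by (simp add: indep_elements_def)
  have I [measurable]: "I n \<in> borel_measurable M" for n
    using measurable_compose[OF I_PiM measurable_component_singleton[of n UNIV]] by simp
  have I_nonneg: "0 \<le> I n x" if "x \<in> space M" for n x
    using strict_mono_leD[OF I_mono[OF that], of 0 n] I_0[OF that] by simp
  \<comment> \<open>On \<open>space M\<close> the truncation changes nothing; it gives the shape
    covered by joint measurability.\<close>
  define Z where "Z l x = Y (max 0 (I (Suc l) x)) x - Y (max 0 (I l x)) x" for l x
  \<comment> \<open>\<open>T\<close> may be negative on a null set, hence the exception for \<open>k = 0\<close>.\<close>
  define E where "E k = (if k = 0 then space M else {x \<in> space M. ereal (I k x) \<le> T x})" for k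
  have Z_eq: "Z l x = Y (I (Suc l) x) x - Y (I l x) x" if "x \<in> space M" for l x
    using I_nonneg[OF that] by (simp add: Z_def max_absorb2)
  have Z_sum: "(\<Sum>l<n. Z l x) = Y (I n x) x" if "x \<in> space M" for n x
    using that by (simp add: Z_eq sum_lessThan_telescope[where f = "\<lambda>l. Y (I l x) x"] I_0 Y_0)
  have Z_meas [measurable]: "Z l \<in> borel_measurable M" for l unfolding Z_def[abs_def] by measurable
  have E_meas [measurable]: "E k \<in> sets M" for k by (cases "k = 0") (simp_all add: E_def)
  have T_ge: "(\<integral>\<^sup>+w. indicator {ereal s..} (T w) \<partial>M) = ennreal (exp (- \<beta> * s))" if "0 \<le> s" for s
  proof -
    have "(\<integral>\<^sup>+w. indicator {ereal s..} (T w) \<partial>M) = emeasure (distr M borel T) {ereal s..}"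
      by (subst nn_integral_indicator[symmetric]) (auto simp: nn_integral_distr simp del: nn_integral_indicator)
    then show ?thesis using emeasure_killing_law[OF \<beta> that] by (simp add: T_law)
  qed
  have T_nonneg: "AE x in M. 0 \<le> T x"
  proof -
    have "emeasure M (T -` {ereal 0..} \<inter> space M) = 1"
      using T_ge[of 0] by (simp add: nn_integral_indicator' indicator_vimage[symmetric])
    also have "T -` {ereal 0..} \<inter> space M = {x \<in> space M. 0 \<le> T x}"
      by (auto simp: zero_ereal_def)
    finally have "prob {x \<in> space M. 0 \<le> T x} = 1" by (simp add: emeasure_eq_measure)
    then have "AE x in M. x \<in> {x \<in> space M. 0 \<le> T x}" by (subst (asm) prob_eq_1) auto
    then show ?thesis by (rule eventually_mono) simp
  qed
  have E_law: "emeasure M {x \<in> E k. \<forall>l<k. Z l x \<in> A l} = ennreal p ^ k * (\<Prod>l<k. emeasure (zlaw q) (A l))"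
    if A: "\<And>l. l < k \<Longrightarrow> A l \<in> sets borel" for k A
  proof -
    \<comment> \<open>Padding by 0 makes \<open>f l\<close> Borel for every \<open>l\<close>, while
      \<open>A l\<close> is known to be Borel only for \<open>l < k\<close>.\<close>
    define f where "f l z = (if l < k then indicator (A l) z else 0 :: ennreal)" for l and z :: real
    have f [measurable]: "f l \<in> borel_measurable borel" for l
      unfolding f_def using A by (cases "l < k") auto
    let ?V2 = "vimage_algebra (space M) (\<lambda>x. (?path x, ?I x)) (?A1 \<Otimes>\<^sub>M ?A2)"
    let ?V1 = "vimage_algebra (space M) ?path ?A1"
    have pre: "?path \<in> measurable ?V1 ?A1"
      by (rule measurable_vimage_algebra1) (auto simp: space_PiM)
    have pre2: "(\<lambda>x. (?path x, ?I x)) \<in> measurable ?V2 (?A1 \<Otimes>\<^sub>M ?A2)"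
      by (rule measurable_vimage_algebra1) (auto simp: space_PiM space_pair_measure)
    have Y1: "Y t \<in> borel_measurable ?V1" if "0 \<le> t" for t
      using measurable_compose[OF pre measurable_component_singleton[of t "{0..}"]] that by simp
    have Y2: "Y t \<in> borel_measurable ?V2" if "0 \<le> t" for t
      using measurable_compose[OF measurable_compose[OF pre2 measurable_fst] measurable_component_singleton[of t "{0..}"]] that by simp
    have I2 [measurable]: "I n \<in> borel_measurable ?V2" for n
      using measurable_compose[OF measurable_compose[OF pre2 measurable_snd] measurable_component_singleton[of n UNIV]] by simp
    have J1: "(\<lambda>(x, t). Y (max 0 t) x) \<in> borel_measurable (?V1 \<Otimes>\<^sub>M borel)"
      by (rule right_continuous_joint_measurable) (auto intro: Y1 Y_right)
    have J2: "(\<lambda>(x, t). Y (max 0 t) x) \<in> borel_measurable (?V2 \<Otimes>\<^sub>M borel)"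
      by (rule right_continuous_joint_measurable) (auto intro: Y2 Y_right)
    have J1': "(\<lambda>w. Y (max 0 (snd w n)) (fst w)) \<in> borel_measurable (?V1 \<Otimes>\<^sub>M ?A2)" for n
      using measurable_compose[OF _ J1, of "\<lambda>w. (fst w, snd w n)" "?V1 \<Otimes>\<^sub>M ?A2"] by simp
    have J2': "(\<lambda>x. Y (max 0 (I n x)) x) \<in> borel_measurable ?V2" for n
      using measurable_compose[OF _ J2, of "\<lambda>x. (x, I n x)" ?V2] by simp
    have "emeasure M {x \<in> E k. \<forall>l<k. Z l x \<in> A l} = (\<integral>\<^sup>+x. indicator {ereal (I k x)..} (T x) * (\<Prod>l<k. f l (Z l x)) \<partial>M)"
    proof -
      have S: "{x \<in> E k. \<forall>l<k. Z l x \<in> A l} \<in> sets M"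
      proof -
        have "Measurable.pred M (\<lambda>x. Z l x \<in> A l)" if "l < k" for l using A[OF that] by measurable
        then have "Measurable.pred M (\<lambda>x. \<forall>l\<in>{..<k}. Z l x \<in> A l)" by (intro pred_intros_finite) auto
        then have "E k \<inter> {x \<in> space M. \<forall>l\<in>{..<k}. Z l x \<in> A l} \<in> sets M"
          using E_meas unfolding pred_def by (intro sets.Int)
        also have "E k \<inter> {x \<in> space M. \<forall>l\<in>{..<k}. Z l x \<in> A l} = {x \<in> E k. \<forall>l<k. Z l x \<in> A l}"
          using sets.sets_into_space[OF E_meas] by auto
        finally show ?thesis .
      qed
      have prod: "(\<Prod>l<k. f l (Z l x)) = (if \<forall>l<k. Z l x \<in> A l then 1 else 0)" for x
      proof (cases "\<forall>l<k. Z l x \<in> A l")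
        case False
        then obtain l where "l < k" "f l (Z l x) = 0" by (auto simp: f_def)
        then have "(\<Prod>l<k. f l (Z l x)) = 0" by (intro prod_zero) auto
        then show ?thesis unfolding if_not_P[OF False] .
      qed (simp add: f_def)
      have "emeasure M {x \<in> E k. \<forall>l<k. Z l x \<in> A l} = (\<integral>\<^sup>+x. indicator {x \<in> E k. \<forall>l<k. Z l x \<in> A l} x \<partial>M)"
        using S by (rule nn_integral_indicator[symmetric])
      also have "\<dots> = (\<integral>\<^sup>+x. indicator {ereal (I k x)..} (T x) * (\<Prod>l<k. f l (Z l x)) \<partial>M)"
      proof (rule nn_integral_cong_AE)
        show "AE x in M. indicator {x \<in> E k. \<forall>l<k. Z l x \<in> A l} x = indicator {ereal (I k x)..} (T x) * (\<Prod>l<k. f l (Z l x))"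
          using T_nonneg AE_space
        proof eventually_elim
          case (elim x)
          then show ?case unfolding prod
            by (cases "k = 0") (auto simp: E_def I_0 indicator_def zero_ereal_def)
        qed
      qed
      finally show ?thesis .
    qed
    \<comment> \<open>The killing time is averaged out first, with path and epochs fixed.\<close>
    also have "\<dots> = (\<integral>\<^sup>+x. \<integral>\<^sup>+w. indicator {ereal (I k x)..} (T w) * (\<Prod>l<k. f l (Z l x)) \<partial>M \<partial>M)"
    proof -
      let ?F = "\<lambda>w. indicator {ereal (I k (fst w))..} (snd w) * (\<Prod>l<k. f l (Z l (fst w)))"
      have "Z l \<in> borel_measurable ?V2" for l
        unfolding Z_def[abs_def] by (intro borel_measurable_diff J2')
      then have "(\<lambda>x. \<Prod>l<k. f l (Z l x)) \<in> borel_measurable ?V2"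
        by (intro borel_measurable_prod_ennreal measurable_compose[OF _ f])
      note G [measurable] = measurable_compose[OF measurable_fst[of ?V2 "borel :: ereal measure"] this]
      note H [measurable] = measurable_compose[OF measurable_fst[of ?V2 "borel :: ereal measure"] I2[of k]]
      have "indicator {a..} b = (if a \<le> b then 1 else 0 :: ennreal)" for a b :: ereal
        by (simp add: indicator_def)
      moreover have "(\<lambda>w. if ereal (I k (fst w)) \<le> snd w then 1 else 0 :: ennreal) \<in> borel_measurable (?V2 \<Otimes>\<^sub>M borel)"
        by measurable
      ultimately have "?F \<in> borel_measurable (?V2 \<Otimes>\<^sub>M borel)"
        by (intro borel_measurable_times_ennreal G) simp
      from indep_elements_nn_integral(1)[OF ind2 this] show ?thesis by simp
    qed
    also have "\<dots> = (\<integral>\<^sup>+x. ennreal (exp (- \<beta> * I k x)) * (\<Prod>l<k. f l (Z l x)) \<partial>M)"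
      by (intro nn_integral_cong) (simp add: nn_integral_multc T_ge I_nonneg)
    \<comment> \<open>Now the path is separated from the epochs, which stay frozen at
      \<open>w\<close>.\<close>
    also have "\<dots> = (\<integral>\<^sup>+w. \<integral>\<^sup>+x. ennreal (exp (- \<beta> * I k w)) * (\<Prod>l<k. f l (Y (max 0 (I (Suc l) w)) x - Y (max 0 (I l w)) x)) \<partial>M \<partial>M)"
    proof -
      let ?F = "\<lambda>w. ennreal (exp (- \<beta> * snd w k)) * (\<Prod>l<k. f l (Y (max 0 (snd w (Suc l))) (fst w) - Y (max 0 (snd w l)) (fst w)))"
      have G [measurable]: "(\<lambda>w. \<Prod>l<k. f l (Y (max 0 (snd w (Suc l))) (fst w) - Y (max 0 (snd w l)) (fst w))) \<in> borel_measurable (?V1 \<Otimes>\<^sub>M ?A2)"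
        by (intro borel_measurable_prod_ennreal measurable_compose[OF _ f] borel_measurable_diff J1')
      have "?F \<in> borel_measurable (?V1 \<Otimes>\<^sub>M ?A2)"
        by (intro borel_measurable_times_ennreal G) measurable
      from indep_elements_nn_integral(2)[OF ind1 this] show ?thesis by (simp add: Z_def)
    qed
    also have "\<dots> = (\<integral>\<^sup>+w. (\<Prod>l<k. ennreal (exp (- \<beta> * (I (Suc l) w - I l w))) * (\<integral>\<^sup>+x. f l (Y (max 0 (I (Suc l) w - I l w)) x) \<partial>M)) \<partial>M)"
    proof (rule nn_integral_cong)
      fix w assume w: "w \<in> space M"
      let ?\<tau> = "\<lambda>l. I l w"
      have \<tau>: "0 \<le> ?\<tau> l" "?\<tau> l \<le> ?\<tau> (Suc l)" for l
        using I_nonneg[OF w] strict_mono_leD[OF I_mono[OF w]] by auto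
      have Yt [measurable]: "Y (?\<tau> l) \<in> borel_measurable M" for l using \<tau> by simp
      have "indep_vars (\<lambda>_. borel) (\<lambda>l x. Y (?\<tau> (Suc l)) x - Y (?\<tau> l) x) UNIV"
        using \<tau> by (intro Y_indep incseq_SucI) auto
      then have "indep_vars (\<lambda>_. borel) (\<lambda>l x. f l (Y (?\<tau> (Suc l)) x - Y (?\<tau> l) x)) UNIV"
        by (rule indep_vars_compose2) simp
      then have "indep_vars (\<lambda>_. borel) (\<lambda>l x. f l (Y (?\<tau> (Suc l)) x - Y (?\<tau> l) x)) {..<k}"
        by (rule indep_vars_subset) simp
      then have "(\<integral>\<^sup>+x. (\<Prod>l<k. f l (Y (?\<tau> (Suc l)) x - Y (?\<tau> l) x)) \<partial>M) = (\<Prod>l<k. \<integral>\<^sup>+x. f l (Y (?\<tau> (Suc l)) x - Y (?\<tau> l) x) \<partial>M)"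
        by (intro indep_vars_nn_integral) auto
      also have "\<dots> = (\<Prod>l<k. \<integral>\<^sup>+x. f l (Y (max 0 (?\<tau> (Suc l) - ?\<tau> l)) x) \<partial>M)"
      proof (intro prod.cong refl)
        fix l
        have "(\<integral>\<^sup>+x. f l (Y (?\<tau> (Suc l)) x - Y (?\<tau> l) x) \<partial>M) = (\<integral>\<^sup>+z. f l z \<partial>distr M borel (\<lambda>x. Y (?\<tau> l + (?\<tau> (Suc l) - ?\<tau> l)) x - Y (?\<tau> l) x))"
          by (simp add: nn_integral_distr)
        also have "\<dots> = (\<integral>\<^sup>+x. f l (Y (max 0 (?\<tau> (Suc l) - ?\<tau> l)) x) \<partial>M)"
          using \<tau>[of l] by (subst Y_stationary) (auto simp: nn_integral_distr max_absorb2)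
        finally show "(\<integral>\<^sup>+x. f l (Y (?\<tau> (Suc l)) x - Y (?\<tau> l) x) \<partial>M) = \<dots>" .
      qed
      finally have prod: "(\<integral>\<^sup>+x. (\<Prod>l<k. f l (Y (?\<tau> (Suc l)) x - Y (?\<tau> l) x)) \<partial>M) = \<dots>" .
      have "(\<Sum>l<k. ?\<tau> (Suc l) - ?\<tau> l) = ?\<tau> k"
        using sum_lessThan_telescope[of ?\<tau> k] I_0[OF w] by simp
      then have "exp (- \<beta> * ?\<tau> k) = (\<Prod>l<k. exp (- \<beta> * (?\<tau> (Suc l) - ?\<tau> l)))"
        by (simp only: exp_sum[symmetric] finite_lessThan sum_distrib_left[symmetric])
      then have "ennreal (exp (- \<beta> * ?\<tau> k)) = (\<Prod>l<k. ennreal (exp (- \<beta> * (?\<tau> (Suc l) - ?\<tau> l))))"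
        by (simp add: prod_ennreal)
      then show "(\<integral>\<^sup>+x. ennreal (exp (- \<beta> * I k w)) * (\<Prod>l<k. f l (Y (max 0 (I (Suc l) w)) x - Y (max 0 (I l w)) x)) \<partial>M) =
          (\<Prod>l<k. ennreal (exp (- \<beta> * (I (Suc l) w - I l w))) * (\<integral>\<^sup>+x. f l (Y (max 0 (I (Suc l) w - I l w)) x) \<partial>M))"
        using prod \<tau> by (subst nn_integral_cmult) (auto simp: max_absorb2 prod.distrib)
    qed
    also have "\<dots> = (\<Prod>l<k. \<integral>\<^sup>+w. ennreal (exp (- \<beta> * (I (Suc l) w - I l w))) * (\<integral>\<^sup>+x. f l (Y (max 0 (I (Suc l) w - I l w)) x) \<partial>M) \<partial>M)"
    proof (rule indep_vars_nn_integral)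
      have "indep_vars (\<lambda>_. borel) (\<lambda>l w. ennreal (exp (- \<beta> * (I (Suc l) w - I l w))) * (\<integral>\<^sup>+x. f l (Y (max 0 (I (Suc l) w - I l w)) x) \<partial>M)) UNIV"
        by (rule indep_vars_compose2[OF I_indep, where Y = "\<lambda>l e. ennreal (exp (- \<beta> * e)) * (\<integral>\<^sup>+x. f l (Y (max 0 e) x) \<partial>M)"]) measurable
      then show "indep_vars (\<lambda>_. borel) (\<lambda>l w. ennreal (exp (- \<beta> * (I (Suc l) w - I l w))) * (\<integral>\<^sup>+x. f l (Y (max 0 (I (Suc l) w - I l w)) x) \<partial>M)) {..<k}"
        by (rule indep_vars_subset) simp
    qed auto
    also have "\<dots> = (\<Prod>l<k. ennreal p * emeasure (zlaw q) (A l))"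
    proof (intro prod.cong refl)
      fix l assume l: "l \<in> {..<k}"
      have "(\<integral>\<^sup>+w. ennreal (exp (- \<beta> * (I (Suc l) w - I l w))) * (\<integral>\<^sup>+x. f l (Y (max 0 (I (Suc l) w - I l w)) x) \<partial>M) \<partial>M) =
          (\<integral>\<^sup>+e. ennreal (exp (- \<beta> * e)) * (\<integral>\<^sup>+x. f l (Y (max 0 e) x) \<partial>M) \<partial>exponential_law \<omega>)"
        unfolding I_law[of l, symmetric] by (subst nn_integral_distr) auto
      \<comment> \<open>Damping by survival turns rate \<omega> into rate \<open>q\<close> with
        total mass \<open>p\<close>.\<close>
      also have "\<dots> = ennreal p * (\<integral>\<^sup>+e. (\<integral>\<^sup>+x. f l (Y (max 0 e) x) \<partial>M) \<partial>exponential_law q)"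
        using \<omega> \<beta> by (subst nn_integral_exp_exponential_law) (auto simp: add.commute)
      also have "(\<integral>\<^sup>+e. (\<integral>\<^sup>+x. f l (Y (max 0 e) x) \<partial>M) \<partial>exponential_law q) = (\<integral>\<^sup>+z. f l z \<partial>zlaw q)"
        by (rule nn_integral_zlaw[OF q_pos, symmetric]) simp
      also have "\<dots> = emeasure (zlaw q) (A l)"
        using l A[of l] by (simp add: f_def)
      finally show "(\<integral>\<^sup>+w. ennreal (exp (- \<beta> * (I (Suc l) w - I l w))) * (\<integral>\<^sup>+x. f l (Y (max 0 (I (Suc l) w - I l w)) x) \<partial>M) \<partial>M) =
          ennreal p * emeasure (zlaw q) (A l)" .
    qed
    finally show ?thesis by (simp add: prod.distrib)
  qed
  interpret W: stopped_walk "zlaw q" c "\<Psi> q" "\<Psi> \<beta>" p M E Z low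
  proof
    show "E 0 = space M" by (simp add: E_def)
    have "ereal (I m x) \<le> T x" if "x \<in> space M" "ereal (I n x) \<le> T x" "m \<le> n" for m n x
      using strict_mono_leD[OF I_mono[OF that(1)] that(3)] that(2) by (meson ereal_less_eq(3) order_trans)
    then show "decseq E" by (auto simp: decseq_def E_def split: if_splits)
  qed (use low_mgf E_law in auto)
  \<comment> \<open>For negative \<open>T x\<close> not even epoch 0 counts and the supremum is over
    the empty set, whereas \<open>W.R\<close> always sees \<open>E 0\<close>; this affects a null
    set only.\<close>
  have max_eq: "inspected_max Y I T x = (if 0 \<le> T x then W.R x else Sup {})" if "x \<in> space M" for x
  proof (cases "0 \<le> T x")
    case True
    then have "{n. ereal (I n x) \<le> T x} = {n. x \<in> E n}"
      using that by (auto simp: E_def I_0 zero_ereal_def[symmetric] split: if_splits)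
    with True show ?thesis using that by (simp add: inspected_max_def W.R_def Z_sum)
  next
    case False
    then have "\<not> ereal (I n x) \<le> T x" for n
      using I_nonneg[OF that, of n] by (metis ereal_less_eq(5) order_trans)
    with False show ?thesis by (simp add: inspected_max_def)
  qed
  \<comment> \<open>The explicit case distinction exhibits measurability, which is required before
    changing the integrand on a null set.\<close>
  have "(\<integral>x. exp (- \<alpha> * inspected_max Y I T x) \<partial>M) = (\<integral>x. exp (- \<alpha> * (if 0 \<le> T x then W.R x else Sup {})) \<partial>M)"
    by (intro Bochner_Integration.integral_cong) (auto simp: max_eq)
  also have "\<dots> = (\<integral>x. exp (- \<alpha> * W.R x) \<partial>M)"
  proof (rule integral_cong_AE)
    show "AE x in M. exp (- \<alpha> * (if 0 \<le> T x then W.R x else Sup {})) = exp (- \<alpha> * W.R x)"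
      using T_nonneg by (rule eventually_mono) simp
  qed measurable
  finally show ?thesis using W.laplace_R[OF \<alpha>] by simp
qed

end

theorem proposition2:
  fixes M :: "'a measure" and Y :: "real \<Rightarrow> 'a \<Rightarrow> real" and \<alpha> \<beta> \<omega> :: real
  assumes "spectrally_negative_levy M Y"
    and "\<omega> > 0" and "\<beta> \<ge> 0" and "\<beta> = 0 \<Longrightarrow> ext_expectation M (Y 1) < 0"
    and "\<alpha> \<ge> 0"
  defines "\<Psi> \<equiv> right_inverse_exponent M Y"
  shows "(\<forall>(K :: 'b measure) Z N. killed_skeleton M Y \<beta> \<omega> K Z N \<longrightarrow>
            (\<integral>x. exp (- \<alpha> * skeleton_max Z N x) \<partial>K) =
              \<Psi> \<beta> / (\<Psi> \<beta> + \<alpha>) * ((\<Psi> (\<beta> + \<omega>) + \<alpha>) / \<Psi> (\<beta> + \<omega>))) \<and>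
         (\<forall>I T. poisson_inspection M Y \<beta> \<omega> I T \<longrightarrow>
            (\<integral>x. exp (- \<alpha> * inspected_max Y I T x) \<partial>M) =
              \<Psi> \<beta> / (\<Psi> \<beta> + \<alpha>) * ((\<Psi> (\<beta> + \<omega>) + \<alpha>) / \<Psi> (\<beta> + \<omega>)))"
proof -
  interpret prob_space M
    using assms(1) by (simp add: spectrally_negative_levy_def levy_process_def)
  interpret killed_levy M Y \<beta> \<omega>
    by unfold_locales (use assms in auto)
  show ?thesis
    unfolding \<Psi>_def using skeleton_laplace inspection_laplace \<open>\<alpha> \<ge> 0\<close> by blast
qed

end
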